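(* Let $1\le p\le 2$ and let $\mu$ be a positive Borel measure on $[0,1)$ which is a $1$-Carleson measure. Then $\mathcal{DH}_\mu$ is a compact operator from $H^p$ into $H^p$ if and only if $\mu$ is a vanishing $2$-Carleson measure.
   Context: $\mathbb{D}$ is the open unit disc in $\mathbb{C}$. For $0<p<\infty$, the Hardy space $H^p$ consists of all analytic $f$ on $\mathbb{D}$ with $\|f\|_{H^p}=\sup_{0<r<1}\left(\frac1{2\pi}\int_0^{2\pi}|f(re^{i\theta})|^p\,d\theta\right)^{1/p}<\infty$. For a positive Borel measure $\mu$ on $[0,1)$, let $\mu_n=\int_{[0,1)}t^n\,d\mu(t)$, and for $f(z)=\sum_{k=0}^\infty a_kz^k$ analytic on $\mathbb{D}$ put $$\mathcal{DH}_\mu(f)(z)=\sum_{n=0}^\infty (n+1)\Big(\sum_{k=0}^\infty \mu_{n+k}a_k\Big)z^n .$$ When $1\le p<\infty$ and $\mu$ is a $1$-Carleson measure, this is a well-defined analytic function on $\mathbb{D}$ for every $f\in H^p$. For $s>0$, a positive Borel measure $\mu$ on $[0,1)$ is an $s$-Carleson measure if there is a constant $C>0$ with $\mu([t,1))\le C(1-t)^s$ for all $0\le t<1$; it is a vanishing $s$-Carleson measure if moreover $\lim_{t\to1^-}\mu([t,1))/(1-t)^s=0$. *)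

theory Defs
  imports "HOL-Complex_Analysis.Complex_Analysis"
begin

definition hardy_mean :: "real \<Rightarrow> (complex \<Rightarrow> complex) \<Rightarrow> real \<Rightarrow> real" where
  "hardy_mean p f r =
     (1 / (2 * pi) * integral {0..2 * pi} (\<lambda>\<theta>. norm (f (of_real r * cis \<theta>)) powr p)) powr (1 / p)"

text \<open>
  Elements of the Hardy space are total functions whose values off the open unit disc are
  arbitrary; every notion below depends only on the values on the disc.
\<close>

definition hardy :: "real \<Rightarrow> (complex \<Rightarrow> complex) set" where
  "hardy p = {f. f holomorphic_on ball 0 1 \<and> bdd_above (hardy_mean p f ` {0<..<1})}"

text \<open>The real supremum is the intended norm only on \<open>hardy p\<close>, where it is finite.\<close>

definition hardy_norm :: "real \<Rightarrow> (complex \<Rightarrow> complex) \<Rightarrow> real" where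
  "hardy_norm p f = (SUP r\<in>{0<..<1}. hardy_mean p f r)"

definition hardy_linear :: "real \<Rightarrow> ((complex \<Rightarrow> complex) \<Rightarrow> complex \<Rightarrow> complex) \<Rightarrow> bool" where
  "hardy_linear p T \<longleftrightarrow>
     (\<forall>f\<in>hardy p. \<forall>g\<in>hardy p. \<forall>z\<in>ball 0 1. T (\<lambda>w. f w + g w) z = T f z + T g z) \<and>
     (\<forall>c. \<forall>f\<in>hardy p. \<forall>z\<in>ball 0 1. T (\<lambda>w. c * f w) z = c * T f z)"

text \<open>
  A compact operator is a linear map sending every norm-bounded sequence to a sequence with a
  norm-convergent subsequence, the limit being in the space.
\<close>

definition hardy_compact_operator ::
    "real \<Rightarrow> ((complex \<Rightarrow> complex) \<Rightarrow> complex \<Rightarrow> complex) \<Rightarrow> bool" where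
  "hardy_compact_operator p T \<longleftrightarrow>
     (\<forall>f\<in>hardy p. T f \<in> hardy p) \<and>
     hardy_linear p T \<and>
     (\<forall>F :: nat \<Rightarrow> complex \<Rightarrow> complex.
        (\<forall>j. F j \<in> hardy p) \<and> bdd_above (range (\<lambda>j. hardy_norm p (F j))) \<longrightarrow>
        (\<exists>g\<in>hardy p. \<exists>\<sigma> :: nat \<Rightarrow> nat. strict_mono \<sigma> \<and>
           (\<lambda>j. hardy_norm p (\<lambda>z. T (F (\<sigma> j)) z - g z)) \<longlonglongrightarrow> 0))"

definition borel_measure_on_unit :: "real measure \<Rightarrow> bool" where
  "borel_measure_on_unit \<mu> \<longleftrightarrow> sets \<mu> = sets (restrict_space borel {0..<1})"

definition carleson :: "real \<Rightarrow> real measure \<Rightarrow> bool" where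
  "carleson s \<mu> \<longleftrightarrow>
     (\<exists>C>0. \<forall>t\<in>{0..<1}. emeasure \<mu> {t..<1} \<le> ennreal (C * (1 - t) powr s))"

text \<open>Being \<open>carleson s\<close> makes all the measures in the limit finite, so \<open>measure\<close> is faithful.\<close>

definition vanishing_carleson :: "real \<Rightarrow> real measure \<Rightarrow> bool" where
  "vanishing_carleson s \<mu> \<longleftrightarrow>
     carleson s \<mu> \<and> ((\<lambda>t. measure \<mu> {t..<1} / (1 - t) powr s) \<longlongrightarrow> 0) (at_left 1)"

definition moment :: "real measure \<Rightarrow> nat \<Rightarrow> real" where
  "moment \<mu> n = (LINT t|\<mu>. t ^ n)"

definition DH :: "real measure \<Rightarrow> (complex \<Rightarrow> complex) \<Rightarrow> complex \<Rightarrow> complex" where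
  "DH \<mu> f z =
     (\<Sum>n. of_nat (n + 1) *
        (\<Sum>k. of_real (moment \<mu> (n + k)) * fps_nth (fps_expansion f 0) k) * z ^ n)"

end

theory Submission
  imports Defs "HOL-Computational_Algebra.Fundamental_Theorem_Algebra"
begin

text \<open>
  On the Hardy space the operator is the integral operator
  \<open>T f z = \<integral> f t / (1 - t z)\<^sup>2 d\<mu>(t)\<close>.

  If \<open>\<mu>([t,1)) \<le> N (1 - t)\<^sup>2\<close>, then \<open>d\<mu>/(1 - t)\<close> is a 1-Carleson measure with constant
  \<open>O(N)\<close> and the kernel is comparable to the Poisson kernel \<open>P\<close> times \<open>1/(1 - t)\<close>. Two Schur
  tests, with powers of \<open>1 - t\<close> and \<open>\<bar>1 - z\<bar>\<close> as weights, give \<open>\<parallel>T\<parallel> = O(N)\<close>. The first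
  bounds \<open>\<integral> \<bar>f t\<bar>\<^sup>p / (1 - t) d\<mu>\<close> by \<open>\<parallel>f\<parallel>\<^sup>p\<close>: it applies the \<open>L\<^sup>2\<close> bound for Poisson
  integrals to \<open>\<bar>f\<bar>\<^bsup>p/2\<^esup> \<le> P[\<bar>f\<bar>\<^bsup>p/2\<^esup>]\<close>, which covers \<open>p = 1\<close> as well. The second
  bounds \<open>\<parallel>T f\<parallel>\<^sup>p\<close> by that integral; its weights need \<open>p \<le> 2\<close>. For a vanishing measure the
  restriction to \<open>[\<rho>,1)\<close> has small constant, and the restriction to \<open>[0,\<rho>)\<close> sends locally
  uniformly convergent sequences to norm convergent ones, so Montel's theorem gives compactness.

  Conversely, compactness is tested on \<open>(1 - a)\<^bsup>2 - 1/p\<^esup> / (1 - a z)\<^sup>2\<close>: the value of the image at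
  \<open>a\<close> dominates \<open>\<mu>([a,1)) (1 - a)\<^bsup>-2-1/p\<^esup>\<close>, while point evaluation at \<open>a\<close> has norm
  \<open>O((1 - a)\<^bsup>-1/p\<^esup>)\<close>. This first shows that \<open>\<mu>\<close> is 2-Carleson; then the images tend to zero
  pointwise as \<open>a \<rightarrow> 1\<close>, so every norm limit vanishes on the radius.
\<close>

section \<open>Poisson integrals and subharmonicity\<close>

text \<open>The functions carry no boundary values, so every estimate is made on a circle of radius
  r < 1 with a constant that does not depend on r. For z on that circle the Poisson kernel at r * t
  has denominator |1 - t z|^2, exactly that of the operator; this is why dilated points appear
  throughout. Integrals are taken in the extended nonnegative reals: Tonelli and comparison then
  apply before anything is known to be finite, and membership in the Hardy space comes out as a
  result. Both Schur tests rest on one fact: integrating |1 - t z|^(-3/2) against d\<mu>/(1 - t)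
  costs |1 - z|^(-1/2). That weight is comparable with the real part of the analytic function (1 -
  z)^(-1/2), so its Poisson integral can be evaluated instead of estimated. In the second test it
  appears to the power p - 1 and is controlled up to the first power. The bound has to be
  proportional to the tail constant N (to N^p for p-th powers), since smallness near 1 is extracted
  from nothing else.\<close>

definition circ :: "real measure" where
  "circ = uniform_measure lborel {0..2 * pi}"

definition pois :: "real \<Rightarrow> real \<Rightarrow> real" where
  "pois u \<theta> = (1 - u\<^sup>2) / (norm (1 - of_real u * cis \<theta>))\<^sup>2"

lemma sets_circ [measurable_cong, simp]: "sets circ = sets borel"
  by (simp add: circ_def)

lemma space_circ [simp]: "space circ = UNIV"
  by (simp add: circ_def)

lemma emeasure_circ_UNIV: "emeasure circ UNIV = 1"
proof -
  have "emeasure circ UNIV = emeasure lborel {0..2 * pi} / emeasure lborel {0..2 * pi}"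
    unfolding circ_def by (subst emeasure_uniform_measure) auto
  also have "\<dots> = 1"
    by (rule ennreal_divide_self) (auto simp: less_le)
  finally show ?thesis .
qed

lemma finite_measure_circ: "finite_measure circ"
  by standard (simp add: emeasure_circ_UNIV)

text \<open>The bridge between the gauge integral, in which \<open>hardy_mean\<close> and Cauchy's
  formula are stated, and the nonnegative integral, in which all estimates are carried out.\<close>

lemma nn_integral_circ_continuous:
  assumes "continuous_on UNIV g" and "\<And>\<theta>. 0 \<le> g \<theta>"
  shows "(\<integral>\<^sup>+\<theta>. ennreal (g \<theta>) \<partial>circ) = ennreal (1 / (2 * pi) * integral {0..2 * pi} g)"
proof -
  have m: "g \<in> borel_measurable borel"
    using assms(1) by (rule borel_measurable_continuous_onI)
  have "continuous_on {0..2 * pi} g"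
    using assms(1) continuous_on_subset by blast
  then have "(g has_integral integral {0..2 * pi} g) {0..2 * pi}"
    by (simp add: integrable_continuous_real integrable_integral)
  then have I: "(\<integral>\<^sup>+\<theta>\<in>{0..2 * pi}. ennreal (g \<theta>) \<partial>lborel) = ennreal (integral {0..2 * pi} g)"
    using assms(2) nn_integral_has_integral_lebesgue' by blast
  have nn: "0 \<le> integral {0..2 * pi} g"
    by (rule integral_nonneg) (use assms in \<open>auto intro!: integrable_continuous_real continuous_on_subset[OF assms(1)]\<close>)
  have "(\<integral>\<^sup>+\<theta>. ennreal (g \<theta>) \<partial>circ)
      = (\<integral>\<^sup>+\<theta>\<in>{0..2 * pi}. ennreal (g \<theta>) \<partial>lborel) / emeasure lborel {0..2 * pi}"
    unfolding circ_def by (subst nn_integral_uniform_measure) (use m in auto)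
  also have "\<dots> = ennreal (integral {0..2 * pi} g) / ennreal (2 * pi)"
    by (simp add: I)
  also have "\<dots> = ennreal (1 / (2 * pi) * integral {0..2 * pi} g)"
    using nn by (simp add: divide_ennreal)
  finally show ?thesis .
qed

lemma norm_one_minus_cis_pos:
  assumes "\<bar>u\<bar> < 1" shows "0 < norm (1 - of_real u * cis \<theta>)"
proof -
  have "norm (of_real u * cis \<theta>) < 1"
    using assms by (simp add: norm_mult)
  then have "of_real u * cis \<theta> \<noteq> 1" by auto
  then show ?thesis by simp
qed

lemma pois_nonneg: "\<bar>u\<bar> < 1 \<Longrightarrow> 0 \<le> pois u \<theta>"
  by (simp add: pois_def abs_square_le_1)

lemma continuous_cis [continuous_intros]: "continuous_on S f \<Longrightarrow> continuous_on S (\<lambda>x. cis (f x))"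
  by (auto simp: cis_conv_exp intro!: continuous_intros)

lemma continuous_pois: "\<bar>u\<bar> < 1 \<Longrightarrow> continuous_on S (pois u)"
  unfolding pois_def
  by (intro continuous_intros) (use norm_one_minus_cis_pos in force)

lemma pois_le:
  assumes "0 \<le> u" "u < 1"
  shows "pois u \<theta> \<le> 2 / (1 - u)"
proof -
  have "1 - u \<le> norm (1 - of_real u * cis \<theta>)"
    using norm_triangle_ineq2[of 1 "of_real u * cis \<theta>"] assms by (simp add: norm_mult)
  then have "(1 - u)\<^sup>2 \<le> (norm (1 - of_real u * cis \<theta>))\<^sup>2"
    using assms by (intro power_mono) auto
  then have "pois u \<theta> \<le> (1 - u\<^sup>2) / (1 - u)\<^sup>2"
    unfolding pois_def using assms by (intro divide_left_mono) (auto simp: abs_square_le_1 intro!: mult_pos_pos)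
  also have "\<dots> = (1 + u) / (1 - u)"
  proof -
    have "1 - u\<^sup>2 = (1 + u) * (1 - u)" by (simp add: power2_eq_square algebra_simps)
    then show ?thesis using assms by (simp add: power2_eq_square)
  qed
  also have "\<dots> \<le> 2 / (1 - u)"
    using assms by (intro divide_right_mono) auto
  finally show ?thesis .
qed

text \<open>Cauchy's formula for \<open>h z / (1 - u z)\<close> at the point \<open>u\<close>.\<close>

lemma poisson_has_integral:
  assumes h: "h holomorphic_on ball 0 1" "continuous_on (cball 0 1) h" and u: "0 \<le> u" "u < 1"
  shows "((\<lambda>\<theta>. h (cis \<theta>) * of_real (pois u \<theta>)) has_integral 2 * of_real pi * h (of_real u)) {0..2 * pi}"
proof -
  have nz: "1 - of_real u * z \<noteq> 0" if "norm z \<le> 1" for z :: complex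
  proof
    assume "1 - of_real u * z = 0"
    then have "norm (of_real u * z) = 1" by simp
    moreover have "norm (of_real u * z) \<le> u"
      using that u by (simp add: norm_mult mult_left_le)
    ultimately show False using u by simp
  qed
  define F where "F z = h z / (1 - of_real u * z)" for z
  have "continuous_on (cball 0 1) F" "F holomorphic_on ball 0 1"
    unfolding F_def using nz by (auto intro!: continuous_intros holomorphic_intros h)
  then have "((\<lambda>z. F z / (z - of_real u)) has_contour_integral 2 * of_real pi * \<i> * F (of_real u)) (circlepath 0 1)"
    using u by (intro Cauchy_integral_circlepath) auto
  then have "((\<lambda>\<theta>. F (cis \<theta>) / (cis \<theta> - of_real u) * \<i> * cis \<theta>) has_integral
      2 * of_real pi * \<i> * F (of_real u)) {0..2 * pi}"
    unfolding circlepath_def by (subst (asm) has_contour_integral_part_circlepath_iff) auto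
  \<comment> \<open>At the pole \<open>F u = h u / (1 - u\<^sup>2)\<close>; this factor clears the
    denominator and becomes the numerator of the Poisson kernel.\<close>
  from has_integral_mult_right[OF this, of "of_real (1 - u\<^sup>2) / \<i>"]
  have I: "((\<lambda>\<theta>. of_real (1 - u\<^sup>2) / \<i> * (F (cis \<theta>) / (cis \<theta> - of_real u) * \<i> * cis \<theta>)) has_integral
      of_real (1 - u\<^sup>2) / \<i> * (2 * of_real pi * \<i> * F (of_real u))) {0..2 * pi}" .
  have c1: "of_real (1 - u\<^sup>2) / \<i> * (2 * of_real pi * \<i> * F (of_real u)) = 2 * of_real pi * h (of_real u)"
  proof -
    have "1 - of_real u * of_real u \<noteq> (0::complex)"
      using nz[of "of_real u"] u by simp
    then show ?thesis by (simp add: F_def power2_eq_square field_simps)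
  qed
  \<comment> \<open>On the circle \<open>cnj z = 1 / z\<close>, hence (1 - u z)(z - u) = z |1 - u
    z|^2, and the Cauchy kernel turns into the Poisson kernel.\<close>
  have c2: "of_real (1 - u\<^sup>2) / \<i> * (F (cis \<theta>) / (cis \<theta> - of_real u) * \<i> * cis \<theta>)
      = h (cis \<theta>) * of_real (pois u \<theta>)" for \<theta>
  proof -
    have n1: "1 - of_real u * cis \<theta> \<noteq> 0" by (rule nz) simp
    have n2: "cis \<theta> - of_real u \<noteq> 0"
    proof
      assume "cis \<theta> - of_real u = 0"
      then have "norm (cis \<theta>) = norm (of_real u :: complex)" by simp
      then show False using u by simp
    qed
    have cc: "cis \<theta> * cnj (cis \<theta>) = 1"
      by (simp add: cis_cnj cis_mult)
    have "of_real ((norm (1 - of_real u * cis \<theta>))\<^sup>2) = (1 - of_real u * cis \<theta>) * cnj (1 - of_real u * cis \<theta>)"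
      by (rule complex_norm_square)
    moreover have "cis \<theta> * cnj (1 - of_real u * cis \<theta>) = cis \<theta> - of_real u"
      using cc by (simp add: algebra_simps)
    ultimately have *: "cis \<theta> * of_real ((norm (1 - of_real u * cis \<theta>))\<^sup>2)
        = (1 - of_real u * cis \<theta>) * (cis \<theta> - of_real u)"
      by (metis mult.left_commute)
    have n3: "of_real ((norm (1 - of_real u * cis \<theta>))\<^sup>2) \<noteq> (0::complex)"
      using n1 by simp
    have "cis \<theta> / ((1 - of_real u * cis \<theta>) * (cis \<theta> - of_real u))
        = 1 / of_real ((norm (1 - of_real u * cis \<theta>))\<^sup>2)"
      unfolding frac_eq_eq[OF no_zero_divisors[OF n1 n2] n3] using * by simp
    then have "of_real (1 - u\<^sup>2) * h (cis \<theta>) * (cis \<theta> / ((1 - of_real u * cis \<theta>) * (cis \<theta> - of_real u)))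
       = of_real (1 - u\<^sup>2) * h (cis \<theta>) * (1 / of_real ((norm (1 - of_real u * cis \<theta>))\<^sup>2))"
      by simp
    then show ?thesis
      by (simp add: F_def pois_def mult_ac)
  qed
  show ?thesis using I unfolding c1 c2 .
qed

lemma poisson_norm_le:
  assumes h: "h holomorphic_on ball 0 1" "continuous_on (cball 0 1) h" and u: "0 \<le> u" "u < 1"
  shows "ennreal (norm (h (of_real u))) \<le> (\<integral>\<^sup>+\<theta>. ennreal (norm (h (cis \<theta>)) * pois u \<theta>) \<partial>circ)"
proof -
  have c: "continuous_on UNIV (\<lambda>\<theta>. h (cis \<theta>))"
    by (rule continuous_on_compose2[OF h(2)]) (auto intro!: continuous_intros)
  have c': "continuous_on UNIV (\<lambda>\<theta>. norm (h (cis \<theta>)) * pois u \<theta>)"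
    using u by (intro continuous_intros c continuous_pois) auto
  have "norm (integral {0..2 * pi} (\<lambda>\<theta>. h (cis \<theta>) * of_real (pois u \<theta>)))
      \<le> integral {0..2 * pi} (\<lambda>\<theta>. norm (h (cis \<theta>)) * pois u \<theta>)"
  proof (rule integral_norm_bound_integral)
    show "(\<lambda>\<theta>. h (cis \<theta>) * of_real (pois u \<theta>)) integrable_on {0..2 * pi}"
      using poisson_has_integral[OF assms] by blast
    show "(\<lambda>\<theta>. norm (h (cis \<theta>)) * pois u \<theta>) integrable_on {0..2 * pi}"
      using c' by (intro integrable_continuous_real) (rule continuous_on_subset, auto)
    show "norm (h (cis \<theta>) * of_real (pois u \<theta>)) \<le> norm (h (cis \<theta>)) * pois u \<theta>" for \<theta>
      using pois_nonneg[of u \<theta>] u by (simp add: norm_mult)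
  qed
  moreover have "integral {0..2 * pi} (\<lambda>\<theta>. h (cis \<theta>) * of_real (pois u \<theta>)) = 2 * of_real pi * h (of_real u)"
    using poisson_has_integral[OF assms] by blast
  ultimately have "norm (h (of_real u)) \<le> 1 / (2 * pi) * integral {0..2 * pi} (\<lambda>\<theta>. norm (h (cis \<theta>)) * pois u \<theta>)"
    by (simp add: norm_mult field_simps)
  then show ?thesis
    using u by (subst nn_integral_circ_continuous[OF c']) (auto intro!: ennreal_leI pois_nonneg mult_nonneg_nonneg)
qed

text \<open>Equality for real parts allows a Poisson integral to be computed by naming an analytic
  function: the constant 1 gives the total mass, an inverse square root gives the weight needed
  later.\<close>

lemma poisson_Re:
  assumes h: "h holomorphic_on ball 0 1" "continuous_on (cball 0 1) h" and u: "0 \<le> u" "u < 1"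
    and nn: "\<And>\<theta>. 0 \<le> Re (h (cis \<theta>))"
  shows "(\<integral>\<^sup>+\<theta>. ennreal (Re (h (cis \<theta>)) * pois u \<theta>) \<partial>circ) = ennreal (Re (h (of_real u)))"
proof -
  have c: "continuous_on UNIV (\<lambda>\<theta>. h (cis \<theta>))"
    by (rule continuous_on_compose2[OF h(2)]) (auto intro!: continuous_intros)
  have c': "continuous_on UNIV (\<lambda>\<theta>. Re (h (cis \<theta>)) * pois u \<theta>)"
    using u by (intro continuous_intros c continuous_pois) auto
  have "((\<lambda>\<theta>. Re (h (cis \<theta>) * of_real (pois u \<theta>))) has_integral Re (2 * of_real pi * h (of_real u))) {0..2 * pi}"
    using has_integral_linear[OF poisson_has_integral[OF h u] bounded_linear_Re] by (simp add: o_def)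
  then have "integral {0..2 * pi} (\<lambda>\<theta>. Re (h (cis \<theta>)) * pois u \<theta>) = 2 * pi * Re (h (of_real u))"
    by (intro integral_unique) simp
  then show ?thesis
    using u nn by (subst nn_integral_circ_continuous[OF c']) (auto intro!: pois_nonneg mult_nonneg_nonneg)
qed

lemma nn_integral_pois:
  assumes "0 \<le> u" "u < 1"
  shows "(\<integral>\<^sup>+\<theta>. ennreal (pois u \<theta>) \<partial>circ) = 1"
  using poisson_Re[of "\<lambda>_. 1" u] assms by simp

lemma norm_powr_of_real:
  fixes w :: complex
  assumes "w \<noteq> 0" shows "norm (w powr of_real q) = norm w powr q"
  using assms by (simp add: powr_def)

text \<open>Replacing a zero \<open>a\<close> in the disc by the zero \<open>1 / cnj a\<close> does not change the modulus on the
  circle and increases it inside; for polynomials this leaves a zero-free function whose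
  \<open>q\<close>-th power is analytic.\<close>

lemma linear_factor_majorant:
  fixes a :: complex
  assumes q: "q > 0"
  shows "\<exists>h. h holomorphic_on ball 0 1 \<and> continuous_on (cball 0 1) h \<and>
     (\<forall>z\<in>ball 0 1. norm (z - a) powr q \<le> norm (h z)) \<and>
     (\<forall>z\<in>sphere 0 1. norm (h z) = norm (z - a) powr q)"
proof (cases "norm a < 1")
  case True
  have pos: "0 < Re (1 - cnj a * z)" if "norm z \<le> 1" for z
  proof -
    have "norm (cnj a * z) < 1"
      using mult_left_mono[OF that norm_ge_zero[of a]] True by (simp add: norm_mult)
    then have "Re (cnj a * z) < 1"
      using complex_Re_le_cmod[of "cnj a * z"] by linarith
    then show ?thesis by simp
  qed
  \<comment> \<open>The right side vanishes for \<open>norm z = 1\<close> and is nonnegative inside,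
    which yields equality on the circle and domination in the disc at once.\<close>
  have id: "(norm (1 - cnj a * z))\<^sup>2 - (norm (z - a))\<^sup>2 = (1 - (norm a)\<^sup>2) * (1 - (norm z)\<^sup>2)" for z
    unfolding cmod_power2 by (simp add: power2_eq_square algebra_simps)
  define h where "h z = (1 - cnj a * z) powr of_real q" for z
  have nh: "norm (h z) = norm (1 - cnj a * z) powr q" if "norm z \<le> 1" for z
    unfolding h_def using pos[OF that] by (intro norm_powr_of_real) (metis less_irrefl zero_complex.sel(1))
  have nr: "1 - cnj a * z \<notin> \<real>\<^sub>\<le>\<^sub>0" if "norm z \<le> 1" for z
    using pos[OF that] unfolding complex_nonpos_Reals_iff by linarith
  show ?thesis
  proof (intro exI[of _ h] conjI ballI)
    show "h holomorphic_on ball 0 1"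
      unfolding h_def using nr by (intro holomorphic_intros) auto
    show "continuous_on (cball 0 1) h"
      unfolding h_def
    proof (intro continuous_on_powr_complex continuous_intros)
      show "cball 0 1 \<subseteq> {z. 0 \<le> Re (1 - cnj a * z) \<or> Im (1 - cnj a * z) \<noteq> 0}"
        by (rule subsetI, rule CollectI, rule disjI1, rule less_imp_le[OF pos]) simp
    qed (use q in simp)
    fix z :: complex assume z: "z \<in> ball 0 1"
    have "0 \<le> (1 - (norm a)\<^sup>2) * (1 - (norm z)\<^sup>2)"
      using z True by (intro mult_nonneg_nonneg) (auto simp: abs_square_le_1)
    then have "(norm (z - a))\<^sup>2 \<le> (norm (1 - cnj a * z))\<^sup>2"
      using id[of z] by linarith
    then have "norm (z - a) \<le> norm (1 - cnj a * z)"
      by (rule power2_le_imp_le) (rule norm_ge_zero)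
    then show "norm (z - a) powr q \<le> norm (h z)"
      using z q by (subst nh) (auto intro!: powr_mono2)
  next
    fix z :: complex assume z: "z \<in> sphere 0 1"
    then have "(norm (1 - cnj a * z))\<^sup>2 = (norm (z - a))\<^sup>2"
      using id[of z] by simp
    then have "norm (1 - cnj a * z) = norm (z - a)"
      by (rule power2_eq_imp_eq) (rule norm_ge_zero)+
    then show "norm (h z) = norm (z - a) powr q"
      using z by (subst nh) auto
  qed
next
  case False
  then have a0: "a \<noteq> 0" by auto
  have le: "norm (z / a) \<le> norm z" for z
    using False a0 divide_left_mono[of 1 "norm a" "norm z"] by (simp add: norm_divide)
  have pos: "0 < Re (1 - z / a)" if "norm z < 1" for z
    using complex_Re_le_cmod[of "z / a"] le[of z] that by simp
  have nr: "1 - z / a \<notin> \<real>\<^sub>\<le>\<^sub>0" if "norm z < 1" for z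
    using pos[OF that] unfolding complex_nonpos_Reals_iff by linarith
  have nonneg: "0 \<le> Re (1 - z / a)" if "norm z \<le> 1" for z
    using complex_Re_le_cmod[of "z / a"] le[of z] that by simp
  \<comment> \<open>A zero on or outside the circle stays where it is: 1 - z/a has positive real
    part in the open disc. For \<open>norm a = 1\<close> it vanishes at the boundary point a, where
    the power is still continuous because q is positive.\<close>
  define h where "h z = of_real (norm a powr q) * (1 - z / a) powr of_real q" for z
  have nh: "norm (h z) = norm (z - a) powr q" for z
  proof (cases "z = a")
    case True
    then show ?thesis using a0 q by (simp add: h_def)
  next
    case z: False
    have "norm (h z) = norm a powr q * norm (1 - z / a) powr q"
      unfolding h_def norm_mult using z a0 by (subst norm_powr_of_real) auto
    also have "\<dots> = norm (a * (1 - z / a)) powr q"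
      by (simp add: powr_mult norm_mult)
    also have "a * (1 - z / a) = a - z"
      using a0 by (simp add: field_simps)
    finally show ?thesis by (simp add: norm_minus_commute)
  qed
  show ?thesis
  proof (intro exI[of _ h] conjI ballI)
    show "h holomorphic_on ball 0 1"
      unfolding h_def using nr a0 by (intro holomorphic_intros) auto
    show "continuous_on (cball 0 1) h"
      unfolding h_def
    proof (intro continuous_on_mult continuous_on_powr_complex continuous_intros)
      show "cball 0 1 \<subseteq> {z. 0 \<le> Re (1 - z / a) \<or> Im (1 - z / a) \<noteq> 0}"
        by (rule subsetI, rule CollectI, rule disjI1, rule nonneg) simp
    qed (use q a0 in simp_all)
  qed (simp_all add: nh)
qed

text \<open>Moduli are multiplicative, so the majorants of the linear factors multiply; the leading
  coefficient enters through the constant polynomial at the base of the induction.\<close>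

lemma poly_majorant:
  fixes P :: "complex poly"
  assumes q: "q > 0"
  shows "\<exists>h. h holomorphic_on ball 0 1 \<and> continuous_on (cball 0 1) h \<and>
     (\<forall>z\<in>ball 0 1. norm (poly P z) powr q \<le> norm (h z)) \<and>
     (\<forall>z\<in>sphere 0 1. norm (h z) = norm (poly P z) powr q)"
proof (induction "degree P" arbitrary: P)
  case 0
  then obtain c where "P = [:c:]" by (metis degree_0_id degree_eq_zeroE)
  then show ?case
    by (intro exI[of _ "\<lambda>_. of_real (norm c powr q)"]) auto
next
  case (Suc n)
  then have "\<not> constant (poly P)" by (metis constant_degree nat.distinct(1))
  then obtain a where "poly P a = 0" using fundamental_theorem_of_algebra by blast
  then obtain Q where Q: "P = [:-a, 1:] * Q" by (auto simp: poly_eq_0_iff_dvd)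
  have "Q \<noteq> 0" using Q Suc.hyps(2) by auto
  then have "degree P = Suc (degree Q)"
    unfolding Q by (subst degree_mult_eq) auto
  then have "n = degree Q" using Suc.hyps(2) by simp
  from Suc.hyps(1)[OF this] obtain h where h: "h holomorphic_on ball 0 1" "continuous_on (cball 0 1) h"
     "\<And>z. z\<in>ball 0 1 \<Longrightarrow> norm (poly Q z) powr q \<le> norm (h z)"
     "\<And>z. z\<in>sphere 0 1 \<Longrightarrow> norm (h z) = norm (poly Q z) powr q" by blast
  from linear_factor_majorant[OF q, of a] obtain l where l: "l holomorphic_on ball 0 1" "continuous_on (cball 0 1) l"
     "\<And>z. z\<in>ball 0 1 \<Longrightarrow> norm (z - a) powr q \<le> norm (l z)"
     "\<And>z. z\<in>sphere 0 1 \<Longrightarrow> norm (l z) = norm (z - a) powr q" by blast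
  have P: "norm (poly P z) powr q = norm (z - a) powr q * norm (poly Q z) powr q" for z
    by (simp add: Q norm_mult[symmetric] powr_mult[symmetric] algebra_simps)
  show ?case
  proof (intro exI[of _ "\<lambda>z. l z * h z"] conjI ballI)
    show "(\<lambda>z. l z * h z) holomorphic_on ball 0 1"
      by (rule holomorphic_on_mult[OF l(1) h(1)])
    show "continuous_on (cball 0 1) (\<lambda>z. l z * h z)"
      by (rule continuous_on_mult[OF l(2) h(2)])
    show "norm (poly P z) powr q \<le> norm (l z * h z)" if "z \<in> ball 0 1" for z
      unfolding P norm_mult by (rule mult_mono[OF l(3)[OF that] h(3)[OF that]]) simp_all
    show "norm (l z * h z) = norm (poly P z) powr q" if "z \<in> sphere 0 1" for z
      unfolding P norm_mult using l(4)[OF that] h(4)[OF that] by simp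
  qed
qed

text \<open>The majorant is built from finitely many zeros, so the inequality is proved for the
  Taylor polynomials of f (R z) and passed to the limit; R < 1 makes them uniformly bounded on the
  closed disc. Exponents q below 1 occur (q = p/2), and for these the case q = 1 and Jensen's
  inequality would point the wrong way.\<close>

lemma subharmonic_powr:
  assumes f: "f holomorphic_on ball 0 1" and R: "0 \<le> R" "R < 1" and u: "0 \<le> u" "u < 1" and q: "q > 0"
  shows "ennreal (norm (f (of_real (R * u))) powr q)
    \<le> (\<integral>\<^sup>+\<theta>. ennreal (norm (f (of_real R * cis \<theta>)) powr q * pois u \<theta>) \<partial>circ)"
proof -
  define a where "a k = (deriv ^^ k) f 0 / fact k" for k
  have sums: "(\<lambda>k. a k * z ^ k) sums f z" if "norm z < 1" for z
    using holomorphic_power_series[OF f, of z] that by (simp add: a_def)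
  define P where "P n = (\<Sum>k<n. monom (a k * of_real R ^ k) k)" for n
  have P: "poly (P n) z = (\<Sum>k<n. a k * (of_real R * z) ^ k)" for n z
    by (simp add: P_def poly_sum poly_monom power_mult_distrib mult_ac)
  have lim: "(\<lambda>n. poly (P n) z) \<longlonglongrightarrow> f (of_real R * z)" if "norm z \<le> 1" for z
  proof -
    have "norm (of_real R * z) \<le> R"
      using that R by (simp add: norm_mult mult_left_le)
    then show ?thesis
      unfolding P using sums[of "of_real R * z"] R by (simp add: sums_def)
  qed
  have "summable (\<lambda>k. norm (a k * of_real R ^ k))"
  proof -
    have "norm (of_real ((R + 1) / 2) :: complex) < 1" using R by (simp del: of_real_add of_real_divide)
    from sums_summable[OF sums[OF this]] show ?thesis
      by (rule powser_insidea) (use R in \<open>simp add: del: of_real_add of_real_divide\<close>)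
  qed
  define B where "B = (\<Sum>k. norm (a k * of_real R ^ k))"
  have PB: "norm (poly (P n) (cis \<theta>)) \<le> B" for n \<theta>
  proof -
    have "norm (poly (P n) (cis \<theta>)) \<le> (\<Sum>k<n. norm (a k * (of_real R * cis \<theta>) ^ k))"
      unfolding P by (rule norm_sum)
    also have "\<dots> = (\<Sum>k<n. norm (a k * of_real R ^ k))"
      by (simp add: norm_mult norm_power)
    also have "\<dots> \<le> B"
      unfolding B_def by (rule sum_le_suminf) (use \<open>summable _\<close> in auto)
    finally show ?thesis .
  qed
  have ineq: "ennreal (norm (poly (P n) (of_real u)) powr q)
      \<le> (\<integral>\<^sup>+\<theta>. ennreal (norm (poly (P n) (cis \<theta>)) powr q * pois u \<theta>) \<partial>circ)" for n
  proof -
    obtain h where h: "h holomorphic_on ball 0 1" "continuous_on (cball 0 1) h"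
       "\<And>z. z\<in>ball 0 1 \<Longrightarrow> norm (poly (P n) z) powr q \<le> norm (h z)"
       "\<And>z. z\<in>sphere 0 1 \<Longrightarrow> norm (h z) = norm (poly (P n) z) powr q"
      using poly_majorant[OF q, of "P n"] by blast
    have "ennreal (norm (poly (P n) (of_real u)) powr q) \<le> ennreal (norm (h (of_real u)))"
      using h(3)[of "of_real u"] u by (intro ennreal_leI) auto
    also have "\<dots> \<le> (\<integral>\<^sup>+\<theta>. ennreal (norm (h (cis \<theta>)) * pois u \<theta>) \<partial>circ)"
      by (rule poisson_norm_le[OF h(1,2) u])
    finally show ?thesis by (simp add: h(4))
  qed
  have lim_powr: "(\<lambda>n. norm (poly (P n) z) powr q) \<longlonglongrightarrow> norm (f (of_real R * z)) powr q" if "norm z \<le> 1" for z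
    using q by (intro tendsto_powr2 tendsto_norm lim that tendsto_const) (auto)
  have "(\<lambda>n. ennreal (norm (poly (P n) (of_real u)) powr q)) \<longlonglongrightarrow> ennreal (norm (f (of_real R * of_real u)) powr q)"
    using u by (intro tendsto_ennrealI lim_powr) auto
  moreover have "(\<lambda>n. \<integral>\<^sup>+\<theta>. ennreal (norm (poly (P n) (cis \<theta>)) powr q * pois u \<theta>) \<partial>circ)
     \<longlonglongrightarrow> (\<integral>\<^sup>+\<theta>. ennreal (norm (f (of_real R * cis \<theta>)) powr q * pois u \<theta>) \<partial>circ)"
  proof (rule nn_integral_dominated_convergence[where w = "\<lambda>_. ennreal (B powr q * (2 / (1 - u)))"])
    have [measurable]: "pois u \<in> borel_measurable borel"
      using u by (intro borel_measurable_continuous_onI continuous_pois) auto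
    have "continuous_on UNIV (\<lambda>\<theta>. poly (P n) (cis \<theta>))" for n
      by (intro continuous_intros)
    then have [measurable]: "(\<lambda>\<theta>. poly (P n) (cis \<theta>)) \<in> borel_measurable borel" for n
      by (intro borel_measurable_continuous_onI)
    show "(\<lambda>\<theta>. ennreal (norm (poly (P n) (cis \<theta>)) powr q * pois u \<theta>)) \<in> borel_measurable circ" for n
      by measurable
    have "continuous_on UNIV (\<lambda>\<theta>. f (of_real R * cis \<theta>))"
      by (rule continuous_on_compose2[OF holomorphic_on_imp_continuous_on[OF f]])
         (use R in \<open>auto intro!: continuous_intros simp: norm_mult\<close>)
    then have [measurable]: "(\<lambda>\<theta>. f (of_real R * cis \<theta>)) \<in> borel_measurable borel"
      by (intro borel_measurable_continuous_onI)
    show "(\<lambda>\<theta>. ennreal (norm (f (of_real R * cis \<theta>)) powr q * pois u \<theta>)) \<in> borel_measurable circ"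
      by measurable
    show "AE \<theta> in circ. ennreal (norm (poly (P n) (cis \<theta>)) powr q * pois u \<theta>) \<le> ennreal (B powr q * (2 / (1 - u)))" for n
      using u q PB by (intro always_eventually allI ennreal_leI mult_mono powr_mono2 pois_le pois_nonneg) auto
    show "(\<integral>\<^sup>+\<theta>. ennreal (B powr q * (2 / (1 - u))) \<partial>circ) < \<infinity>"
      by (simp add: emeasure_circ_UNIV ennreal_mult_less_top)
    show "AE \<theta> in circ. (\<lambda>n. ennreal (norm (poly (P n) (cis \<theta>)) powr q * pois u \<theta>))
       \<longlonglongrightarrow> ennreal (norm (f (of_real R * cis \<theta>)) powr q * pois u \<theta>)"
      by (intro always_eventually allI tendsto_ennrealI tendsto_mult tendsto_const lim_powr) auto
  qed auto
  ultimately have "ennreal (norm (f (of_real R * of_real u)) powr q)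
      \<le> (\<integral>\<^sup>+\<theta>. ennreal (norm (f (of_real R * cis \<theta>)) powr q * pois u \<theta>) \<partial>circ)"
    by (rule LIMSEQ_le) (use ineq in blast)
  then show ?thesis by simp
qed

section \<open>Weighted kernel estimates\<close>

text \<open>Convexity: the graph of x^p lies above its tangent at Y. Young's inequality with
  exponents p and p/(p - 1) is the same statement, but needs p > 1.\<close>

lemma young_tangent:
  fixes u Y p :: real
  assumes p: "1 \<le> p" and "0 \<le> u" "0 \<le> Y"
  shows "p * Y powr (p - 1) * u \<le> u powr p + (p - 1) * Y powr p"
proof (cases "p = 1")
  case True
  \<comment> \<open>At Y = 0 the convention \<open>0 powr 0 = 0\<close> makes the left side
    vanish.\<close>
  then show ?thesis using assms by (cases "Y = 0") auto
next
  case False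
  then have p1: "1 < p" using p by simp
  have "1 / p + 1 / (p / (p - 1)) = 1" "1 < p / (p - 1)"
    using p1 by (auto simp: field_simps)
  then have "u * Y powr (p - 1) \<le> u powr p / p + (Y powr (p - 1)) powr (p / (p - 1)) / (p / (p - 1))"
    using p1 assms by (intro Youngs_inequality) auto
  also have "(Y powr (p - 1)) powr (p / (p - 1)) = Y powr p"
    using p1 by (simp add: powr_powr)
  finally have "p * (u * Y powr (p - 1)) \<le> p * (u powr p / p + Y powr p / (p / (p - 1)))"
    using p1 by (intro mult_left_mono) auto
  also have "\<dots> = u powr p + (p - 1) * Y powr p"
    using p1 by (simp add: field_simps)
  finally show ?thesis by (simp add: mult_ac)
qed

text \<open>The tangent line at \<open>X / A\<close> replaces Hoelder's inequality, so that no finiteness or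
  \<open>p\<close>-th power of an extended real is needed.\<close>

lemma holder_kernel:
  fixes u K :: "'a \<Rightarrow> real"
  assumes [measurable]: "u \<in> borel_measurable M" "K \<in> borel_measurable M"
    and u: "\<And>x. 0 \<le> u x" and K: "\<And>x. 0 \<le> K x"
    and p: "1 \<le> p" and A: "0 < A" and X: "0 \<le> X"
    and le: "ennreal X \<le> (\<integral>\<^sup>+x. ennreal (u x * K x) \<partial>M)"
    and KA: "(\<integral>\<^sup>+x. ennreal (K x) \<partial>M) \<le> ennreal A"
  shows "ennreal (X powr p) \<le> ennreal (A powr (p - 1)) * (\<integral>\<^sup>+x. ennreal (u x powr p * K x) \<partial>M)"
proof -
  \<comment> \<open>If K had mass exactly A, then X / A would be the average of u, the point where
    the tangent loses least.\<close>
  define Y where "Y = X / A"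
  have Y: "0 \<le> Y" using X A by (simp add: Y_def)
  have XY: "X = A * Y" using A by (simp add: Y_def)
  have Yp: "Y powr (p - 1) * Y = Y powr p"
    using Y by (cases "Y = 0") (auto simp: powr_mult_base powr_diff)
  define I where "I = (\<integral>\<^sup>+x. ennreal (u x powr p * K x) \<partial>M)"
  have "ennreal (p * Y powr (p - 1)) * ennreal X \<le> ennreal (p * Y powr (p - 1)) * (\<integral>\<^sup>+x. ennreal (u x * K x) \<partial>M)"
    by (intro mult_left_mono le) auto
  also have "\<dots> = (\<integral>\<^sup>+x. ennreal (p * Y powr (p - 1)) * ennreal (u x * K x) \<partial>M)"
    by (rule nn_integral_cmult[symmetric]) measurable
  also have "\<dots> \<le> (\<integral>\<^sup>+x. ennreal (u x powr p * K x) + ennreal ((p - 1) * Y powr p) * ennreal (K x) \<partial>M)"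
  proof (rule nn_integral_mono)
    fix x
    have "p * Y powr (p - 1) * u x * K x \<le> (u x powr p + (p - 1) * Y powr p) * K x"
      using young_tangent[OF p u Y] K by (intro mult_right_mono) auto
    then have "ennreal (p * Y powr (p - 1) * (u x * K x)) \<le> ennreal (u x powr p * K x + (p - 1) * Y powr p * K x)"
      by (intro ennreal_leI) (simp only: distrib_right mult.assoc)
    also have "\<dots> = ennreal (u x powr p * K x) + ennreal ((p - 1) * Y powr p * K x)"
      using p K by (intro ennreal_plus) auto
    also have "ennreal ((p - 1) * Y powr p * K x) = ennreal ((p - 1) * Y powr p) * ennreal (K x)"
      using p by (intro ennreal_mult') auto
    also have "ennreal (p * Y powr (p - 1) * (u x * K x)) = ennreal (p * Y powr (p - 1)) * ennreal (u x * K x)"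
      using p by (intro ennreal_mult') auto
    finally show "ennreal (p * Y powr (p - 1)) * ennreal (u x * K x)
        \<le> ennreal (u x powr p * K x) + ennreal ((p - 1) * Y powr p) * ennreal (K x)"
      .
  qed
  also have "\<dots> = I + (\<integral>\<^sup>+x. ennreal ((p - 1) * Y powr p) * ennreal (K x) \<partial>M)"
    unfolding I_def by (rule nn_integral_add) measurable
  also have "(\<integral>\<^sup>+x. ennreal ((p - 1) * Y powr p) * ennreal (K x) \<partial>M)
      = ennreal ((p - 1) * Y powr p) * (\<integral>\<^sup>+x. ennreal (K x) \<partial>M)"
    by (rule nn_integral_cmult) measurable
  also have "I + \<dots> \<le> I + ennreal ((p - 1) * Y powr p) * ennreal A"
    by (intro add_left_mono mult_left_mono KA) auto
  finally have *: "ennreal (p * Y powr (p - 1)) * ennreal X \<le> I + ennreal ((p - 1) * Y powr p) * ennreal A" .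
  \<comment> \<open>For infinite I there is nothing to show; for finite I the term (p - 1) Y^p A can
    be cancelled, because p Y^(p-1) X = p Y^p A.\<close>
  have "ennreal (Y powr p * A) \<le> I"
  proof (cases I)
    case (real i)
    have "ennreal (p * Y powr (p - 1) * X) \<le> ennreal (i + (p - 1) * Y powr p * A)"
      using * real p X A by (simp add: ennreal_mult ennreal_plus)
    then have "p * Y powr (p - 1) * X \<le> i + (p - 1) * Y powr p * A"
      using real p A by (subst (asm) ennreal_le_iff) auto
    moreover have "p * Y powr (p - 1) * X = p * Y powr p * A"
      unfolding XY Yp[symmetric] by simp
    ultimately have "p * Y powr p * A \<le> i + (p - 1) * Y powr p * A" by linarith
    then have "Y powr p * A \<le> i" by (simp add: algebra_simps)
    then show ?thesis using real by (simp add: ennreal_leI)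
  qed simp
  then have "ennreal (A powr (p - 1)) * ennreal (Y powr p * A) \<le> ennreal (A powr (p - 1)) * I"
    by (intro mult_left_mono) auto
  moreover have "A powr (p - 1) * (Y powr p * A) = X powr p"
  proof -
    have "A powr (p - 1) * A = A powr p"
      using A by (simp add: powr_diff)
    then show ?thesis
      unfolding XY using A Y by (simp add: powr_mult mult_ac)
  qed
  ultimately show ?thesis
    by (simp add: I_def flip: ennreal_mult')
qed

text \<open>The square root maps the closed right half-plane into the sector of angles at most pi/4,
  which inversion preserves; in that sector the modulus is at most sqrt 2 times the real
  part.\<close>

lemma Re_inverse_csqrt:
  assumes "0 \<le> Re v"
  shows "inverse (sqrt (norm v)) \<le> sqrt 2 * Re (inverse (csqrt v))"
proof (cases "v = 0")
  case False
  define w where "w = csqrt v"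
  have w: "w\<^sup>2 = v" by (simp add: w_def)
  have w0: "w \<noteq> 0" using False w by auto
  have nw: "norm v = (norm w)\<^sup>2" by (simp add: w[symmetric] norm_power)
  have Rew: "0 \<le> Re w" unfolding w_def by (rule Re_csqrt)
  have "Re v = (Re w)\<^sup>2 - (Im w)\<^sup>2" by (simp add: w[symmetric] power2_eq_square)
  then have "(norm w)\<^sup>2 \<le> 2 * (Re w)\<^sup>2" using assms by (simp add: cmod_power2)
  also have "\<dots> = (sqrt 2 * Re w)\<^sup>2" by (simp add: power_mult_distrib)
  finally have le: "norm w \<le> sqrt 2 * Re w"
    by (rule power2_le_imp_le) (simp add: Rew)
  have "Re (inverse w) = Re w / (norm w)\<^sup>2" by (simp add: cmod_power2)
  then have e: "sqrt 2 * Re (inverse w) = sqrt 2 * Re w / (norm w)\<^sup>2" by simp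
  have "inverse (norm w) = norm w / (norm w)\<^sup>2" using w0 by (simp add: power2_eq_square field_simps)
  also have "\<dots> \<le> sqrt 2 * Re w / (norm w)\<^sup>2"
    by (rule divide_right_mono[OF le]) simp
  also note e[symmetric]
  finally have "inverse (norm w) \<le> sqrt 2 * Re (inverse w)" .
  moreover have "sqrt (norm v) = norm w" unfolding nw by simp
  ultimately show ?thesis by (simp only: w_def[symmetric])
qed simp

lemma powr_minus_half: "0 \<le> x \<Longrightarrow> x powr (-1/2) = inverse (sqrt x)"
  for x :: real
  by (simp add: powr_minus powr_half_sqrt flip: minus_divide_left)

text \<open>The weight is not harmonic, but up to sqrt 2 it is below the real part of the analytic
  function (1 - r z)^(-1/2). The Poisson integral of that real part is its value at z = r t.\<close>

lemma poisson_weight: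
  assumes r: "0 \<le> r" "r < 1" and t: "0 \<le> t" "t < 1"
  shows "(\<integral>\<^sup>+\<theta>. ennreal (norm (1 - of_real r * cis \<theta>) powr (-1/2) * pois (r * t) \<theta>) \<partial>circ)
      \<le> ennreal (sqrt 2 * (1 - r\<^sup>2 * t) powr (-1/2))"
proof -
  have rt: "0 \<le> r * t" "r * t < 1"
    using r t mult_strict_mono'[of r 1 t 1] by auto
  define H where "H z = inverse (csqrt (1 - of_real r * z))" for z
  have pos: "0 < Re (1 - of_real r * z)" if "norm z \<le> 1" for z :: complex
  proof -
    have "norm (of_real r * z) < 1"
      using mult_left_mono[OF that r(1)] r by (simp add: norm_mult)
    then show ?thesis
      using complex_Re_le_cmod[of "of_real r * z"] by simp
  qed
  have nr: "1 - of_real r * z \<notin> \<real>\<^sub>\<le>\<^sub>0" if "norm z \<le> 1" for z :: complex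
    using pos[OF that] unfolding complex_nonpos_Reals_iff by linarith
  have n0: "csqrt (1 - of_real r * z) \<noteq> 0" if "norm z \<le> 1" for z
    using pos[OF that] by (metis csqrt_eq_0 less_irrefl zero_complex.sel(1))
  have "H holomorphic_on cball 0 1"
    unfolding H_def by (intro holomorphic_intros) (use nr n0 in auto)
  then have H: "H holomorphic_on ball 0 1" "continuous_on (cball 0 1) H"
    using holomorphic_on_subset[of H "cball 0 1" "ball 0 1"] holomorphic_on_imp_continuous_on by auto
  have le: "norm (1 - of_real r * cis \<theta>) powr (-1/2) \<le> sqrt 2 * Re (H (cis \<theta>))" for \<theta>
    unfolding H_def powr_minus_half[OF norm_ge_zero]
    by (rule Re_inverse_csqrt) (rule less_imp_le[OF pos], simp)
  have nn: "0 \<le> Re (H (cis \<theta>))" for \<theta>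
  proof -
    have "0 \<le> sqrt 2 * Re (H (cis \<theta>))" using le[of \<theta>] powr_ge_zero order_trans by blast
    then show ?thesis by (simp add: zero_le_mult_iff)
  qed
  have m: "(\<lambda>\<theta>. Re (H (cis \<theta>)) * pois (r * t) \<theta>) \<in> borel_measurable circ"
  proof -
    have "continuous_on UNIV (\<lambda>\<theta>. H (cis \<theta>))"
      by (rule continuous_on_compose2[OF H(2)]) (auto intro!: continuous_intros)
    then have "continuous_on UNIV (\<lambda>\<theta>. Re (H (cis \<theta>)) * pois (r * t) \<theta>)"
      using rt by (intro continuous_intros continuous_pois) auto
    then show ?thesis
      using borel_measurable_continuous_onI measurable_cong_sets[OF sets_circ refl] by blast
  qed
  have "(\<integral>\<^sup>+\<theta>. ennreal (norm (1 - of_real r * cis \<theta>) powr (-1/2) * pois (r * t) \<theta>) \<partial>circ)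
     \<le> (\<integral>\<^sup>+\<theta>. ennreal (sqrt 2) * ennreal (Re (H (cis \<theta>)) * pois (r * t) \<theta>) \<partial>circ)"
  proof (rule nn_integral_mono)
    fix \<theta>
    have "norm (1 - of_real r * cis \<theta>) powr (-1/2) * pois (r * t) \<theta> \<le> sqrt 2 * (Re (H (cis \<theta>)) * pois (r * t) \<theta>)"
      using mult_right_mono[OF le[of \<theta>] pois_nonneg[of "r * t" \<theta>]] rt by (simp add: mult_ac)
    then show "ennreal (norm (1 - of_real r * cis \<theta>) powr (-1/2) * pois (r * t) \<theta>)
      \<le> ennreal (sqrt 2) * ennreal (Re (H (cis \<theta>)) * pois (r * t) \<theta>)"
      by (simp add: ennreal_leI flip: ennreal_mult')
  qed
  also have "\<dots> = ennreal (sqrt 2) * ennreal (Re (H (of_real (r * t))))"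
    using m by (subst nn_integral_cmult) (auto simp: poisson_Re[OF H rt nn])
  also have "Re (H (of_real (r * t))) = (1 - r\<^sup>2 * t) powr (-1/2)"
  proof -
    have "r\<^sup>2 * t = r * (r * t)" by (simp add: power2_eq_square)
    also have "\<dots> \<le> 1" using rt r by (simp add: mult_le_one)
    finally have nn: "0 \<le> 1 - r\<^sup>2 * t" by simp
    have e: "1 - of_real r * of_real (r * t) = (of_real (1 - r\<^sup>2 * t) :: complex)"
      by (simp add: power2_eq_square mult.assoc)
    have "H (of_real (r * t)) = inverse (csqrt (of_real (1 - r\<^sup>2 * t)))"
      unfolding H_def e ..
    also have "\<dots> = of_real (inverse (sqrt (1 - r\<^sup>2 * t)))"
      by (subst csqrt_of_real[OF nn]) (rule of_real_inverse[symmetric])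
    finally show ?thesis using nn by (simp only: Re_complex_of_real powr_minus_half)
  qed
  finally show ?thesis by (simp add: ennreal_mult')
qed

text \<open>An interpolation between a = 0, where the total mass is 1, and a = 1, the preceding
  lemma: for \<open>x = l * y\<close> with \<open>l = sqrt (1 - t)\<close> one has x^a \<le> 1 + x.
  The two terms contribute 1 and at most sqrt 2, together below 3. With a = p - 1 the condition a
  \<le> 1 reads p \<le> 2.\<close>

lemma poisson_weight_powr:
  assumes r: "0 \<le> r" "r < 1" and t: "0 \<le> t" "t < 1" and a: "0 \<le> a" "a \<le> 1"
  shows "(\<integral>\<^sup>+\<theta>. ennreal (norm (1 - of_real r * cis \<theta>) powr (-a/2) * pois (r * t) \<theta>) \<partial>circ)
      \<le> ennreal (3 * (1 - t) powr (-a/2))"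
proof -
  have rt: "0 \<le> r * t" "r * t < 1"
    using r t mult_strict_mono'[of r 1 t 1] by auto
  define y where "y \<theta> = norm (1 - of_real r * cis \<theta>) powr (-1/2)" for \<theta>
  define l where "l = (1 - t) powr (1/2)"
  have l: "l > 0" using t by (simp add: l_def)
  have ypos: "0 < y \<theta>" for \<theta> unfolding y_def using norm_one_minus_cis_pos[of r \<theta>] r by auto
  have pt: "norm (1 - of_real r * cis \<theta>) powr (-a/2) \<le> (1 - t) powr (-a/2) * (1 + l * y \<theta>)" for \<theta>
  proof -
    have "(l * y \<theta>) powr a \<le> 1 + l * y \<theta>"
    proof (cases "l * y \<theta> \<le> 1")
      case True
      then have "(l * y \<theta>) powr a \<le> 1" using a l ypos[of \<theta>] by (intro powr_le1) auto
      then show ?thesis using l ypos[of \<theta>] by (simp add: add_increasing2)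
    next
      case False
      then have "(l * y \<theta>) powr a \<le> (l * y \<theta>) powr 1" using a by (intro powr_mono) auto
      then show ?thesis using False by simp
    qed
    then have "(1 - t) powr (-a/2) * (l * y \<theta>) powr a \<le> (1 - t) powr (-a/2) * (1 + l * y \<theta>)"
      by (intro mult_left_mono) auto
    moreover have "(1 - t) powr (-a/2) * (l * y \<theta>) powr a = norm (1 - of_real r * cis \<theta>) powr (-a/2)"
      using t by (simp add: l_def y_def powr_mult powr_powr flip: powr_add mult.assoc)
    ultimately show ?thesis by simp
  qed
  have c: "continuous_on UNIV y"
    unfolding y_def using norm_one_minus_cis_pos[of r] r by (intro continuous_intros) fastforce
  then have [measurable]: "y \<in> borel_measurable circ"
    using borel_measurable_continuous_onI measurable_cong_sets[OF sets_circ refl] by blast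
  have "pois (r * t) \<in> borel_measurable borel"
    using rt by (intro borel_measurable_continuous_onI continuous_pois) auto
  then have [measurable]: "pois (r * t) \<in> borel_measurable circ"
    using measurable_cong_sets[OF sets_circ refl] by blast
  have pn: "0 \<le> pois (r * t) \<theta>" for \<theta> using pois_nonneg rt by auto
  have "(\<integral>\<^sup>+\<theta>. ennreal (norm (1 - of_real r * cis \<theta>) powr (-a/2) * pois (r * t) \<theta>) \<partial>circ)
     \<le> (\<integral>\<^sup>+\<theta>. ennreal ((1 - t) powr (-a/2)) * (ennreal (pois (r * t) \<theta>) + ennreal l * ennreal (y \<theta> * pois (r * t) \<theta>)) \<partial>circ)"
  proof (rule nn_integral_mono)
    fix \<theta>
    have "norm (1 - of_real r * cis \<theta>) powr (-a/2) * pois (r * t) \<theta>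
       \<le> (1 - t) powr (-a/2) * (pois (r * t) \<theta> + l * (y \<theta> * pois (r * t) \<theta>))"
      using mult_right_mono[OF pt[of \<theta>] pn[of \<theta>]] by (simp add: algebra_simps)
    then show "ennreal (norm (1 - of_real r * cis \<theta>) powr (-a/2) * pois (r * t) \<theta>)
       \<le> ennreal ((1 - t) powr (-a/2)) * (ennreal (pois (r * t) \<theta>) + ennreal l * ennreal (y \<theta> * pois (r * t) \<theta>))"
      using l pn[of \<theta>] ypos[of \<theta>] by (simp add: ennreal_leI flip: ennreal_mult' ennreal_plus)
  qed
  also have "\<dots> = ennreal ((1 - t) powr (-a/2)) * ((\<integral>\<^sup>+\<theta>. ennreal (pois (r * t) \<theta>) \<partial>circ)
      + ennreal l * (\<integral>\<^sup>+\<theta>. ennreal (y \<theta> * pois (r * t) \<theta>) \<partial>circ))"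
    by (subst nn_integral_cmult, measurable, subst nn_integral_add, measurable, subst nn_integral_cmult, measurable)
  also have "\<dots> \<le> ennreal ((1 - t) powr (-a/2)) * (1 + ennreal l * ennreal (sqrt 2 * (1 - r\<^sup>2 * t) powr (-1/2)))"
    unfolding nn_integral_pois[OF rt] y_def using poisson_weight[OF r t]
    by (intro mult_left_mono add_left_mono) auto
  also have "\<dots> = ennreal ((1 - t) powr (-a/2) * (1 + l * (sqrt 2 * (1 - r\<^sup>2 * t) powr (-1/2))))"
    using l by (simp add: ennreal_mult' ennreal_plus del: ennreal_1 flip: ennreal_1)
  also have "\<dots> \<le> ennreal (3 * (1 - t) powr (-a/2))"
  proof (rule ennreal_leI)
    have "r\<^sup>2 * t \<le> t" using r t by (simp add: mult_left_le_one_le abs_square_le_1)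
    then have "(1 - r\<^sup>2 * t) powr (-1/2) \<le> (1 - t) powr (-1/2)"
      using t by (intro powr_mono2') auto
    then have "l * (sqrt 2 * (1 - r\<^sup>2 * t) powr (-1/2)) \<le> l * (sqrt 2 * (1 - t) powr (-1/2))"
      using l by (intro mult_left_mono) auto
    also have "\<dots> = sqrt 2" using t by (simp add: l_def powr_minus field_simps)
    also have "\<dots> \<le> 2" by (rule real_le_lsqrt) auto
    finally have "1 + l * (sqrt 2 * (1 - r\<^sup>2 * t) powr (-1/2)) \<le> 3" by simp
    then show "(1 - t) powr (-a/2) * (1 + l * (sqrt 2 * (1 - r\<^sup>2 * t) powr (-1/2))) \<le> 3 * (1 - t) powr (-a/2)"
      by (subst mult.commute[of 3], intro mult_left_mono) auto
  qed
  finally show ?thesis .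
qed

text \<open>The constant is a parameter because the same estimates are used twice: for the whole
  measure, and for its restriction to an interval near 1, where N can be made arbitrarily
  small.\<close>

locale tail_measure =
  fixes \<mu> :: "real measure" and N :: real
  assumes sets_mu: "sets \<mu> = sets (restrict_space borel {0..<1})"
    and N_pos: "0 < N"
    and tail: "\<And>t. t \<in> {0..<1} \<Longrightarrow> emeasure \<mu> {t..<1} \<le> ennreal (N * (1 - t)\<^sup>2)"

lemma space_restrict_unit:
  fixes \<mu> :: "real measure"
  assumes "sets \<mu> = sets (restrict_space borel {0..<1})"
  shows "space \<mu> = {0..<1}"
  using sets_eq_imp_space_eq[OF assms] by (simp add: space_restrict_space)

lemma measurable_restrict_unit:
  fixes \<mu> :: "real measure" and g :: "real \<Rightarrow> 'b::topological_space"
  assumes "sets \<mu> = sets (restrict_space borel {0..<1})" "continuous_on {0..<1} g"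
  shows "g \<in> borel_measurable \<mu>"
  using borel_measurable_continuous_on_restrict[OF assms(2)] measurable_cong_sets[OF assms(1) refl] by blast

text \<open>The sigma-algebra of \<mu> lives on [0,1); this moves a map into it, such as the first
  projection of a product, to the Borel sets of the line.\<close>

lemma borel_measurable_of_unit_measure:
  fixes \<mu> :: "real measure"
  assumes "sets \<mu> = sets (restrict_space borel {0..<1})" and g: "g \<in> measurable M \<mu>"
  shows "g \<in> borel_measurable M"
proof -
  have "(\<lambda>t. t) \<in> borel_measurable \<mu>"
    by (rule measurable_restrict_unit[OF assms(1)]) (intro continuous_intros)
  from measurable_compose[OF g this] show ?thesis by simp
qed

context tail_measure
begin

lemma space_mu: "space \<mu> = {0..<1}"
  using space_restrict_unit[OF sets_mu] .

lemma finite_mu: "finite_measure \<mu>"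
proof
  have "emeasure \<mu> {0..<1} \<le> ennreal N"
    using tail[of 0] by simp
  then show "emeasure \<mu> (space \<mu>) \<noteq> \<infinity>"
    using space_mu by (auto simp: top_unique)
qed

lemma sigma_finite_mu: "sigma_finite_measure \<mu>"
  using finite_mu by (simp add: finite_measure.axioms(1))

lemma measurable_mu_id: "(\<lambda>t. t) \<in> borel_measurable \<mu>"
  by (rule measurable_restrict_unit[OF sets_mu]) (intro continuous_intros)

text \<open>For \<tau> \<ge> 1 the set is the whole space, whose mass N is at most
  \<open>N * \<tau>\<^sup>2\<close>; thus the layer integral can run over all positive \<tau>
  without a case split.\<close>

lemma emeasure_tail_le:
  assumes \<tau>: "0 < \<tau>"
  shows "emeasure \<mu> {t \<in> space \<mu>. 1 - t \<le> \<tau>} \<le> ennreal (N * \<tau>\<^sup>2)"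
proof (cases "\<tau> < 1")
  case True
  then have "{t \<in> space \<mu>. 1 - t \<le> \<tau>} = {1 - \<tau>..<1}"
    using \<tau> by (auto simp: space_mu)
  then show ?thesis using tail[of "1 - \<tau>"] \<tau> True by simp
next
  case False
  then have "{t \<in> space \<mu>. 1 - t \<le> \<tau>} = {0..<1}"
    by (auto simp: space_mu)
  moreover have "N * 1 \<le> N * \<tau>\<^sup>2"
    using False N_pos by (intro mult_left_mono) auto
  ultimately show ?thesis using tail[of 0] by (auto intro: order_trans ennreal_leI)
qed

text \<open>Layer cake: the decreasing function \<open>s\<^bsup>-1\<^esup> (s + x)\<^bsup>-3/2\<^esup>\<close> of \<open>s = 1 - t\<close> is written as the
  integral of minus its derivative over \<open>[s, \<infinity>)\<close>.\<close>

lemma layer_bound: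
  assumes x: "0 < x"
  shows "(\<integral>\<^sup>+t. ennreal (inverse (1 - t) * ((1 - t) + x) powr (-3/2)) \<partial>\<mu>) \<le> ennreal (5 * N * x powr (-1/2))"
proof -
  define \<psi> where "\<psi> \<tau> = inverse (\<tau>\<^sup>2) * (\<tau> + x) powr (-3/2) + 3/2 * inverse \<tau> * (\<tau> + x) powr (-5/2)" for \<tau>
  have [measurable]: "\<psi> \<in> borel_measurable borel" unfolding \<psi>_def by measurable
  have \<psi>_nonneg: "0 \<le> \<psi> \<tau>" if "0 < \<tau>" for \<tau> using that by (simp add: \<psi>_def)
  have lim: "((\<lambda>\<tau>. (\<tau> + x) powr (-a)) \<longlongrightarrow> 0) at_top" if "a > 0" for a
  proof -
    have "filterlim (\<lambda>\<tau>. \<tau> + x) at_top at_top"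
      using filterlim_tendsto_add_at_top[OF tendsto_const filterlim_ident, of x] by (simp add: add.commute)
    from tendsto_neg_powr[OF _ this, of "-a"] show ?thesis using that by simp
  qed
  have repr: "ennreal (inverse s * (s + x) powr (-3/2)) = (\<integral>\<^sup>+\<tau>\<in>{s..}. ennreal (\<psi> \<tau>) \<partial>lborel)" if s: "0 < s" for s
  proof -
    define F where "F \<tau> = - (inverse \<tau> * (\<tau> + x) powr (-3/2))" for \<tau>
    have "((\<lambda>\<tau>. inverse \<tau> * (\<tau> + x) powr (-(3/2))) \<longlongrightarrow> 0 * 0) at_top"
      by (intro tendsto_mult lim tendsto_inverse_0_at_top filterlim_ident) auto
    then have "(F \<longlongrightarrow> - 0) at_top"
      unfolding F_def by (intro tendsto_minus) simp
    moreover have "(F has_real_derivative \<psi> \<tau>) (at \<tau>)" if "s \<le> \<tau>" for \<tau>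
      unfolding F_def \<psi>_def using s x that
      by (auto intro!: derivative_eq_intros simp: power2_eq_square algebra_simps powr_diff field_simps)
    ultimately have "(\<integral>\<^sup>+\<tau>\<in>{s..}. ennreal (\<psi> \<tau>) \<partial>lborel) = ennreal (- 0 - F s)"
      using s \<psi>_nonneg by (intro nn_integral_FTC_atLeast) auto
    then show ?thesis by (simp add: F_def)
  qed
  have [measurable]: "(\<lambda>t. t) \<in> borel_measurable \<mu>" by (rule measurable_mu_id)
  have [measurable]: "fst \<in> borel_measurable (\<mu> \<Otimes>\<^sub>M lborel)"
    by (rule borel_measurable_of_unit_measure[OF sets_mu measurable_fst])
  interpret pair_sigma_finite \<mu> lborel
    using sigma_finite_mu lborel.sigma_finite_measure_axioms by (simp add: pair_sigma_finite_def)
  have "(\<integral>\<^sup>+t. ennreal (inverse (1 - t) * ((1 - t) + x) powr (-3/2)) \<partial>\<mu>)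
      = (\<integral>\<^sup>+t. \<integral>\<^sup>+\<tau>. ennreal (\<psi> \<tau>) * indicator {(t, \<tau>). 1 - t \<le> \<tau>} (t, \<tau>) \<partial>lborel \<partial>\<mu>)"
  proof (rule nn_integral_cong)
    fix t assume "t \<in> space \<mu>"
    then have "0 < 1 - t" by (simp add: space_mu)
    from repr[OF this] show "ennreal (inverse (1 - t) * ((1 - t) + x) powr (-3/2))
        = (\<integral>\<^sup>+\<tau>. ennreal (\<psi> \<tau>) * indicator {(t, \<tau>). 1 - t \<le> \<tau>} (t, \<tau>) \<partial>lborel)"
      by (simp add: indicator_def)
  qed
  also have "\<dots> = (\<integral>\<^sup>+\<tau>. \<integral>\<^sup>+t. ennreal (\<psi> \<tau>) * indicator {(t, \<tau>). 1 - t \<le> \<tau>} (t, \<tau>) \<partial>\<mu> \<partial>lborel)"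
    by (rule Fubini'[symmetric]) (auto simp: indicator_def case_prod_unfold cong: measurable_cong)
  \<comment> \<open>Here the quadratic tail acts: \<open>\<tau>\<^sup>2\<close> cancels the
    singularity of \<psi> at 0, and \<tau> \<le> \<tau> + x reduces both terms to the power -3/2
    with total factor 1 + 3/2. Integrating 5/2 times that power gives the 5.\<close>
  also have "\<dots> \<le> (\<integral>\<^sup>+\<tau>\<in>{0..}. ennreal (5/2 * N * (\<tau> + x) powr (-3/2)) \<partial>lborel)"
  proof (rule nn_integral_mono)
    fix \<tau> :: real
    have set: "{t \<in> space \<mu>. 1 - t \<le> \<tau>} \<in> sets \<mu>" by measurable
    have "(\<integral>\<^sup>+t. ennreal (\<psi> \<tau>) * indicator {(t, \<tau>). 1 - t \<le> \<tau>} (t, \<tau>) \<partial>\<mu>)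
        = (\<integral>\<^sup>+t. ennreal (\<psi> \<tau>) * indicator {t \<in> space \<mu>. 1 - t \<le> \<tau>} t \<partial>\<mu>)"
      by (intro nn_integral_cong) (auto simp: indicator_def)
    also have "\<dots> = ennreal (\<psi> \<tau>) * emeasure \<mu> {t \<in> space \<mu>. 1 - t \<le> \<tau>}"
      by (rule nn_integral_cmult_indicator[OF set])
    also have "\<dots> \<le> ennreal (5/2 * N * (\<tau> + x) powr (-3/2)) * indicator {0..} \<tau>"
    proof (cases "0 < \<tau>")
      case True
      have "(\<tau> + x) powr (-5/2) * \<tau> \<le> (\<tau> + x) powr (-5/2) * (\<tau> + x)"
        using True x by (intro mult_left_mono) auto
      also have "\<dots> = (\<tau> + x) powr (-5/2) * (\<tau> + x) powr 1" using True x by simp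
      also have "\<dots> = (\<tau> + x) powr (-3/2)" by (subst powr_add[symmetric]) simp
      finally have *: "(\<tau> + x) powr (-5/2) * \<tau> \<le> (\<tau> + x) powr (-3/2)" .
      have "\<psi> \<tau> * (N * \<tau>\<^sup>2) = N * ((\<tau> + x) powr (-3/2) + 3/2 * ((\<tau> + x) powr (-5/2) * \<tau>))"
        using True by (simp add: \<psi>_def field_simps power2_eq_square)
      also have "\<dots> \<le> N * ((\<tau> + x) powr (-3/2) + 3/2 * (\<tau> + x) powr (-3/2))"
        using * N_pos by (intro mult_left_mono) (linarith, simp)
      finally have **: "\<psi> \<tau> * (N * \<tau>\<^sup>2) \<le> 5/2 * N * (\<tau> + x) powr (-3/2)"
        by (simp add: algebra_simps)
      have "ennreal (\<psi> \<tau>) * emeasure \<mu> {t \<in> space \<mu>. 1 - t \<le> \<tau>} \<le> ennreal (\<psi> \<tau>) * ennreal (N * \<tau>\<^sup>2)"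
        by (intro mult_left_mono emeasure_tail_le True) auto
      also have "\<dots> = ennreal (\<psi> \<tau> * (N * \<tau>\<^sup>2))"
        using \<psi>_nonneg[OF True] by (simp add: ennreal_mult')
      also have "\<dots> \<le> ennreal (5/2 * N * (\<tau> + x) powr (-3/2))"
        using ** by (rule ennreal_leI)
      finally show ?thesis using True by simp
    next
      case False
      then have e: "{t \<in> space \<mu>. 1 - t \<le> \<tau>} = {}" by (auto simp: space_mu)
      show ?thesis unfolding e by simp
    qed
    finally show "(\<integral>\<^sup>+t. ennreal (\<psi> \<tau>) * indicator {(t, \<tau>). 1 - t \<le> \<tau>} (t, \<tau>) \<partial>\<mu>)
       \<le> ennreal (5/2 * N * (\<tau> + x) powr (-3/2)) * indicator {0..} \<tau>" .
  qed
  also have "\<dots> = ennreal (0 - (- 5 * N * (0 + x) powr (-1/2)))"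
  proof (rule nn_integral_FTC_atLeast)
    show "((\<lambda>\<tau>. - 5 * N * (\<tau> + x) powr (-1/2)) \<longlongrightarrow> 0) at_top"
      using tendsto_mult_right_zero[OF lim[of "1/2"], of "- 5 * N"] by simp
    show "((\<lambda>\<tau>. - 5 * N * (\<tau> + x) powr (-1/2)) has_real_derivative 5/2 * N * (\<tau> + x) powr (-3/2)) (at \<tau>)"
      if "0 \<le> \<tau>" for \<tau>
      using that x by (auto intro!: derivative_eq_intros simp: powr_diff field_simps)
  qed (use N_pos in auto)
  finally show ?thesis by simp
qed

text \<open>From 1 - z = (1 - t z) - (1 - t) z follows |1 - z| \<le> 2 |1 - t z|, and adding 1 - t
  \<le> |1 - t z| gives the 3. This separates t from z in the kernel.\<close>

lemma norm_one_minus_ge: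
  fixes z :: complex
  assumes "norm z < 1" "t \<in> {0..<1}"
  shows "1 - t \<le> norm (1 - of_real t * z)" "((1 - t) + norm (1 - z)) / 3 \<le> norm (1 - of_real t * z)"
proof -
  have "norm (of_real t * z) \<le> t"
    using assms by (simp add: norm_mult mult_left_le)
  then show *: "1 - t \<le> norm (1 - of_real t * z)"
    using norm_triangle_ineq2[of 1 "of_real t * z"] by simp
  have "1 - z = (1 - of_real t * z) - of_real (1 - t) * z"
    by (simp add: algebra_simps)
  then have "norm (1 - z) \<le> norm (1 - of_real t * z) + norm (of_real (1 - t) * z)"
    using norm_triangle_ineq4 by metis
  also have "norm (of_real (1 - t) * z) \<le> 1 - t"
    using assms unfolding norm_mult norm_of_real by (simp add: mult_left_le)
  finally show "((1 - t) + norm (1 - z)) / 3 \<le> norm (1 - of_real t * z)"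
    using * by simp
qed

text \<open>The Schur condition in t shared by both tests. It is \<open>layer_bound\<close> at x =
  |1 - z|; the comparison of |1 - t z| with (1 - t) + |1 - z| costs 3^(3/2), rounded up to 9, and 45
  = 9 * 5.\<close>

lemma kernel_bound:
  fixes z :: complex
  assumes z: "norm z < 1"
  shows "(\<integral>\<^sup>+t. ennreal (inverse (1 - t) * norm (1 - of_real t * z) powr (-3/2)) \<partial>\<mu>)
      \<le> ennreal (45 * N * norm (1 - z) powr (-1/2))"
proof -
  have [measurable]: "(\<lambda>t. t) \<in> borel_measurable \<mu>" by (rule measurable_mu_id)
  have x: "0 < norm (1 - z)" using z by auto
  have "(\<integral>\<^sup>+t. ennreal (inverse (1 - t) * norm (1 - of_real t * z) powr (-3/2)) \<partial>\<mu>)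
     \<le> (\<integral>\<^sup>+t. ennreal 9 * ennreal (inverse (1 - t) * ((1 - t) + norm (1 - z)) powr (-3/2)) \<partial>\<mu>)"
  proof (rule nn_integral_mono)
    fix t assume "t \<in> space \<mu>"
    then have t: "t \<in> {0..<1}" by (simp add: space_mu)
    have "0 < (1 - t) + norm (1 - z)"
      by (rule add_pos_pos) (use t x in auto)
    then have "norm (1 - of_real t * z) powr (-3/2) \<le> (((1 - t) + norm (1 - z)) / 3) powr (-3/2)"
      using norm_one_minus_ge[OF z t] by (intro powr_mono2') auto
    also have "\<dots> = ((1 - t) + norm (1 - z)) powr (-3/2) * 3 powr (3/2)"
      using t by (simp add: powr_divide powr_minus field_simps)
    also have "\<dots> \<le> ((1 - t) + norm (1 - z)) powr (-3/2) * 3 powr 2"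
      by (intro mult_left_mono powr_mono) auto
    finally have "norm (1 - of_real t * z) powr (-3/2) \<le> 9 * ((1 - t) + norm (1 - z)) powr (-3/2)"
      by simp
    then have "inverse (1 - t) * norm (1 - of_real t * z) powr (-3/2)
        \<le> inverse (1 - t) * (9 * ((1 - t) + norm (1 - z)) powr (-3/2))"
      using t by (intro mult_left_mono) auto
    then have "ennreal (inverse (1 - t) * norm (1 - of_real t * z) powr (-3/2))
      \<le> ennreal (9 * (inverse (1 - t) * ((1 - t) + norm (1 - z)) powr (-3/2)))"
      by (intro ennreal_leI) (simp only: mult_ac)
    also have "\<dots> = ennreal 9 * ennreal (inverse (1 - t) * ((1 - t) + norm (1 - z)) powr (-3/2))"
      by (rule ennreal_mult') simp
    finally show "ennreal (inverse (1 - t) * norm (1 - of_real t * z) powr (-3/2))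
      \<le> ennreal 9 * ennreal (inverse (1 - t) * ((1 - t) + norm (1 - z)) powr (-3/2))"
      .
  qed
  also have "\<dots> = ennreal 9 * (\<integral>\<^sup>+t. ennreal (inverse (1 - t) * ((1 - t) + norm (1 - z)) powr (-3/2)) \<partial>\<mu>)"
    by (rule nn_integral_cmult) measurable
  also have "\<dots> \<le> ennreal 9 * ennreal (5 * N * norm (1 - z) powr (-1/2))"
    by (intro mult_left_mono layer_bound x) auto
  also have "\<dots> = ennreal (45 * N * norm (1 - z) powr (-1/2))"
    by (subst ennreal_mult'[symmetric]) (simp_all add: mult.assoc)
  finally show ?thesis .
qed

end

section \<open>The two Schur tests\<close>

lemma nn_integral_limit_le:
  assumes [measurable]: "\<And>n. u n \<in> borel_measurable M"
    and lim: "\<And>x. x \<in> space M \<Longrightarrow> (\<lambda>n. u n x) \<longlonglongrightarrow> v x"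
    and le: "\<And>n::nat. (\<integral>\<^sup>+x. u n x \<partial>M) \<le> C"
  shows "(\<integral>\<^sup>+x. v x \<partial>M) \<le> (C::ennreal)"
proof -
  have "(\<integral>\<^sup>+x. v x \<partial>M) = (\<integral>\<^sup>+x. liminf (\<lambda>n. u n x) \<partial>M)"
    by (intro nn_integral_cong lim_imp_Liminf[symmetric] lim) auto
  also have "\<dots> \<le> liminf (\<lambda>n. \<integral>\<^sup>+x. u n x \<partial>M)"
    by (rule nn_integral_liminf) measurable
  also have "\<dots> \<le> limsup (\<lambda>n. \<integral>\<^sup>+x. u n x \<partial>M)"
    by (rule Liminf_le_Limsup) simp
  also have "\<dots> \<le> C"
    by (rule Limsup_bounded) (simp add: le)
  finally show ?thesis .
qed

lemma measurable_circle:
  assumes "f holomorphic_on ball 0 1" "0 \<le> r" "r < 1"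
  shows "(\<lambda>\<theta>. f (of_real r * cis \<theta>)) \<in> borel_measurable borel"
proof -
  have "continuous_on UNIV (\<lambda>\<theta>. f (of_real r * cis \<theta>))"
    by (rule continuous_on_compose2[OF holomorphic_on_imp_continuous_on[OF assms(1)]])
       (use assms in \<open>auto intro!: continuous_intros simp: norm_mult\<close>)
  then show ?thesis by (rule borel_measurable_continuous_onI)
qed

lemma continuous_on_radius:
  assumes "f holomorphic_on ball 0 1" "0 \<le> r" "r \<le> 1"
  shows "continuous_on {0..<1} (\<lambda>t. f (of_real (r * t)))"
proof (rule continuous_on_compose2[OF holomorphic_on_imp_continuous_on[OF assms(1)]])
  show "(\<lambda>t. of_real (r * t)) ` {0..<1} \<subseteq> ball (0::complex) 1"
  proof clarsimp
    fix t :: real assume t: "0 \<le> t" "t < 1"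
    have "r * t \<le> t" using t assms by (intro mult_left_le_one_le) auto
    then show "norm (of_real r * of_real t :: complex) < 1" using t assms by (simp add: norm_mult)
  qed
qed (intro continuous_intros)

lemma measurable_cis [measurable]: "cis \<in> borel_measurable borel"
  by (intro borel_measurable_continuous_onI) (intro continuous_intros)

context tail_measure
begin

lemma pair_circ: "pair_sigma_finite \<mu> circ"
  using sigma_finite_mu finite_measure.axioms(1)[OF finite_measure_circ]
  by (simp add: pair_sigma_finite_def)

lemma measurable_pair_fst: "fst \<in> borel_measurable (\<mu> \<Otimes>\<^sub>M circ)"
  by (rule borel_measurable_of_unit_measure[OF sets_mu measurable_fst])

lemma measurable_pair_snd: "snd \<in> borel_measurable (\<mu> \<Otimes>\<^sub>M circ)"
  using measurable_snd[of \<mu> circ] measurable_cong_sets[OF refl sets_circ] by blast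

text \<open>Subharmonicity is used on the circle of radius r at the relative point r * t, hence the
  argument r * (r * t): then the Poisson denominator is |1 - t z|^2 with |z| = r, and
  \<open>kernel_bound\<close> applies. Working with |f|^(p/2) turns the claim into an L^2 estimate,
  so one Cauchy-Schwarz step serves every p > 0.\<close>

lemma carleson_embedding_dilated:
  assumes f: "f holomorphic_on ball 0 1" and p: "0 < p" and r: "0 < r" "r < 1"
    and M: "(\<integral>\<^sup>+\<theta>. ennreal (norm (f (of_real r * cis \<theta>)) powr p) \<partial>circ) \<le> ennreal M"
  shows "(\<integral>\<^sup>+t. ennreal (norm (f (of_real (r * (r * t)))) powr p * inverse (1 - t)) \<partial>\<mu>) \<le> ennreal (180 * N * M)"
proof -
  define z where "z \<theta> = of_real r * cis \<theta>" for \<theta>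
  have nz: "norm (z \<theta>) < 1" for \<theta> using r by (simp add: z_def norm_mult)
  have w0: "0 < norm (1 - z \<theta>)" for \<theta> using nz[of \<theta>] by auto
  have [measurable]: "(\<lambda>\<theta>. f (z \<theta>)) \<in> borel_measurable borel"
    unfolding z_def using measurable_circle[OF f] r by auto
  have [measurable]: "(\<lambda>\<theta>. f (z \<theta>)) \<in> borel_measurable circ"
    using measurable_cong_sets[OF sets_circ refl] \<open>(\<lambda>\<theta>. f (z \<theta>)) \<in> borel_measurable borel\<close> by blast
  have [measurable]: "z \<in> borel_measurable borel" unfolding z_def by measurable
  note id = measurable_mu_id
  interpret pair_sigma_finite \<mu> circ by (rule pair_circ)
  define G where "G \<theta> = 4 * norm (f (z \<theta>)) powr p * norm (1 - z \<theta>) powr (1/2)" for \<theta>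
  define k where "k t \<theta> = inverse (1 - t) * norm (1 - of_real t * z \<theta>) powr (-3/2)" for t \<theta>
  have [measurable]: "G \<in> borel_measurable borel" unfolding G_def by measurable
  have km: "(\<lambda>(t, \<theta>). k t \<theta>) \<in> borel_measurable (\<mu> \<Otimes>\<^sub>M circ)"
    using measurable_pair_fst measurable_pair_snd unfolding k_def case_prod_unfold by measurable
  have k1[measurable]: "(\<lambda>t. k t \<theta>) \<in> borel_measurable \<mu>" for \<theta>
    using id unfolding k_def by measurable
  have k2[measurable]: "(\<lambda>\<theta>. k t \<theta>) \<in> borel_measurable borel" for t
    unfolding k_def by measurable
  have pt: "ennreal (norm (f (of_real (r * (r * t)))) powr p * inverse (1 - t))
      \<le> (\<integral>\<^sup>+\<theta>. ennreal (G \<theta>) * ennreal (k t \<theta>) \<partial>circ)" if t: "t \<in> {0..<1}" for t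
  proof -
    have rt: "0 \<le> r * t" "r * t < 1"
      using r t mult_strict_mono'[of r 1 t 1] by auto
    have [measurable]: "pois (r * t) \<in> borel_measurable borel"
      using rt by (intro borel_measurable_continuous_onI continuous_pois) auto
    have pn: "0 \<le> pois (r * t) \<theta>" for \<theta> using pois_nonneg rt by auto
    have "r\<^sup>2 * t \<le> t" using r t by (simp add: mult_left_le_one_le abs_square_le_1)
    then have s: "0 < 1 - r\<^sup>2 * t" using t by simp
    define A where "A = sqrt 2 * (1 - r\<^sup>2 * t) powr (-1/2)"
    have A: "0 < A" using s by (simp add: A_def)
    define X where "X = norm (f (of_real (r * (r * t)))) powr (p/2)"
    \<comment> \<open>The Schur weight |1 - z|^(1/2) goes into u and its inverse into K, whose mass
      is at most A by \<open>poisson_weight\<close>.\<close>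
    define u where "u \<theta> = norm (f (z \<theta>)) powr (p/2) * norm (1 - z \<theta>) powr (1/2)" for \<theta>
    define K where "K \<theta> = norm (1 - z \<theta>) powr (-1/2) * pois (r * t) \<theta>" for \<theta>
    have uK: "u \<theta> * K \<theta> = norm (f (z \<theta>)) powr (p/2) * pois (r * t) \<theta>" for \<theta>
    proof -
      have "norm (1 - z \<theta>) powr (1/2) * norm (1 - z \<theta>) powr (-1/2) = 1"
        using w0[of \<theta>] by (subst powr_add[symmetric]) simp
      then show ?thesis by (simp add: u_def K_def mult_ac)
    qed
    have "ennreal (X powr 2) \<le> ennreal (A powr (2 - 1)) * (\<integral>\<^sup>+\<theta>. ennreal (u \<theta> powr 2 * K \<theta>) \<partial>circ)"
    proof (rule holder_kernel)
      show "u \<in> borel_measurable circ" "K \<in> borel_measurable circ"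
        unfolding u_def K_def by measurable
      show "0 \<le> u \<theta>" "0 \<le> K \<theta>" for \<theta> by (auto simp: u_def K_def pn)
      show "ennreal X \<le> (\<integral>\<^sup>+\<theta>. ennreal (u \<theta> * K \<theta>) \<partial>circ)"
        unfolding X_def uK z_def using p r rt by (intro subharmonic_powr[OF f]) auto
      show "(\<integral>\<^sup>+\<theta>. ennreal (K \<theta>) \<partial>circ) \<le> ennreal A"
        unfolding K_def A_def z_def using r t by (intro poisson_weight) auto
    qed (use A in \<open>auto simp: X_def\<close>)
    also have "A powr (2 - 1) = A" using A by simp
    also have "X powr 2 = norm (f (of_real (r * (r * t)))) powr p"
      by (simp only: X_def powr_powr) simp
    finally have le: "ennreal (norm (f (of_real (r * (r * t)))) powr p)
        \<le> ennreal A * (\<integral>\<^sup>+\<theta>. ennreal (u \<theta> powr 2 * K \<theta>) \<partial>circ)" .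
    have "ennreal (norm (f (of_real (r * (r * t)))) powr p * inverse (1 - t))
        = ennreal (inverse (1 - t)) * ennreal (norm (f (of_real (r * (r * t)))) powr p)"
      using t by (subst mult.commute) (intro ennreal_mult', auto)
    also have "\<dots> \<le> ennreal (inverse (1 - t)) * (ennreal A * (\<integral>\<^sup>+\<theta>. ennreal (u \<theta> powr 2 * K \<theta>) \<partial>circ))"
      by (intro mult_left_mono le) auto
    also have "\<dots> = ennreal (inverse (1 - t) * A) * (\<integral>\<^sup>+\<theta>. ennreal (u \<theta> powr 2 * K \<theta>) \<partial>circ)"
      using t by (subst ennreal_mult') (auto simp: mult.assoc)
    also have "\<dots> = (\<integral>\<^sup>+\<theta>. ennreal (inverse (1 - t) * A) * ennreal (u \<theta> powr 2 * K \<theta>) \<partial>circ)"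
      by (rule nn_integral_cmult[symmetric]) (simp add: u_def K_def)
    also have "\<dots> \<le> (\<integral>\<^sup>+\<theta>. ennreal (G \<theta>) * ennreal (k t \<theta>) \<partial>circ)"
    proof (rule nn_integral_mono)
      fix \<theta>
      define n where "n = norm (1 - of_real t * z \<theta>)"
      have n: "1 - t \<le> n" "1 - r * t \<le> n"
      proof -
        show "1 - t \<le> n" unfolding n_def using norm_one_minus_ge[OF nz t] by simp
        have "norm (of_real t * z \<theta>) = r * t" using r t by (simp add: z_def norm_mult)
        then show "1 - r * t \<le> n"
          unfolding n_def using norm_triangle_ineq2[of 1 "of_real t * z \<theta>"] by simp
      qed
      have n0: "0 < n" using n(1) t by auto
      have pois: "pois (r * t) \<theta> = (1 - (r * t)\<^sup>2) / n\<^sup>2"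
        by (simp add: pois_def n_def z_def mult_ac)
      \<comment> \<open>Expanded, this is 1 - 2 r^2 t + r^2 t^2, the difference of the two sides of
        c1.\<close>
      have "0 \<le> r\<^sup>2 * (1 - t)\<^sup>2 + (1 - r\<^sup>2)" using r by (simp add: abs_square_le_1)
      then have c1: "1 - (r * t)\<^sup>2 \<le> 2 * (1 - r\<^sup>2 * t)"
        by (simp add: power2_eq_square algebra_simps)
      \<comment> \<open>Write 1 - r^2 t = (1 - r t) + r t (1 - r); the second summand is at most 1 -
        r \<le> 1 - r t, and 1 - r t \<le> n.\<close>
      have "t * r * (1 - r) \<le> 1 * (1 - r)"
        using r rt by (intro mult_right_mono) (auto simp: mult.commute)
      moreover have "r * t \<le> r" using r t by (simp add: mult_left_le)
      ultimately have c2: "1 - r\<^sup>2 * t \<le> 2 * n"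
        using n(2) by (simp add: power2_eq_square algebra_simps)
      \<comment> \<open>A is of size (1 - r^2 t)^(-1/2) and the kernel of size (1 - r^2 t) / n^2.
        The half power left over is absorbed into n, which produces the exponent -3/2 and the
        constant 2 sqrt 2 * sqrt 2 = 4.\<close>
      have "A * pois (r * t) \<theta> \<le> A * (2 * (1 - r\<^sup>2 * t) / n\<^sup>2)"
        unfolding pois using A c1 by (intro mult_left_mono divide_right_mono) auto
      also have "\<dots> = 2 * sqrt 2 * ((1 - r\<^sup>2 * t) powr (-1/2) * (1 - r\<^sup>2 * t) powr 1) / n\<^sup>2"
        using s by (simp add: A_def)
      also have "(1 - r\<^sup>2 * t) powr (-1/2) * (1 - r\<^sup>2 * t) powr 1 = (1 - r\<^sup>2 * t) powr (1/2)"
        by (subst powr_add[symmetric]) simp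
      also have "2 * sqrt 2 * (1 - r\<^sup>2 * t) powr (1/2) / n\<^sup>2 \<le> 2 * sqrt 2 * (2 * n) powr (1/2) / n\<^sup>2"
        using c2 s by (intro mult_left_mono divide_right_mono powr_mono2) auto
      also have "\<dots> = 4 * (n powr (1/2) * n powr (-2))"
        using n0 by (simp add: powr_mult powr_half_sqrt powr_minus field_simps)
      also have "n powr (1/2) * n powr (-2) = n powr (-3/2)"
        by (subst powr_add[symmetric]) simp
      finally have Ap: "A * pois (r * t) \<theta> \<le> 4 * n powr (-3/2)" .
      have "u \<theta> powr 2 = norm (f (z \<theta>)) powr p * norm (1 - z \<theta>) powr 1"
        by (simp only: u_def powr_mult powr_powr) simp
      then have "u \<theta> powr 2 * K \<theta> = norm (f (z \<theta>)) powr p * (norm (1 - z \<theta>) powr 1 * norm (1 - z \<theta>) powr (-1/2)) * pois (r * t) \<theta>"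
        by (simp add: K_def)
      also have "norm (1 - z \<theta>) powr 1 * norm (1 - z \<theta>) powr (-1/2) = norm (1 - z \<theta>) powr (1/2)"
        by (subst powr_add[symmetric]) simp
      finally have "inverse (1 - t) * A * (u \<theta> powr 2 * K \<theta>)
          = (inverse (1 - t) * norm (f (z \<theta>)) powr p * norm (1 - z \<theta>) powr (1/2)) * (A * pois (r * t) \<theta>)"
        by (simp add: mult_ac)
      also have "\<dots> \<le> (inverse (1 - t) * norm (f (z \<theta>)) powr p * norm (1 - z \<theta>) powr (1/2)) * (4 * n powr (-3/2))"
        using t by (intro mult_left_mono Ap) auto
      also have "\<dots> = G \<theta> * k t \<theta>" by (simp add: G_def k_def n_def)
      finally have "ennreal (inverse (1 - t) * A * (u \<theta> powr 2 * K \<theta>)) \<le> ennreal (G \<theta> * k t \<theta>)"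
        by (rule ennreal_leI)
      also have "\<dots> = ennreal (G \<theta>) * ennreal (k t \<theta>)"
        by (rule ennreal_mult') (simp add: G_def)
      also have "ennreal (inverse (1 - t) * A * (u \<theta> powr 2 * K \<theta>))
          = ennreal (inverse (1 - t) * A) * ennreal (u \<theta> powr 2 * K \<theta>)"
        using t A by (intro ennreal_mult') auto
      finally show "ennreal (inverse (1 - t) * A) * ennreal (u \<theta> powr 2 * K \<theta>) \<le> ennreal (G \<theta>) * ennreal (k t \<theta>)" .
    qed
    finally show ?thesis .
  qed
  have "(\<integral>\<^sup>+t. ennreal (norm (f (of_real (r * (r * t)))) powr p * inverse (1 - t)) \<partial>\<mu>)
      \<le> (\<integral>\<^sup>+t. \<integral>\<^sup>+\<theta>. ennreal (G \<theta>) * ennreal (k t \<theta>) \<partial>circ \<partial>\<mu>)"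
    using pt by (intro nn_integral_mono) (simp add: space_mu)
  also have "\<dots> = (\<integral>\<^sup>+\<theta>. \<integral>\<^sup>+t. ennreal (G \<theta>) * ennreal (k t \<theta>) \<partial>\<mu> \<partial>circ)"
    by (rule Fubini'[symmetric]) (use km in \<open>simp add: case_prod_unfold\<close>)
  \<comment> \<open>The inner integral returns |1 - z|^(-1/2), which cancels the weight inside
    \<open>G\<close>; 180 = 4 * 45.\<close>
  also have "\<dots> \<le> (\<integral>\<^sup>+\<theta>. ennreal (180 * N) * ennreal (norm (f (z \<theta>)) powr p) \<partial>circ)"
  proof (rule nn_integral_mono)
    fix \<theta>
    have "(\<integral>\<^sup>+t. ennreal (G \<theta>) * ennreal (k t \<theta>) \<partial>\<mu>) = ennreal (G \<theta>) * (\<integral>\<^sup>+t. ennreal (k t \<theta>) \<partial>\<mu>)"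
      by (rule nn_integral_cmult) measurable
    also have "\<dots> \<le> ennreal (G \<theta>) * ennreal (45 * N * norm (1 - z \<theta>) powr (-1/2))"
      unfolding k_def by (intro mult_left_mono kernel_bound nz) auto
    also have "\<dots> = ennreal (G \<theta> * (45 * N * norm (1 - z \<theta>) powr (-1/2)))"
      by (rule ennreal_mult'[symmetric]) (simp add: G_def)
    also have "G \<theta> * (45 * N * norm (1 - z \<theta>) powr (-1/2))
        = 180 * N * norm (f (z \<theta>)) powr p * (norm (1 - z \<theta>) powr (1/2) * norm (1 - z \<theta>) powr (-1/2))"
      by (simp add: G_def)
    also have "norm (1 - z \<theta>) powr (1/2) * norm (1 - z \<theta>) powr (-1/2) = 1"
      using w0[of \<theta>] by (subst powr_add[symmetric]) simp
    also have "ennreal (180 * N * norm (f (z \<theta>)) powr p * 1) = ennreal (180 * N) * ennreal (norm (f (z \<theta>)) powr p)"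
      unfolding mult_1_right using N_pos by (intro ennreal_mult') simp
    finally show "(\<integral>\<^sup>+t. ennreal (G \<theta>) * ennreal (k t \<theta>) \<partial>\<mu>) \<le> ennreal (180 * N) * ennreal (norm (f (z \<theta>)) powr p)" .
  qed
  also have "\<dots> = ennreal (180 * N) * (\<integral>\<^sup>+\<theta>. ennreal (norm (f (z \<theta>)) powr p) \<partial>circ)"
    by (rule nn_integral_cmult) measurable
  also have "\<dots> \<le> ennreal (180 * N) * ennreal M"
    using M unfolding z_def by (intro mult_left_mono) auto
  also have "\<dots> = ennreal (180 * N * M)"
    using N_pos by (intro ennreal_mult'[symmetric]) simp
  finally show ?thesis .
qed

text \<open>The dilated constant is independent of r, so Fatou's lemma along a sequence of radii
  tending to 1 removes the dilation.\<close>

lemma carleson_embedding: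
  assumes f: "f holomorphic_on ball 0 1" and p: "0 < p"
    and M: "\<And>r. 0 < r \<Longrightarrow> r < 1 \<Longrightarrow> (\<integral>\<^sup>+\<theta>. ennreal (norm (f (of_real r * cis \<theta>)) powr p) \<partial>circ) \<le> ennreal M"
  shows "(\<integral>\<^sup>+t. ennreal (norm (f (of_real t)) powr p * inverse (1 - t)) \<partial>\<mu>) \<le> ennreal (180 * N * M)"
proof (rule nn_integral_limit_le)
  define r where "r n = real (Suc n) / real (Suc (Suc n))" for n
  have r: "0 < r n" "r n < 1" for n by (auto simp: r_def)
  have lim: "r \<longlonglongrightarrow> 1"
    unfolding r_def by (rule LIMSEQ_n_over_Suc_n[THEN LIMSEQ_Suc])
  have [measurable]: "(\<lambda>t. t) \<in> borel_measurable \<mu>" by (rule measurable_mu_id)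
  show "(\<integral>\<^sup>+t. ennreal (norm (f (of_real (r n * (r n * t)))) powr p * inverse (1 - t)) \<partial>\<mu>) \<le> ennreal (180 * N * M)" for n
    by (rule carleson_embedding_dilated[OF f p r M[OF r]])
  show "(\<lambda>t. ennreal (norm (f (of_real (r n * (r n * t)))) powr p * inverse (1 - t))) \<in> borel_measurable \<mu>" for n
  proof -
    have "(\<lambda>t. f (of_real (r n * r n * t))) \<in> borel_measurable \<mu>"
      using r[of n] by (intro measurable_restrict_unit[OF sets_mu] continuous_on_radius[OF f]) (auto intro!: mult_le_one)
    then have [measurable]: "(\<lambda>t. f (of_real (r n * (r n * t)))) \<in> borel_measurable \<mu>"
      by (simp add: mult.assoc)
    show ?thesis by measurable
  qed
  show "(\<lambda>n. ennreal (norm (f (of_real (r n * (r n * t)))) powr p * inverse (1 - t)))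
      \<longlonglongrightarrow> ennreal (norm (f (of_real t)) powr p * inverse (1 - t))" if "t \<in> space \<mu>" for t
  proof -
    have t: "t \<in> {0..<1}" using that by (simp add: space_mu)
    have "(\<lambda>n. of_real (r n * (r n * t)) :: complex) \<longlonglongrightarrow> of_real (1 * (1 * t))"
      by (intro tendsto_of_real tendsto_mult lim tendsto_const)
    moreover have "isCont f (of_real t)"
      using holomorphic_on_imp_continuous_on[OF f] t by (intro continuous_on_interior[of "ball 0 1"]) auto
    ultimately have "(\<lambda>n. f (of_real (r n * (r n * t)))) \<longlonglongrightarrow> f (of_real t)"
      by (intro isCont_tendsto_compose[of _ f]) auto
    then show ?thesis
      using p by (intro tendsto_ennrealI tendsto_mult tendsto_const tendsto_powr2 tendsto_norm) auto
  qed
qed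

text \<open>X stands for any quantity dominated by the integral operator; sufficiency later inserts
  the part of |DH| that exceeds a small \<delta>. Hoelder contributes N^(p-1) and the embedding one
  more N, so the p-th powers scale like N^p. The constant is 24300 = 3 * 180 * 45, from
  \<open>poisson_weight_powr\<close>, \<open>carleson_embedding\<close> and
  \<open>kernel_bound\<close> with p - 1 \<le> 1.\<close>

lemma operator_bound:
  assumes f: "f holomorphic_on ball 0 1" and p: "1 \<le> p" "p \<le> 2" and r: "0 < r" "r < 1"
    and M0: "0 \<le> M"
    and M: "\<And>r. 0 < r \<Longrightarrow> r < 1 \<Longrightarrow> (\<integral>\<^sup>+\<theta>. ennreal (norm (f (of_real r * cis \<theta>)) powr p) \<partial>circ) \<le> ennreal M"
    and X: "\<And>\<theta>. 0 \<le> X \<theta>"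
      "\<And>\<theta>. ennreal (X \<theta>) \<le> (\<integral>\<^sup>+t. ennreal (norm (f (of_real t)) * inverse ((norm (1 - of_real t * (of_real r * cis \<theta>)))\<^sup>2)) \<partial>\<mu>)"
  shows "(\<integral>\<^sup>+\<theta>. ennreal (X \<theta> powr p) \<partial>circ) \<le> ennreal (24300 * N powr p * M)"
proof -
  define z where "z \<theta> = of_real r * cis \<theta>" for \<theta>
  have nz: "norm (z \<theta>) < 1" for \<theta> using r by (simp add: z_def norm_mult)
  have w0: "0 < norm (1 - z \<theta>)" for \<theta> using nz[of \<theta>] by auto
  have [measurable]: "z \<in> borel_measurable borel" unfolding z_def by measurable
  have kc: "(\<lambda>\<theta>. norm (1 - z \<theta>) powr c * inverse ((norm (1 - of_real t * z \<theta>))\<^sup>2)) \<in> borel_measurable circ" for c t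
  proof -
    have "(\<lambda>\<theta>. norm (1 - z \<theta>) powr c * inverse ((norm (1 - of_real t * z \<theta>))\<^sup>2)) \<in> borel_measurable borel"
      by measurable
    then show ?thesis using measurable_cong_sets[OF sets_circ refl] by blast
  qed
  have [measurable]: "(\<lambda>t. t) \<in> borel_measurable \<mu>" by (rule measurable_mu_id)
  have [measurable]: "(\<lambda>t. f (of_real t)) \<in> borel_measurable \<mu>"
    using measurable_restrict_unit[OF sets_mu continuous_on_radius[OF f, of 1]] by simp
  note [measurable] = measurable_pair_fst measurable_pair_snd
  have [measurable]: "(\<lambda>x. f (of_real (fst x))) \<in> borel_measurable (\<mu> \<Otimes>\<^sub>M circ)"
    by (rule measurable_compose[OF measurable_fst]) measurable
  interpret pair_sigma_finite \<mu> circ by (rule pair_circ)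
  define c where "c = (45 * N) powr (p - 1)"
  define n where "n t \<theta> = norm (1 - of_real t * z \<theta>)" for t \<theta>
  have n_ge: "1 - t \<le> n t \<theta>" if "t \<in> {0..<1}" for t \<theta>
    unfolding n_def using norm_one_minus_ge[OF nz that] by simp
  have n1[measurable]: "(\<lambda>t. n t \<theta>) \<in> borel_measurable \<mu>" for \<theta>
    unfolding n_def by measurable
  have n2[measurable]: "(\<lambda>\<theta>. n t \<theta>) \<in> borel_measurable borel" for t
    unfolding n_def by measurable
  have n3[measurable]: "(\<lambda>x. n (fst x) (snd x)) \<in> borel_measurable (\<mu> \<Otimes>\<^sub>M circ)"
    unfolding n_def by measurable
  define G where "G t = c * norm (f (of_real t)) powr p * (1 - t) powr ((p - 1)/2)" for t
  define k where "k t \<theta> = norm (1 - z \<theta>) powr (-(p - 1)/2) * inverse ((n t \<theta>)\<^sup>2)" for t \<theta>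
  have pt: "ennreal (X \<theta> powr p) \<le> (\<integral>\<^sup>+t. ennreal (G t) * ennreal (k t \<theta>) \<partial>\<mu>)" for \<theta>
  proof -
    define A where "A = 45 * N * norm (1 - z \<theta>) powr (-1/2)"
    have A: "0 < A" using N_pos w0[of \<theta>] by (simp add: A_def)
    define u where "u t = norm (f (of_real t)) * (1 - t) powr (1/2)" for t
    \<comment> \<open>This time the Schur weight is (1 - t)^(1/2). The mass of K brings in |1 -
      z|^(-(p-1)/2), the weight of the circle integral below.\<close>
    define K where "K t = (1 - t) powr (-1/2) * inverse ((n t \<theta>)\<^sup>2)" for t
    have "ennreal (X \<theta> powr p) \<le> ennreal (A powr (p - 1)) * (\<integral>\<^sup>+t. ennreal (u t powr p * K t) \<partial>\<mu>)"
    proof (rule holder_kernel)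
      show "u \<in> borel_measurable \<mu>" "K \<in> borel_measurable \<mu>"
        unfolding u_def K_def by measurable
      show "0 \<le> u t" "0 \<le> K t" for t by (auto simp: u_def K_def)
      have "(\<integral>\<^sup>+t. ennreal (u t * K t) \<partial>\<mu>) = (\<integral>\<^sup>+t. ennreal (norm (f (of_real t)) * inverse ((n t \<theta>)\<^sup>2)) \<partial>\<mu>)"
      proof (rule nn_integral_cong)
        fix t assume "t \<in> space \<mu>"
        then have "(1 - t) powr (1/2) * (1 - t) powr (-1/2) = 1"
          by (subst powr_add[symmetric]) (simp add: space_mu)
        then show "ennreal (u t * K t) = ennreal (norm (f (of_real t)) * inverse ((n t \<theta>)\<^sup>2))"
          by (simp add: u_def K_def mult_ac)
      qed
      then show "ennreal (X \<theta>) \<le> (\<integral>\<^sup>+t. ennreal (u t * K t) \<partial>\<mu>)"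
        using X(2)[of \<theta>] by (simp add: n_def z_def)
      have "(\<integral>\<^sup>+t. ennreal (K t) \<partial>\<mu>) \<le> (\<integral>\<^sup>+t. ennreal (inverse (1 - t) * norm (1 - of_real t * z \<theta>) powr (-3/2)) \<partial>\<mu>)"
      proof (intro nn_integral_mono ennreal_leI)
        fix t assume "t \<in> space \<mu>"
        then have t: "t \<in> {0..<1}" by (simp add: space_mu)
        have n0: "0 < n t \<theta>" using n_ge[OF t, of \<theta>] t by simp
        \<comment> \<open>Half a power of 1 - t is traded for half a power of the larger n, which
          yields exactly the integrand of \<open>kernel_bound\<close>.\<close>
        have "K t = ((1 - t) powr (-1) * (1 - t) powr (1/2)) * (n t \<theta>) powr (-2)"
          unfolding K_def using n0 by (subst powr_add[symmetric]) (simp add: powr_minus)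
        also have "\<dots> \<le> ((1 - t) powr (-1) * (n t \<theta>) powr (1/2)) * (n t \<theta>) powr (-2)"
          using n_ge[OF t] t by (intro mult_right_mono mult_left_mono powr_mono2) auto
        also have "\<dots> = (1 - t) powr (-1) * (n t \<theta>) powr (-3/2)"
          unfolding mult.assoc by (subst powr_add[symmetric]) simp
        finally show "K t \<le> inverse (1 - t) * norm (1 - of_real t * z \<theta>) powr (-3/2)"
          using t by (simp add: powr_minus n_def)
      qed
      also have "\<dots> \<le> ennreal A" unfolding A_def by (rule kernel_bound[OF nz])
      finally show "(\<integral>\<^sup>+t. ennreal (K t) \<partial>\<mu>) \<le> ennreal A" .
    qed (use A p X in auto)
    also have "\<dots> = (\<integral>\<^sup>+t. ennreal (A powr (p - 1)) * ennreal (u t powr p * K t) \<partial>\<mu>)"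
      by (rule nn_integral_cmult[symmetric]) (simp add: u_def K_def)
    also have "\<dots> = (\<integral>\<^sup>+t. ennreal (G t) * ennreal (k t \<theta>) \<partial>\<mu>)"
    proof (rule nn_integral_cong)
      fix t assume "t \<in> space \<mu>"
      then have t: "t \<in> {0..<1}" by (simp add: space_mu)
      have "u t powr p = norm (f (of_real t)) powr p * (1 - t) powr (p/2)"
        by (simp add: u_def powr_mult powr_powr)
      moreover have "(1 - t) powr (p/2) * (1 - t) powr (-1/2) = (1 - t) powr ((p - 1)/2)"
        by (subst powr_add[symmetric]) (simp add: diff_divide_distrib)
      ultimately have 1: "u t powr p * K t = norm (f (of_real t)) powr p * (1 - t) powr ((p - 1)/2) * inverse ((n t \<theta>)\<^sup>2)"
        by (simp add: K_def mult.assoc)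
      have 2: "A powr (p - 1) = c * norm (1 - z \<theta>) powr (-(p - 1)/2)"
      proof -
        have e: "(-1/2) * (p - 1) = -(p - 1)/2" by (simp add: field_simps)
        show ?thesis
          unfolding A_def c_def powr_mult[of "45 * N"] powr_powr e ..
      qed
      have "A powr (p - 1) * (u t powr p * K t) = G t * k t \<theta>"
        unfolding 1 2 G_def k_def by (simp only: mult_ac)
      then show "ennreal (A powr (p - 1)) * ennreal (u t powr p * K t) = ennreal (G t) * ennreal (k t \<theta>)"
        by (simp add: c_def G_def flip: ennreal_mult')
    qed
    finally show ?thesis .
  qed
  have "(\<integral>\<^sup>+\<theta>. ennreal (X \<theta> powr p) \<partial>circ) \<le> (\<integral>\<^sup>+\<theta>. \<integral>\<^sup>+t. ennreal (G t) * ennreal (k t \<theta>) \<partial>\<mu> \<partial>circ)"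
    by (intro nn_integral_mono pt)
  also have "\<dots> = (\<integral>\<^sup>+t. \<integral>\<^sup>+\<theta>. ennreal (G t) * ennreal (k t \<theta>) \<partial>circ \<partial>\<mu>)"
    by (rule Fubini') (simp add: case_prod_unfold G_def k_def)
  also have "\<dots> \<le> (\<integral>\<^sup>+t. ennreal (3 * c) * ennreal (norm (f (of_real t)) powr p * inverse (1 - t)) \<partial>\<mu>)"
  proof (rule nn_integral_mono)
    fix t assume "t \<in> space \<mu>"
    then have t: "0 \<le> t" "t < 1" by (auto simp: space_mu)
    have rt: "0 \<le> r * t" "r * t < 1"
      using r t mult_strict_mono'[of r 1 t 1] by auto
    have "(\<integral>\<^sup>+\<theta>. ennreal (k t \<theta>) \<partial>circ)
        \<le> (\<integral>\<^sup>+\<theta>. ennreal (inverse (1 - t)) * ennreal (norm (1 - of_real r * cis \<theta>) powr (-(p - 1)/2) * pois (r * t) \<theta>) \<partial>circ)"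
    proof (rule nn_integral_mono)
      fix \<theta>
      \<comment> \<open>This makes the Poisson numerator at least 1 - t, so the squared kernel is at
        most the Poisson kernel divided by 1 - t. That quotient supplies the factor 1 / (1 - t) of
        the embedding.\<close>
      have "(r * t)\<^sup>2 \<le> t"
      proof -
        have "(r * t) * (r * t) \<le> 1 * t"
          using rt r t by (intro mult_mono) (auto simp: mult_left_le_one_le)
        then show ?thesis by (simp add: power2_eq_square)
      qed
      then have "(1 - t) / (n t \<theta>)\<^sup>2 \<le> pois (r * t) \<theta>"
        unfolding pois_def n_def z_def by (simp add: mult_ac divide_right_mono)
      then have le: "inverse (1 - t) * ((1 - t) / (n t \<theta>)\<^sup>2) \<le> inverse (1 - t) * pois (r * t) \<theta>"
        using t by (intro mult_left_mono) auto
      have "inverse (1 - t) * ((1 - t) / (n t \<theta>)\<^sup>2) = inverse ((n t \<theta>)\<^sup>2)"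
        using t by (simp add: divide_inverse)
      with le have "inverse ((n t \<theta>)\<^sup>2) \<le> inverse (1 - t) * pois (r * t) \<theta>"
        by (simp only:)
      then have "k t \<theta> \<le> norm (1 - z \<theta>) powr (-(p - 1)/2) * (inverse (1 - t) * pois (r * t) \<theta>)"
        unfolding k_def by (intro mult_left_mono) auto
      then have "ennreal (k t \<theta>) \<le> ennreal (inverse (1 - t) * (norm (1 - of_real r * cis \<theta>) powr (-(p - 1)/2) * pois (r * t) \<theta>))"
        by (intro ennreal_leI) (simp only: z_def mult_ac)
      also have "\<dots> = ennreal (inverse (1 - t)) * ennreal (norm (1 - of_real r * cis \<theta>) powr (-(p - 1)/2) * pois (r * t) \<theta>)"
        using t by (intro ennreal_mult') simp
      finally show "ennreal (k t \<theta>) \<le> ennreal (inverse (1 - t)) * ennreal (norm (1 - of_real r * cis \<theta>) powr (-(p - 1)/2) * pois (r * t) \<theta>)" .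
    qed
    also have "\<dots> = ennreal (inverse (1 - t)) * (\<integral>\<^sup>+\<theta>. ennreal (norm (1 - of_real r * cis \<theta>) powr (-(p - 1)/2) * pois (r * t) \<theta>) \<partial>circ)"
    proof (rule nn_integral_cmult, rule measurable_compose[OF _ measurable_ennreal])
      have "continuous_on UNIV (\<lambda>\<theta>. norm (1 - of_real r * cis \<theta>) powr (-(p - 1)/2) * pois (r * t) \<theta>)"
        using rt w0 unfolding z_def by (intro continuous_intros continuous_pois) fastforce+
      then show "(\<lambda>\<theta>. norm (1 - of_real r * cis \<theta>) powr (-(p - 1)/2) * pois (r * t) \<theta>) \<in> borel_measurable circ"
        using borel_measurable_continuous_onI measurable_cong_sets[OF sets_circ refl] by blast
    qed
    also have "\<dots> \<le> ennreal (inverse (1 - t)) * ennreal (3 * (1 - t) powr (-(p - 1)/2))"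
      using r t p by (intro mult_left_mono poisson_weight_powr) auto
    finally have kint: "(\<integral>\<^sup>+\<theta>. ennreal (k t \<theta>) \<partial>circ) \<le> ennreal (inverse (1 - t)) * ennreal (3 * (1 - t) powr (-(p - 1)/2))" .
    have "(\<integral>\<^sup>+\<theta>. ennreal (G t) * ennreal (k t \<theta>) \<partial>circ) = ennreal (G t) * (\<integral>\<^sup>+\<theta>. ennreal (k t \<theta>) \<partial>circ)"
      unfolding k_def n_def
      by (rule nn_integral_cmult, rule measurable_compose[OF _ measurable_ennreal], rule kc)
    also have "\<dots> \<le> ennreal (G t) * (ennreal (inverse (1 - t)) * ennreal (3 * (1 - t) powr (-(p - 1)/2)))"
      by (intro mult_left_mono kint) auto
    also have "\<dots> = ennreal (G t * (inverse (1 - t) * (3 * (1 - t) powr (-(p - 1)/2))))"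
      using t by (simp add: ennreal_mult' G_def c_def)
    also have "G t * (inverse (1 - t) * (3 * (1 - t) powr (-(p - 1)/2)))
        = 3 * c * (norm (f (of_real t)) powr p * inverse (1 - t)) * ((1 - t) powr ((p - 1)/2) * (1 - t) powr (-(p - 1)/2))"
      unfolding G_def by (simp only: mult_ac)
    also have "(1 - t) powr ((p - 1)/2) * (1 - t) powr (-(p - 1)/2) = 1"
    proof -
      have e: "(p - 1)/2 + -(p - 1)/2 = 0" by (simp add: field_simps)
      show ?thesis unfolding powr_add[symmetric] e using t by simp
    qed
    also have "ennreal (3 * c * (norm (f (of_real t)) powr p * inverse (1 - t)) * 1)
        = ennreal (3 * c) * ennreal (norm (f (of_real t)) powr p * inverse (1 - t))"
      unfolding mult_1_right by (intro ennreal_mult') (simp add: c_def)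
    finally show "(\<integral>\<^sup>+\<theta>. ennreal (G t) * ennreal (k t \<theta>) \<partial>circ)
      \<le> ennreal (3 * c) * ennreal (norm (f (of_real t)) powr p * inverse (1 - t))" .
  qed
  also have "\<dots> = ennreal (3 * c) * (\<integral>\<^sup>+t. ennreal (norm (f (of_real t)) powr p * inverse (1 - t)) \<partial>\<mu>)"
    by (rule nn_integral_cmult) measurable
  also have "\<dots> \<le> ennreal (3 * c) * ennreal (180 * N * M)"
    using p by (intro mult_left_mono carleson_embedding[OF f _ M]) auto
  also have "\<dots> = ennreal (3 * c * (180 * N * M))"
    by (intro ennreal_mult'[symmetric]) (simp add: c_def)
  also have "\<dots> \<le> ennreal (24300 * N powr p * M)"
  proof (rule ennreal_leI)
    have "c = 45 powr (p - 1) * N powr (p - 1)" by (simp add: c_def powr_mult)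
    moreover have "N powr (p - 1) * N = N powr p" using N_pos by (simp add: powr_diff)
    ultimately have "3 * c * (180 * N * M) = 540 * 45 powr (p - 1) * (N powr p * M)"
      by (simp add: mult_ac)
    also have "\<dots> \<le> 540 * 45 powr 1 * (N powr p * M)"
      using p M0 by (intro mult_right_mono mult_left_mono powr_mono) auto
    finally show "3 * c * (180 * N * M) \<le> 24300 * N powr p * M" by simp
  qed
  finally show ?thesis .
qed

end

section \<open>Hardy spaces\<close>

lemma continuous_on_circle_powr:
  assumes f: "f holomorphic_on ball 0 1" and r: "0 \<le> r" "r < 1" and p: "0 < p"
  shows "continuous_on UNIV (\<lambda>\<theta>. norm (f (of_real r * cis \<theta>)) powr p)"
proof -
  have "continuous_on UNIV (\<lambda>\<theta>. f (of_real r * cis \<theta>))"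
    by (rule continuous_on_compose2[OF holomorphic_on_imp_continuous_on[OF f]])
       (use r in \<open>auto intro!: continuous_intros simp: norm_mult\<close>)
  then show ?thesis
    by (intro continuous_on_powr' continuous_intros) (use p in auto)
qed

lemma hardy_mean_powr:
  assumes f: "f holomorphic_on ball 0 1" and r: "0 \<le> r" "r < 1" and p: "0 < p"
  shows "hardy_mean p f r powr p = 1 / (2 * pi) * integral {0..2 * pi} (\<lambda>\<theta>. norm (f (of_real r * cis \<theta>)) powr p)"
proof -
  have "0 \<le> integral {0..2 * pi} (\<lambda>\<theta>. norm (f (of_real r * cis \<theta>)) powr p)"
    by (rule integral_nonneg)
       (use continuous_on_circle_powr[OF assms] in \<open>auto intro!: integrable_continuous_real intro: continuous_on_subset\<close>)
  then show ?thesis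
    using p unfolding hardy_mean_def powr_powr by simp
qed

lemma nn_integral_circle_powr:
  assumes "f holomorphic_on ball 0 1" "0 \<le> r" "r < 1" "0 < p"
  shows "(\<integral>\<^sup>+\<theta>. ennreal (norm (f (of_real r * cis \<theta>)) powr p) \<partial>circ) = ennreal (hardy_mean p f r powr p)"
  unfolding hardy_mean_powr[OF assms]
  by (rule nn_integral_circ_continuous[OF continuous_on_circle_powr[OF assms]]) simp

lemma hardy_mean_nonneg: "0 \<le> hardy_mean p f r"
  by (simp add: hardy_mean_def)

lemma hardy_mean_le_norm:
  assumes "f \<in> hardy p" "0 < r" "r < 1"
  shows "hardy_mean p f r \<le> hardy_norm p f"
  unfolding hardy_norm_def using assms by (intro cSUP_upper) (auto simp: hardy_def)

lemma hardy_norm_nonneg: "f \<in> hardy p \<Longrightarrow> 0 \<le> hardy_norm p f"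
  using hardy_mean_le_norm[of f p "1/2"] hardy_mean_nonneg[of p f "1/2"] by simp

lemma hardy_circle_le:
  assumes f: "f \<in> hardy p" and p: "0 < p" and r: "0 < r" "r < 1"
  shows "(\<integral>\<^sup>+\<theta>. ennreal (norm (f (of_real r * cis \<theta>)) powr p) \<partial>circ) \<le> ennreal (hardy_norm p f powr p)"
  using f p r hardy_mean_le_norm[OF f r] hardy_mean_nonneg
  by (subst nn_integral_circle_powr) (auto simp: hardy_def intro!: ennreal_leI powr_mono2)

lemma hardy_mean_le_powr:
  assumes f: "f holomorphic_on ball 0 1" and p: "0 < p" and r: "0 < r" "r < 1" and M: "0 \<le> M"
    and le: "(\<integral>\<^sup>+\<theta>. ennreal (norm (f (of_real r * cis \<theta>)) powr p) \<partial>circ) \<le> ennreal M"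
  shows "hardy_mean p f r \<le> M powr (1 / p)"
proof -
  have "hardy_mean p f r powr p \<le> M"
    using le nn_integral_circle_powr[OF f _ _ p, of r] r M by (simp add: ennreal_le_iff)
  then have "(hardy_mean p f r powr p) powr (1 / p) \<le> M powr (1 / p)"
    using p by (intro powr_mono2) auto
  then show ?thesis using p hardy_mean_nonneg[of p f r] by (simp add: powr_powr)
qed

lemma hardyI:
  assumes f: "f holomorphic_on ball 0 1" and p: "0 < p" and M: "0 \<le> M"
    and le: "\<And>r. 0 < r \<Longrightarrow> r < 1 \<Longrightarrow> (\<integral>\<^sup>+\<theta>. ennreal (norm (f (of_real r * cis \<theta>)) powr p) \<partial>circ) \<le> ennreal M"
  shows "f \<in> hardy p" "hardy_norm p f \<le> M powr (1 / p)"
proof -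
  have *: "hardy_mean p f r \<le> M powr (1 / p)" if "r \<in> {0<..<1}" for r
    using that hardy_mean_le_powr[OF f p _ _ M le] by auto
  then show "f \<in> hardy p" using f by (auto simp: hardy_def intro!: bdd_aboveI2[where M = "M powr (1 / p)"])
  show "hardy_norm p f \<le> M powr (1 / p)"
    unfolding hardy_norm_def using * by (intro cSUP_least) auto
qed

text \<open>A crude form of the triangle inequality for p-th powers, sufficient for boundedness and
  for convergence to zero.\<close>

lemma powr_add_le:
  fixes a b :: real
  assumes "0 \<le> a" "0 \<le> b" "0 < p"
  shows "(a + b) powr p \<le> 2 powr p * (a powr p + b powr p)"
proof -
  have "(a + b) powr p \<le> (2 * max a b) powr p"
    using assms by (intro powr_mono2) auto
  also have "\<dots> = 2 powr p * max a b powr p" by (rule powr_mult)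
  also have "\<dots> \<le> 2 powr p * (a powr p + b powr p)"
    by (intro mult_left_mono) (auto simp: max_def)
  finally show ?thesis .
qed

lemma circle_diff_le:
  assumes f: "f holomorphic_on ball 0 1" and g: "g holomorphic_on ball 0 1" and p: "0 < p" and r: "0 < r" "r < 1"
    and Mf: "(\<integral>\<^sup>+\<theta>. ennreal (norm (f (of_real r * cis \<theta>)) powr p) \<partial>circ) \<le> ennreal Mf" "0 \<le> Mf"
    and Mg: "(\<integral>\<^sup>+\<theta>. ennreal (norm (g (of_real r * cis \<theta>)) powr p) \<partial>circ) \<le> ennreal Mg" "0 \<le> Mg"
  shows "(\<integral>\<^sup>+\<theta>. ennreal (norm (f (of_real r * cis \<theta>) - g (of_real r * cis \<theta>)) powr p) \<partial>circ) \<le> ennreal (2 powr p * (Mf + Mg))"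
proof -
  have "(\<lambda>\<theta>. f (of_real r * cis \<theta>)) \<in> borel_measurable borel" "(\<lambda>\<theta>. g (of_real r * cis \<theta>)) \<in> borel_measurable borel"
    using measurable_circle f g r by auto
  then have [measurable]: "(\<lambda>\<theta>. f (of_real r * cis \<theta>)) \<in> borel_measurable circ" "(\<lambda>\<theta>. g (of_real r * cis \<theta>)) \<in> borel_measurable circ"
    using measurable_cong_sets[OF sets_circ refl] by auto
  have "(\<integral>\<^sup>+\<theta>. ennreal (norm (f (of_real r * cis \<theta>) - g (of_real r * cis \<theta>)) powr p) \<partial>circ)
     \<le> (\<integral>\<^sup>+\<theta>. ennreal (2 powr p) * (ennreal (norm (f (of_real r * cis \<theta>)) powr p) + ennreal (norm (g (of_real r * cis \<theta>)) powr p)) \<partial>circ)"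
  proof (rule nn_integral_mono)
    fix \<theta>
    let ?a = "f (of_real r * cis \<theta>)" and ?b = "g (of_real r * cis \<theta>)"
    have "norm (?a - ?b) powr p \<le> (norm ?a + norm ?b) powr p"
      using p by (intro powr_mono2 norm_triangle_ineq4) auto
    also have "\<dots> \<le> 2 powr p * (norm ?a powr p + norm ?b powr p)"
      using p by (intro powr_add_le) auto
    finally have "ennreal (norm (?a - ?b) powr p) \<le> ennreal (2 powr p * (norm ?a powr p + norm ?b powr p))"
      by (rule ennreal_leI)
    also have "\<dots> = ennreal (2 powr p) * (ennreal (norm ?a powr p) + ennreal (norm ?b powr p))"
      by (simp add: ennreal_mult' ennreal_plus)
    finally show "ennreal (norm (?a - ?b) powr p) \<le> ennreal (2 powr p) * (ennreal (norm ?a powr p) + ennreal (norm ?b powr p))" .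
  qed
  also have "\<dots> = ennreal (2 powr p) * ((\<integral>\<^sup>+\<theta>. ennreal (norm (f (of_real r * cis \<theta>)) powr p) \<partial>circ)
      + (\<integral>\<^sup>+\<theta>. ennreal (norm (g (of_real r * cis \<theta>)) powr p) \<partial>circ))"
    by (subst nn_integral_cmult, measurable, subst nn_integral_add, measurable)
  also have "\<dots> \<le> ennreal (2 powr p) * (ennreal Mf + ennreal Mg)"
    by (intro mult_left_mono add_mono Mf Mg) auto
  also have "\<dots> = ennreal (2 powr p * (Mf + Mg))"
    using Mf Mg by (simp add: ennreal_mult' ennreal_plus)
  finally show ?thesis .
qed

lemma hardy_diff:
  assumes f: "f \<in> hardy p" and g: "g \<in> hardy p" and p: "0 < p"
  shows "(\<lambda>z. f z - g z) \<in> hardy p"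
proof (rule hardyI(1)[OF _ p])
  have hol: "f holomorphic_on ball 0 1" "g holomorphic_on ball 0 1"
    using f g by (auto simp: hardy_def)
  then show "(\<lambda>z. f z - g z) holomorphic_on ball 0 1" by (intro holomorphic_intros)
  show "(\<integral>\<^sup>+\<theta>. ennreal (norm (f (of_real r * cis \<theta>) - g (of_real r * cis \<theta>)) powr p) \<partial>circ)
      \<le> ennreal (2 powr p * (hardy_norm p f powr p + hardy_norm p g powr p))" if "0 < r" "r < 1" for r
    using that by (intro circle_diff_le hol p hardy_circle_le f g) auto
qed simp

text \<open>The Poisson kernel at a is at most 2/(1 - a), so subharmonicity bounds |f (R a)|^p by
  that multiple of the mean at radius R; then R tends to 1. The exponent 1/p matches the
  normalisation of the test functions.\<close>

lemma hardy_growth: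
  assumes f: "f \<in> hardy p" and p: "0 < p" and a: "0 \<le> a" "a < 1"
  shows "norm (f (of_real a)) \<le> (2 / (1 - a)) powr (1 / p) * hardy_norm p f"
proof -
  have hol: "f holomorphic_on ball 0 1" using f by (simp add: hardy_def)
  have *: "norm (f (of_real (R * a))) powr p \<le> 2 / (1 - a) * hardy_norm p f powr p" if R: "0 < R" "R < 1" for R
  proof -
    have "(\<lambda>\<theta>. f (of_real R * cis \<theta>)) \<in> borel_measurable borel"
      using measurable_circle hol R by auto
    then have [measurable]: "(\<lambda>\<theta>. f (of_real R * cis \<theta>)) \<in> borel_measurable circ"
      using measurable_cong_sets[OF sets_circ refl] by blast
    have "ennreal (norm (f (of_real (R * a))) powr p)
        \<le> (\<integral>\<^sup>+\<theta>. ennreal (norm (f (of_real R * cis \<theta>)) powr p * pois a \<theta>) \<partial>circ)"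
      using hol p a R by (intro subharmonic_powr) auto
    also have "\<dots> \<le> (\<integral>\<^sup>+\<theta>. ennreal (2 / (1 - a)) * ennreal (norm (f (of_real R * cis \<theta>)) powr p) \<partial>circ)"
    proof (rule nn_integral_mono)
      fix \<theta>
      have "norm (f (of_real R * cis \<theta>)) powr p * pois a \<theta> \<le> norm (f (of_real R * cis \<theta>)) powr p * (2 / (1 - a))"
        using a by (intro mult_left_mono pois_le) auto
      then have "ennreal (norm (f (of_real R * cis \<theta>)) powr p * pois a \<theta>)
          \<le> ennreal (2 / (1 - a) * norm (f (of_real R * cis \<theta>)) powr p)"
        by (intro ennreal_leI) (simp only: mult.commute)
      also have "\<dots> = ennreal (2 / (1 - a)) * ennreal (norm (f (of_real R * cis \<theta>)) powr p)"
        using a by (intro ennreal_mult') auto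
      finally show "ennreal (norm (f (of_real R * cis \<theta>)) powr p * pois a \<theta>)
        \<le> ennreal (2 / (1 - a)) * ennreal (norm (f (of_real R * cis \<theta>)) powr p)" .
    qed
    also have "\<dots> = ennreal (2 / (1 - a)) * (\<integral>\<^sup>+\<theta>. ennreal (norm (f (of_real R * cis \<theta>)) powr p) \<partial>circ)"
      by (rule nn_integral_cmult) measurable
    also have "\<dots> \<le> ennreal (2 / (1 - a)) * ennreal (hardy_norm p f powr p)"
      using R by (intro mult_left_mono hardy_circle_le[OF f p]) auto
    also have "\<dots> = ennreal (2 / (1 - a) * hardy_norm p f powr p)"
      using a by (intro ennreal_mult'[symmetric]) auto
    finally show ?thesis
      using a by (subst (asm) ennreal_le_iff) auto
  qed
  have "((\<lambda>R. norm (f (of_real (R * a))) powr p) \<longlongrightarrow> norm (f (of_real (1 * a))) powr p) (at_left 1)"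
  proof -
    have "isCont f (of_real (1 * a))"
      using holomorphic_on_imp_continuous_on[OF hol] a by (intro continuous_on_interior[of "ball 0 1"]) auto
    moreover have "((\<lambda>R. of_real (R * a) :: complex) \<longlongrightarrow> of_real (1 * a)) (at_left 1)"
      by (intro tendsto_intros)
    ultimately have "((\<lambda>R. f (of_real (R * a))) \<longlongrightarrow> f (of_real (1 * a))) (at_left 1)"
      by (rule isCont_tendsto_compose)
    then show ?thesis using p by (intro tendsto_powr2 tendsto_norm tendsto_const) auto
  qed
  moreover have "eventually (\<lambda>R. norm (f (of_real (R * a))) powr p \<le> 2 / (1 - a) * hardy_norm p f powr p) (at_left 1)"
    using * unfolding eventually_at_left_field by (intro exI[of _ 0]) auto
  ultimately have "norm (f (of_real (1 * a))) powr p \<le> 2 / (1 - a) * hardy_norm p f powr p"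
    by (rule tendsto_upperbound) simp
  then have "(norm (f (of_real a)) powr p) powr (1 / p) \<le> (2 / (1 - a) * hardy_norm p f powr p) powr (1 / p)"
    using p by (intro powr_mono2) auto
  then show ?thesis
    using p a hardy_norm_nonneg[OF f] unfolding powr_mult powr_powr by simp
qed

text \<open>Only a bound uniform in k is wanted: x \<le> 1 + x^p inside Cauchy's coefficient formula
  leads straight to the p-th mean, and letting r tend to 1 removes r^k. It serves the summability of
  the coefficient series and the local boundedness for Montel's theorem.\<close>

lemma hardy_coeff_bound:
  assumes f: "f holomorphic_on ball 0 1" and p: "1 \<le> p" and M: "0 \<le> M"
    and le: "\<And>r. 0 < r \<Longrightarrow> r < 1 \<Longrightarrow> hardy_mean p f r powr p \<le> M"
  shows "norm (fps_nth (fps_expansion f 0) k) \<le> 1 + M"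
proof -
  define a where "a = fps_nth (fps_expansion f 0) k"
  have *: "norm a * r ^ k \<le> 1 + M" if r: "0 < r" "r < 1" for r
  proof -
    have sub: "cball 0 r \<subseteq> ball (0::complex) 1" "ball 0 r \<subseteq> ball (0::complex) 1" using r by auto
    have "((\<lambda>u. f u / (u - 0) ^ Suc k) has_contour_integral of_real (2 * pi) * \<i> / fact k * (deriv ^^ k) f 0) (circlepath 0 r)"
      using r by (intro Cauchy_has_contour_integral_higher_derivative_circlepath)
        (auto intro: holomorphic_on_subset[OF f] continuous_on_subset[OF holomorphic_on_imp_continuous_on[OF f] sub(1)] sub)
    then have I: "((\<lambda>\<theta>. f (of_real r * cis \<theta>) / (of_real r * cis \<theta>) ^ Suc k * of_real r * \<i> * cis \<theta>)
       has_integral of_real (2 * pi) * \<i> / fact k * (deriv ^^ k) f 0) {0..2 * pi}"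
      unfolding circlepath_def by (subst (asm) has_contour_integral_part_circlepath_iff) auto
    have ak: "of_real (2 * pi) * \<i> / fact k * (deriv ^^ k) f 0 = 2 * of_real pi * \<i> * a"
      by (simp add: a_def fps_expansion_def)
    define g where "g \<theta> = inverse (r ^ k) * (1 + norm (f (of_real r * cis \<theta>)) powr p)" for \<theta>
    have c: "continuous_on {0..2 * pi} (\<lambda>\<theta>. norm (f (of_real r * cis \<theta>)) powr p)"
      using continuous_on_circle_powr[OF f, of r p] r p by (auto intro: continuous_on_subset)
    then have gi: "g integrable_on {0..2 * pi}"
      unfolding g_def
      by (intro integrable_continuous_real continuous_on_mult continuous_on_add continuous_on_const)
    have "norm (2 * of_real pi * \<i> * a) \<le> integral {0..2 * pi} g"
    proof -
      have "norm (integral {0..2 * pi} (\<lambda>\<theta>. f (of_real r * cis \<theta>) / (of_real r * cis \<theta>) ^ Suc k * of_real r * \<i> * cis \<theta>))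
         \<le> integral {0..2 * pi} g"
      proof (rule integral_norm_bound_integral[OF _ gi])
        show "(\<lambda>\<theta>. f (of_real r * cis \<theta>) / (of_real r * cis \<theta>) ^ Suc k * of_real r * \<i> * cis \<theta>) integrable_on {0..2 * pi}"
          using I by blast
        fix \<theta>
        let ?x = "norm (f (of_real r * cis \<theta>))"
        have "?x \<le> 1 + ?x powr p"
        proof (cases "?x \<le> 1")
          case False
          then have "?x powr 1 \<le> ?x powr p" using p by (intro powr_mono) auto
          then show ?thesis using False by simp
        qed (simp add: add_increasing2)
        then have "inverse (r ^ k) * ?x \<le> g \<theta>"
          unfolding g_def using r by (intro mult_left_mono) auto
        moreover have "norm (f (of_real r * cis \<theta>) / (of_real r * cis \<theta>) ^ Suc k * of_real r * \<i> * cis \<theta>) = inverse (r ^ k) * ?x"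
          using r by (simp add: norm_mult norm_divide norm_power field_simps)
        ultimately show "norm (f (of_real r * cis \<theta>) / (of_real r * cis \<theta>) ^ Suc k * of_real r * \<i> * cis \<theta>) \<le> g \<theta>"
          by simp
      qed
      then show ?thesis using integral_unique[OF I] unfolding ak by simp
    qed
    also have "integral {0..2 * pi} g = inverse (r ^ k) * (2 * pi + integral {0..2 * pi} (\<lambda>\<theta>. norm (f (of_real r * cis \<theta>)) powr p))"
      unfolding g_def integral_mult_right using c
      by (subst integral_add) (auto intro!: integrable_continuous_real)
    also have "integral {0..2 * pi} (\<lambda>\<theta>. norm (f (of_real r * cis \<theta>)) powr p) = 2 * pi * hardy_mean p f r powr p"
      using hardy_mean_powr[OF f, of r p] r p by simp
    also have "inverse (r ^ k) * (2 * pi + 2 * pi * hardy_mean p f r powr p) \<le> inverse (r ^ k) * (2 * pi + 2 * pi * M)"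
      using r le by (intro mult_left_mono add_left_mono) auto
    finally have "2 * pi * norm a \<le> inverse (r ^ k) * (2 * pi * (1 + M))"
      by (simp add: norm_mult algebra_simps)
    then have "2 * pi * (norm a * r ^ k) \<le> 2 * pi * (1 + M)"
      using r by (simp add: field_simps)
    then show ?thesis by (rule mult_left_le_imp_le) simp
  qed
  have "((\<lambda>r. norm a * r ^ k) \<longlongrightarrow> norm a * 1 ^ k) (at_left 1)"
    by (intro tendsto_intros)
  moreover have "eventually (\<lambda>r. norm a * r ^ k \<le> 1 + M) (at_left 1)"
    using * unfolding eventually_at_left_field by (intro exI[of _ 0]) auto
  ultimately have "norm a * 1 ^ k \<le> 1 + M"
    by (rule tendsto_upperbound) simp
  then show ?thesis by (simp add: a_def)
qed

lemma expansion_sums: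
  assumes "f holomorphic_on ball 0 1" "norm z < 1"
  shows "(\<lambda>k. fps_nth (fps_expansion f 0) k * z ^ k) sums f z"
  using holomorphic_power_series[OF assms(1), of z] assms(2) by (simp add: fps_expansion_def)

lemma bounded_coeff_growth:
  assumes f: "f holomorphic_on ball 0 1" and B: "\<And>k. norm (fps_nth (fps_expansion f 0) k) \<le> B"
    and z: "norm z < 1"
  shows "norm (f z) \<le> B / (1 - norm z)"
proof -
  have g: "(\<lambda>k. B * norm z ^ k) sums (B * (1 / (1 - norm z)))"
    using z by (intro sums_mult geometric_sums) simp
  have le: "norm (fps_nth (fps_expansion f 0) k * z ^ k) \<le> B * norm z ^ k" for k
    using B by (auto simp: norm_mult norm_power intro!: mult_right_mono)
  have "norm (\<Sum>k. fps_nth (fps_expansion f 0) k * z ^ k) \<le> (\<Sum>k. B * norm z ^ k)"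
    by (rule norm_suminf_le[OF le sums_summable[OF g]])
  then show ?thesis
    using sums_unique[OF g] sums_unique[OF expansion_sums[OF f z]] by simp
qed

section \<open>Integral representation\<close>

text \<open>Two exchanges of sum and integral. The one over k uses \<open>sm\<close> and also shows
  that f is integrable along the radius; the one over n then works since (n + 1) |z|^n is summable.
  The assumption is phrased by coefficients, so that it covers test functions for a measure known
  only to be finite.\<close>

lemma DH_integral_representation:
  fixes \<mu> :: "real measure"
  assumes sets: "sets \<mu> = sets (restrict_space borel {0..<1})" and fin: "finite_measure \<mu>"
    and f: "f holomorphic_on ball 0 1"
    and sm: "summable (\<lambda>k. moment \<mu> k * norm (fps_nth (fps_expansion f 0) k))"
  shows "integrable \<mu> (\<lambda>t. f (of_real t))"
    and "DH \<mu> f holomorphic_on ball 0 1"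
    and "\<And>z. norm z < 1 \<Longrightarrow> integrable \<mu> (\<lambda>t. f (of_real t) / (1 - of_real t * z)\<^sup>2)"
    and "\<And>z. norm z < 1 \<Longrightarrow> DH \<mu> f z = (LINT t|\<mu>. f (of_real t) / (1 - of_real t * z)\<^sup>2)"
proof -
  interpret finite_measure \<mu> by (rule fin)
  define a where "a k = fps_nth (fps_expansion f 0) k" for k
  have sp: "space \<mu> = {0..<1}" by (rule space_restrict_unit[OF sets])
  have [measurable]: "(\<lambda>t. t) \<in> borel_measurable \<mu>"
    by (rule measurable_restrict_unit[OF sets]) (intro continuous_intros)
  have [measurable]: "(\<lambda>t. f (of_real t)) \<in> borel_measurable \<mu>"
    using measurable_restrict_unit[OF sets continuous_on_radius[OF f, of 1]] by simp
  have fs: "(\<lambda>k. a k * of_real t ^ k) sums f (of_real t)" if "t \<in> space \<mu>" for t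
    using expansion_sums[OF f, of "of_real t"] that by (simp add: a_def sp)
  have pow_le: "norm (of_real t ^ n :: complex) \<le> 1" if "t \<in> space \<mu>" for t n
    using that by (auto simp: sp norm_power intro: power_le_one)
  have int_term: "integrable \<mu> (\<lambda>t. of_real t ^ n * a k)" for n k
    using pow_le by (intro integrable_const_bound[where B = "norm (a k)"] AE_I2)
      (auto simp: norm_mult intro!: mult_left_le_one_le)
  have int_pow: "integrable \<mu> (\<lambda>t. t ^ n)" for n
    by (intro integrable_const_bound[where B = 1] AE_I2) (auto simp: sp power_le_one)
  have term_eq: "(LINT t|\<mu>. of_real t ^ n * a k) = of_real (moment \<mu> n) * a k" for n k
  proof -
    have "(LINT t|\<mu>. of_real t ^ n * a k) = (LINT t|\<mu>. of_real (t ^ n)) * a k"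
      by simp
    then show ?thesis unfolding integral_complex_of_real moment_def .
  qed
  have norm_eq: "(LINT t|\<mu>. norm (of_real t ^ n * a k)) = moment \<mu> n * norm (a k)" for n k
  proof -
    have "(LINT t|\<mu>. norm (of_real t ^ n * a k)) = (LINT t|\<mu>. t ^ n * norm (a k))"
      by (intro Bochner_Integration.integral_cong) (auto simp: norm_mult norm_power sp)
    then show ?thesis by (simp add: moment_def)
  qed
  have moment_nonneg: "0 \<le> moment \<mu> n" for n
    unfolding moment_def by (intro integral_nonneg_AE AE_I2) (simp add: sp)
  \<comment> \<open>Moments decrease, so \<open>sm\<close> dominates the inner series for every
    shift n simultaneously.\<close>
  have moment_mono: "moment \<mu> (n + k) \<le> moment \<mu> k" for n k
    unfolding moment_def
    by (intro integral_mono int_pow) (auto simp: sp intro!: power_decreasing)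
  have AEs: "AE t in \<mu>. summable (\<lambda>k. norm (of_real t ^ (n + k) * a k))" for n
  proof (rule AE_I2)
    fix t assume t: "t \<in> space \<mu>"
    have "summable (\<lambda>k. a k * of_real ((1 + t) / 2) ^ k)"
      using expansion_sums[OF f, of "of_real ((1 + t) / 2)"] t
      unfolding a_def by (intro sums_summable) (auto simp: sp simp del: of_real_add of_real_divide)
    then have "summable (\<lambda>k. norm (a k * of_real t ^ k))"
      by (rule powser_insidea) (use t in \<open>simp add: sp del: of_real_add of_real_divide\<close>)
    then have "summable (\<lambda>k. norm (of_real t ^ n :: complex) * norm (a k * of_real t ^ k))"
      by (rule summable_mult)
    then show "summable (\<lambda>k. norm (of_real t ^ (n + k) * a k))"
      by (simp add: norm_mult norm_power power_add mult_ac)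
  qed
  have sn: "summable (\<lambda>k. LINT t|\<mu>. norm (of_real t ^ (n + k) * a k))" for n
    unfolding norm_eq
    by (rule summable_comparison_test[OF _ sm])
       (auto simp: a_def moment_nonneg intro!: exI[of _ 0] mult_right_mono moment_mono)
  have sum_eq: "(\<Sum>k. of_real t ^ (n + k) * a k) = of_real t ^ n * f (of_real t)" if "t \<in> space \<mu>" for t n
  proof -
    have "(\<lambda>k. of_real t ^ n * (a k * of_real t ^ k)) sums (of_real t ^ n * f (of_real t))"
      by (intro sums_mult fs that)
    then show ?thesis by (simp add: power_add mult_ac sums_iff)
  qed
  have "integrable \<mu> (\<lambda>t. \<Sum>k. of_real t ^ (0 + k) * a k)"
    by (rule integrable_suminf[OF int_term AEs sn])
  moreover have "integrable \<mu> (\<lambda>t. \<Sum>k. of_real t ^ (0 + k) * a k) = integrable \<mu> (\<lambda>t. f (of_real t))"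
    by (rule Bochner_Integration.integrable_cong[OF refl]) (use sum_eq[of _ 0] in simp)
  ultimately show intf: "integrable \<mu> (\<lambda>t. f (of_real t))"
    by simp
  define c where "c n = (LINT t|\<mu>. of_real t ^ n * f (of_real t))" for n
  have c_eq: "(\<Sum>k. of_real (moment \<mu> (n + k)) * a k) = c n" for n
  proof -
    have "c n = (LINT t|\<mu>. (\<Sum>k. of_real t ^ (n + k) * a k))"
      unfolding c_def by (intro Bochner_Integration.integral_cong) (auto simp: sum_eq)
    also have "\<dots> = (\<Sum>k. (LINT t|\<mu>. of_real t ^ (n + k) * a k))"
      by (rule integral_suminf[OF int_term AEs sn])
    finally show ?thesis by (simp only: term_eq)
  qed
  define D where "D = (LINT t|\<mu>. norm (f (of_real t)))"
  have D: "0 \<le> D" unfolding D_def by (intro integral_nonneg_AE AE_I2) simp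
  have DH: "DH \<mu> f z = (\<Sum>n. of_nat (n + 1) * c n * z ^ n)" for z
    unfolding DH_def a_def[symmetric] c_eq ..
  define g where "g z n t = of_nat (Suc n) * (of_real t * z) ^ n * f (of_real t)" for z :: complex and n and t :: real
  have g_le: "norm (g z n t) \<le> real (Suc n) * norm z ^ n * norm (f (of_real t))" if "t \<in> space \<mu>" for z n t
  proof -
    have "t ^ n * norm z ^ n \<le> 1 * norm z ^ n"
      using that by (intro mult_right_mono) (auto simp: sp power_le_one)
    then have "real (Suc n) * (t ^ n * norm z ^ n) * norm (f (of_real t)) \<le> real (Suc n) * norm z ^ n * norm (f (of_real t))"
      by (intro mult_right_mono mult_left_mono) auto
    moreover have "norm (of_nat (Suc n) :: complex) = real (Suc n)" by (rule norm_of_nat)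
    ultimately show ?thesis using that unfolding g_def norm_mult norm_power power_mult_distrib
      by (simp add: sp del: of_nat_Suc)
  qed
  have gi: "integrable \<mu> (g z n)" for z n
  proof (rule Bochner_Integration.integrable_bound)
    show "integrable \<mu> (\<lambda>t. real (Suc n) * norm z ^ n * norm (f (of_real t)))"
      using intf by (intro integrable_mult_right integrable_norm)
    show "g z n \<in> borel_measurable \<mu>" unfolding g_def by measurable
  qed (use g_le in \<open>auto intro!: AE_I2\<close>)
  have g_int: "(LINT t|\<mu>. g z n t) = of_nat (n + 1) * c n * z ^ n" for z n
  proof -
    have "(LINT t|\<mu>. g z n t) = (LINT t|\<mu>. (of_nat (n + 1) * z ^ n) * (of_real t ^ n * f (of_real t)))"
      by (simp add: g_def power_mult_distrib mult_ac)
    also have "\<dots> = (of_nat (n + 1) * z ^ n) * c n"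
      unfolding c_def by (rule integral_mult_right_zero)
    finally show ?thesis by (simp add: mult_ac)
  qed
  have gn: "(LINT t|\<mu>. norm (g z n t)) \<le> real (Suc n) * norm z ^ n * D" for z n
  proof -
    have "(LINT t|\<mu>. norm (g z n t)) \<le> (LINT t|\<mu>. real (Suc n) * norm z ^ n * norm (f (of_real t)))"
      using g_le gi intf by (intro integral_mono integrable_norm integrable_mult_right) auto
    then show ?thesis by (simp add: D_def)
  qed
  have geo: "summable (\<lambda>n. real (Suc n) * norm z ^ n)" if "norm z < 1" for z :: complex
    using geometric_deriv_sums[of "norm z"] that by (intro sums_summable) auto
  have gsum: "summable (\<lambda>n. LINT t|\<mu>. norm (g z n t))" if "norm z < 1" for z
    by (rule summable_comparison_test[OF _ summable_mult2[OF geo[OF that], of D]])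
       (use gn in \<open>auto intro!: exI[of _ 0] simp: abs_of_nonneg\<close>)
  have gAE: "AE t in \<mu>. summable (\<lambda>n. norm (g z n t))" if "norm z < 1" for z
  proof (rule AE_I2)
    fix t assume t: "t \<in> space \<mu>"
    show "summable (\<lambda>n. norm (g z n t))"
      by (rule summable_comparison_test[OF _ summable_mult2[OF geo[OF that], of "norm (f (of_real t))"]])
         (use g_le[OF t] in \<open>auto intro!: exI[of _ 0]\<close>)
  qed
  have gs: "(\<Sum>n. g z n t) = f (of_real t) / (1 - of_real t * z)\<^sup>2" if "t \<in> space \<mu>" "norm z < 1" for z t
  proof -
    have "norm (of_real t * z) < 1"
      using that mult_right_mono[of t 1 "norm z"] by (auto simp: sp norm_mult)
    from sums_mult2[OF geometric_deriv_sums[OF this], of "f (of_real t)"]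
    show ?thesis by (simp add: g_def sums_iff)
  qed
  show "integrable \<mu> (\<lambda>t. f (of_real t) / (1 - of_real t * z)\<^sup>2)" if "norm z < 1" for z
  proof -
    have "integrable \<mu> (\<lambda>t. f (of_real t) / (1 - of_real t * z)\<^sup>2) = integrable \<mu> (\<lambda>t. \<Sum>n. g z n t)"
      by (rule Bochner_Integration.integrable_cong[OF refl]) (simp add: gs that)
    then show ?thesis
      using integrable_suminf[OF gi gAE[OF that] gsum[OF that]] by simp
  qed
  show "DH \<mu> f z = (LINT t|\<mu>. f (of_real t) / (1 - of_real t * z)\<^sup>2)" if "norm z < 1" for z
  proof -
    have "(LINT t|\<mu>. f (of_real t) / (1 - of_real t * z)\<^sup>2) = (LINT t|\<mu>. (\<Sum>n. g z n t))"
      by (intro Bochner_Integration.integral_cong) (auto simp: gs that)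
    also have "\<dots> = (\<Sum>n. (LINT t|\<mu>. g z n t))"
      by (rule integral_suminf[OF gi gAE[OF that] gsum[OF that]])
    finally show ?thesis by (simp only: g_int DH)
  qed
  show "DH \<mu> f holomorphic_on ball 0 1"
  proof (rule power_series_holomorphic)
    fix z :: complex assume "z \<in> ball 0 1"
    then have z: "norm z < 1" by simp
    have "summable (\<lambda>n. of_nat (n + 1) * c n * z ^ n)"
    proof (rule summable_comparison_test[OF _ gsum[OF z]], intro exI[of _ 0] allI impI)
      show "norm (of_nat (n + 1) * c n * z ^ n) \<le> (LINT t|\<mu>. norm (g z n t))" for n
        unfolding g_int[symmetric] by (rule integral_norm_bound)
    qed
    then show "(\<lambda>n. of_nat (n + 1) * c n * (z - 0) ^ n) sums DH \<mu> f z"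
      unfolding DH by (simp add: summable_sums)
  qed
qed

section \<open>The operator for measures with quadratic tails\<close>

context tail_measure
begin

lemma nn_integral_inverse: "(\<integral>\<^sup>+t. ennreal (inverse (1 - t)) \<partial>\<mu>) < \<infinity>"
  using kernel_bound[of 0] by (simp add: order_le_less_trans)

lemma integrable_inverse: "integrable \<mu> (\<lambda>t. inverse (1 - t))"
proof (rule integrableI_bounded)
  have [measurable]: "(\<lambda>t. t) \<in> borel_measurable \<mu>" by (rule measurable_mu_id)
  show "(\<lambda>t. inverse (1 - t)) \<in> borel_measurable \<mu>" by measurable
  have "(\<integral>\<^sup>+t. ennreal (norm (inverse (1 - t))) \<partial>\<mu>) = (\<integral>\<^sup>+t. ennreal (inverse (1 - t)) \<partial>\<mu>)"
    by (intro nn_integral_cong) (simp add: space_mu)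
  then show "(\<integral>\<^sup>+t. ennreal (norm (inverse (1 - t))) \<partial>\<mu>) < \<infinity>"
    using nn_integral_inverse by simp
qed

text \<open>Summing the geometric series, the partial sums stay below the integral of 1 / (1 - t),
  which is finite by \<open>kernel_bound\<close> at z = 0. Together with bounded Taylor coefficients
  this gives absolute convergence in \<open>DH\<close>.\<close>

lemma summable_moments: "summable (moment \<mu>)"
proof (rule summableI_nonneg_bounded)
  interpret finite_measure \<mu> by (rule finite_mu)
  have [measurable]: "(\<lambda>t. t) \<in> borel_measurable \<mu>" by (rule measurable_mu_id)
  have int_pow: "integrable \<mu> (\<lambda>t. t ^ n)" for n
    by (intro integrable_const_bound[where B = 1] AE_I2) (auto simp: space_mu power_le_one)
  show "0 \<le> moment \<mu> n" for n
    unfolding moment_def by (intro integral_nonneg_AE AE_I2) (simp add: space_mu)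
  show "(\<Sum>k<n. moment \<mu> k) \<le> (LINT t|\<mu>. inverse (1 - t))" for n
  proof -
    have "(\<Sum>k<n. moment \<mu> k) = (LINT t|\<mu>. (\<Sum>k<n. t ^ k))"
      unfolding moment_def by (rule Bochner_Integration.integral_sum[symmetric]) (rule int_pow)
    also have "\<dots> \<le> (LINT t|\<mu>. inverse (1 - t))"
    proof (rule integral_mono[OF _ integrable_inverse])
      fix t assume "t \<in> space \<mu>"
      then have t: "0 \<le> t" "t < 1" by (auto simp: space_mu)
      have "(\<Sum>k<n. t ^ k) \<le> (\<Sum>k. t ^ k)"
        using t by (intro sum_le_suminf summable_geometric) auto
      also have "\<dots> = inverse (1 - t)"
        using t by (subst suminf_geometric) (auto simp: inverse_eq_divide)
      finally show "(\<Sum>k<n. t ^ k) \<le> inverse (1 - t)" .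
    qed (intro Bochner_Integration.integrable_sum int_pow)
    finally show ?thesis .
  qed
qed

lemma moment_coeff_summable:
  assumes "f \<in> hardy p" "1 \<le> p"
  shows "summable (\<lambda>k. moment \<mu> k * norm (fps_nth (fps_expansion f 0) k))"
proof (rule summable_comparison_test[OF _ summable_mult2[OF summable_moments]], intro exI[of _ 0] allI impI)
  fix k
  have "norm (fps_nth (fps_expansion f 0) k) \<le> 1 + hardy_norm p f powr p"
    using assms hardy_mean_le_norm[OF assms(1)] hardy_mean_nonneg
    by (intro hardy_coeff_bound[of f p]) (auto simp: hardy_def intro!: powr_mono2)
  moreover have "0 \<le> moment \<mu> k"
    unfolding moment_def by (intro integral_nonneg_AE AE_I2) (simp add: space_mu)
  ultimately show "norm (moment \<mu> k * norm (fps_nth (fps_expansion f 0) k)) \<le> moment \<mu> k * (1 + hardy_norm p f powr p)"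
    by (simp add: mult_left_mono)
qed

lemma DH_representation:
  assumes "f \<in> hardy p" "1 \<le> p"
  shows "integrable \<mu> (\<lambda>t. f (of_real t))"
    and "DH \<mu> f holomorphic_on ball 0 1"
    and "\<And>z. norm z < 1 \<Longrightarrow> integrable \<mu> (\<lambda>t. f (of_real t) / (1 - of_real t * z)\<^sup>2)"
    and "\<And>z. norm z < 1 \<Longrightarrow> DH \<mu> f z = (LINT t|\<mu>. f (of_real t) / (1 - of_real t * z)\<^sup>2)"
  using DH_integral_representation[OF sets_mu finite_mu _ moment_coeff_summable[OF assms]] assms(1)
  by (auto simp: hardy_def)

lemma norm_DH_le:
  assumes "f \<in> hardy p" "1 \<le> p" "norm z < 1"
  shows "ennreal (norm (DH \<mu> f z)) \<le> (\<integral>\<^sup>+t. ennreal (norm (f (of_real t)) * inverse ((norm (1 - of_real t * z))\<^sup>2)) \<partial>\<mu>)"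
proof -
  have "ennreal (norm (DH \<mu> f z)) \<le> (\<integral>\<^sup>+t. ennreal (norm (f (of_real t) / (1 - of_real t * z)\<^sup>2)) \<partial>\<mu>)"
    unfolding DH_representation(4)[OF assms]
    by (rule integral_norm_bound_ennreal[OF DH_representation(3)[OF assms]])
  then show ?thesis by (simp add: norm_mult norm_inverse norm_power divide_inverse)
qed

lemma DH_in_hardy:
  assumes f: "f \<in> hardy p" and p: "1 \<le> p" "p \<le> 2"
  shows "DH \<mu> f \<in> hardy p"
proof (rule hardyI(1))
  show "DH \<mu> f holomorphic_on ball 0 1" by (rule DH_representation(2)[OF f p(1)])
  show "(\<integral>\<^sup>+\<theta>. ennreal (norm (DH \<mu> f (of_real r * cis \<theta>)) powr p) \<partial>circ) \<le> ennreal (24300 * N powr p * hardy_norm p f powr p)"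
    if r: "0 < r" "r < 1" for r
    using f p r
    by (intro operator_bound[OF _ p r _ hardy_circle_le[OF f]] norm_DH_le[OF f p(1)]) (auto simp: hardy_def norm_mult)
qed (use p in auto)

lemma DH_linear:
  assumes p: "1 \<le> p" "p \<le> 2"
  shows "hardy_linear p (DH \<mu>)"
  unfolding hardy_linear_def
proof (intro conjI ballI allI)
  fix f g z assume f: "f \<in> hardy p" and g: "g \<in> hardy p" and "z \<in> ball (0::complex) 1"
  then have z: "norm z < 1" by simp
  \<comment> \<open>Sums are obtained from the closure under differences.\<close>
  have "(\<lambda>w. (-1) * g w) \<in> hardy p"
    using g by (auto simp: hardy_def hardy_mean_def norm_mult intro!: holomorphic_intros)
  from hardy_diff[OF f this] have fg: "(\<lambda>w. f w + g w) \<in> hardy p" using p by simp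
  have "DH \<mu> (\<lambda>w. f w + g w) z = (LINT t|\<mu>. f (of_real t) / (1 - of_real t * z)\<^sup>2 + g (of_real t) / (1 - of_real t * z)\<^sup>2)"
    unfolding DH_representation(4)[OF fg p(1) z] by (simp add: add_divide_distrib)
  also have "\<dots> = DH \<mu> f z + DH \<mu> g z"
    unfolding DH_representation(4)[OF f p(1) z] DH_representation(4)[OF g p(1) z]
    by (intro Bochner_Integration.integral_add DH_representation(3)[OF _ p(1) z] f g)
  finally show "DH \<mu> (\<lambda>w. f w + g w) z = DH \<mu> f z + DH \<mu> g z" .
next
  fix c f z assume f: "f \<in> hardy p" and "z \<in> ball (0::complex) 1"
  then have z: "norm z < 1" by simp
  have hol: "f holomorphic_on ball 0 1" using f by (simp add: hardy_def)
  have cf: "(\<lambda>w. c * f w) \<in> hardy p"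
  proof (rule hardyI(1)[where M = "norm c powr p * hardy_norm p f powr p"])
    show "(\<lambda>w. c * f w) holomorphic_on ball 0 1" using hol by (intro holomorphic_intros)
    show "(\<integral>\<^sup>+\<theta>. ennreal (norm (c * f (of_real r * cis \<theta>)) powr p) \<partial>circ) \<le> ennreal (norm c powr p * hardy_norm p f powr p)"
      if r: "0 < r" "r < 1" for r
    proof -
      have m: "(\<lambda>\<theta>. ennreal (norm (f (of_real r * cis \<theta>)) powr p)) \<in> borel_measurable circ"
        using borel_measurable_continuous_onI[OF continuous_on_circle_powr[OF hol, of r p]] r p
          measurable_cong_sets[OF sets_circ refl] by auto
      have "(\<integral>\<^sup>+\<theta>. ennreal (norm (c * f (of_real r * cis \<theta>)) powr p) \<partial>circ)
          = ennreal (norm c powr p) * (\<integral>\<^sup>+\<theta>. ennreal (norm (f (of_real r * cis \<theta>)) powr p) \<partial>circ)"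
        by (subst nn_integral_cmult[OF m, symmetric]) (simp add: norm_mult powr_mult ennreal_mult')
      also have "\<dots> \<le> ennreal (norm c powr p) * ennreal (hardy_norm p f powr p)"
        using p r by (intro mult_left_mono hardy_circle_le[OF f]) auto
      finally show ?thesis by (simp add: ennreal_mult')
    qed
  qed (use p in auto)
  show "DH \<mu> (\<lambda>w. c * f w) z = c * DH \<mu> f z"
    unfolding DH_representation(4)[OF cf p(1) z] DH_representation(4)[OF f p(1) z]
    by (simp flip: times_divide_eq_right)
qed

end

section \<open>Sufficiency\<close>

lemma sets_Ico:
  fixes \<mu> :: "real measure"
  assumes "sets \<mu> = sets (restrict_space borel {0..<1})" "0 \<le> t"
  shows "{t..<1} \<in> sets \<mu>"
proof -
  have "{0..<1} \<inter> {t..<1} \<in> sets \<mu>"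
    unfolding assms(1) sets_restrict_space by (rule imageI) simp
  also have "{0..<1} \<inter> {t..<1} = {t..<1}" using assms(2) by auto
  finally show ?thesis .
qed

lemma tail_measureI:
  assumes "borel_measure_on_unit \<mu>" "0 < C"
    and "\<And>t. t \<in> {0..<1} \<Longrightarrow> emeasure \<mu> {t..<1} \<le> ennreal (C * (1 - t) powr 2)"
  shows "tail_measure \<mu> C"
proof
  show "sets \<mu> = sets (restrict_space borel {0..<1})" using assms(1) by (simp add: borel_measure_on_unit_def)
  show "emeasure \<mu> {t..<1} \<le> ennreal (C * (1 - t)\<^sup>2)" if "t \<in> {0..<1}" for t
    using assms(3)[OF that] that by simp
qed (rule assms(2))

text \<open>Restricting by a density keeps the sigma-algebra on [0,1), so the result is again an
  instance of \<open>tail_measure\<close>. For t below \<rho> the tail equals the one at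
  \<rho>.\<close>

lemma tail_measure_restrict:
  assumes "tail_measure \<mu> C" and \<rho>: "0 \<le> \<rho>" "\<rho> < 1" and \<epsilon>: "0 < \<epsilon>"
    and le: "\<And>t. \<rho> \<le> t \<Longrightarrow> t < 1 \<Longrightarrow> emeasure \<mu> {t..<1} \<le> ennreal (\<epsilon> * (1 - t)\<^sup>2)"
  shows "tail_measure (density \<mu> (indicator {\<rho>..<1})) \<epsilon>"
proof -
  interpret tail_measure \<mu> C by fact
  have [measurable]: "{t..<1} \<in> sets \<mu>" if "0 \<le> t" for t using sets_Ico[OF sets_mu that] .
  show ?thesis
  proof
    show "sets (density \<mu> (indicator {\<rho>..<1})) = sets (restrict_space borel {0..<1})"
      by (simp add: sets_mu)
    fix t :: real assume t: "t \<in> {0..<1}"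
    have "emeasure (density \<mu> (indicator {\<rho>..<1})) {t..<1} = (\<integral>\<^sup>+x. indicator {\<rho>..<1} x * indicator {t..<1} x \<partial>\<mu>)"
      using t \<rho> by (subst emeasure_density) auto
    also have "\<dots> = (\<integral>\<^sup>+x. indicator {max \<rho> t..<1} x \<partial>\<mu>)"
      by (intro nn_integral_cong) (auto simp: indicator_def)
    also have "\<dots> = emeasure \<mu> {max \<rho> t..<1}"
      using \<rho> by (intro nn_integral_indicator) auto
    also have "\<dots> \<le> ennreal (\<epsilon> * (1 - max \<rho> t)\<^sup>2)"
      using le \<rho> t by auto
    also have "\<dots> \<le> ennreal (\<epsilon> * (1 - t)\<^sup>2)"
      using \<rho> t \<epsilon> by (intro ennreal_leI mult_left_mono power_mono) auto
    finally show "emeasure (density \<mu> (indicator {\<rho>..<1})) {t..<1} \<le> ennreal (\<epsilon> * (1 - t)\<^sup>2)" .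
  qed (rule \<epsilon>)
qed

lemma vanishing_tail:
  assumes T: "tail_measure \<mu> C" and van: "vanishing_carleson 2 \<mu>" and \<epsilon>: "0 < \<epsilon>"
  obtains \<rho> where "0 \<le> \<rho>" "\<rho> < 1" "tail_measure (density \<mu> (indicator {\<rho>..<1})) \<epsilon>"
proof -
  interpret tail_measure \<mu> C by fact
  interpret finite_measure \<mu> by (rule finite_mu)
  have "((\<lambda>t. measure \<mu> {t..<1} / (1 - t) powr 2) \<longlongrightarrow> 0) (at_left 1)"
    using van by (simp add: vanishing_carleson_def)
  then have "eventually (\<lambda>t. measure \<mu> {t..<1} / (1 - t) powr 2 < \<epsilon>) (at_left 1)"
    using \<epsilon> by (auto dest: order_tendstoD)
  then obtain b where b: "b < 1" "\<And>t. b < t \<Longrightarrow> t < 1 \<Longrightarrow> measure \<mu> {t..<1} / (1 - t) powr 2 < \<epsilon>"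
    unfolding eventually_at_left_field by auto
  \<comment> \<open>The limit controls only t strictly above b; a point strictly between b and 1
    makes the bound valid at \<rho> itself.\<close>
  define \<rho> where "\<rho> = max 0 ((b + 1) / 2)"
  have \<rho>: "0 \<le> \<rho>" "\<rho> < 1" "b < \<rho>" using b(1) by (auto simp: \<rho>_def max_def)
  moreover have "tail_measure (density \<mu> (indicator {\<rho>..<1})) \<epsilon>"
  proof (rule tail_measure_restrict[OF T \<rho>(1,2) \<epsilon>])
    fix t assume t: "\<rho> \<le> t" "t < 1"
    then have "measure \<mu> {t..<1} \<le> \<epsilon> * (1 - t)\<^sup>2"
      using b(2)[of t] \<rho> by (simp add: field_simps)
    then show "emeasure \<mu> {t..<1} \<le> ennreal (\<epsilon> * (1 - t)\<^sup>2)"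
      unfolding emeasure_eq_measure by (rule ennreal_leI)
  qed
  ultimately show ?thesis using that by blast
qed

text \<open>For t < \<rho> the kernel is at most (1 - \<rho>)^(-2) and the mass at most C, so the
  assumed smallness of h is scaled to contribute exactly \<delta>; the rest of the integral sees
  only the measure with constant \<epsilon>.\<close>

lemma DH_circle_bound_split:
  assumes T: "tail_measure \<mu> C" and T': "tail_measure (density \<mu> (indicator {\<rho>..<1})) \<epsilon>"
    and \<rho>: "0 \<le> \<rho>" "\<rho> < 1"
    and p: "1 \<le> p" "p \<le> 2" and h: "h \<in> hardy p" and M0: "0 \<le> M"
    and M: "\<And>r. 0 < r \<Longrightarrow> r < 1 \<Longrightarrow> (\<integral>\<^sup>+\<theta>. ennreal (norm (h (of_real r * cis \<theta>)) powr p) \<partial>circ) \<le> ennreal M"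
    and \<delta>: "0 < \<delta>" and small: "\<And>t. 0 \<le> t \<Longrightarrow> t \<le> \<rho> \<Longrightarrow> norm (h (of_real t)) \<le> \<delta> * (1 - \<rho>)\<^sup>2 / C"
    and r: "0 < r" "r < 1"
  shows "(\<integral>\<^sup>+\<theta>. ennreal (norm (DH \<mu> h (of_real r * cis \<theta>)) powr p) \<partial>circ)
     \<le> ennreal (2 powr p * (24300 * \<epsilon> powr p * M + \<delta> powr p))"
proof -
  interpret tail_measure \<mu> C by fact
  interpret T': tail_measure "density \<mu> (indicator {\<rho>..<1})" \<epsilon> by fact
  have hol: "h holomorphic_on ball 0 1" using h by (simp add: hardy_def)
  have C: "0 < C" by (rule N_pos)
  have [measurable]: "(\<lambda>t. t) \<in> borel_measurable \<mu>" by (rule measurable_mu_id)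
  have [measurable]: "(\<lambda>t. h (of_real t)) \<in> borel_measurable \<mu>"
    using measurable_restrict_unit[OF sets_mu continuous_on_radius[OF hol, of 1]] by simp
  have [measurable]: "{\<rho>..<1} \<in> sets \<mu>" using sets_Ico[OF sets_mu \<rho>(1)] .
  define D where "D \<theta> = norm (DH \<mu> h (of_real r * cis \<theta>))" for \<theta>
  \<comment> \<open>Removing \<delta> from the modulus leaves a quantity dominated by the integral
    over [\<rho>,1) alone, the form that \<open>operator_bound\<close> accepts.\<close>
  define X where "X \<theta> = max 0 (D \<theta> - \<delta>)" for \<theta>
  have Xle: "ennreal (X \<theta>) \<le> (\<integral>\<^sup>+t. ennreal (norm (h (of_real t)) * inverse ((norm (1 - of_real t * (of_real r * cis \<theta>)))\<^sup>2)) \<partial>density \<mu> (indicator {\<rho>..<1}))" for \<theta>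
  proof -
    define z where "z = of_real r * cis \<theta>"
    have z: "norm z < 1" using r by (simp add: z_def norm_mult)
    define k where "k t = ennreal (norm (h (of_real t)) * inverse ((norm (1 - of_real t * z))\<^sup>2))" for t
    have [measurable]: "k \<in> borel_measurable \<mu>" unfolding k_def by measurable
    have "ennreal (D \<theta>) \<le> (\<integral>\<^sup>+t. k t \<partial>\<mu>)"
      unfolding D_def k_def z_def[symmetric] by (rule norm_DH_le[OF h p(1) z])
    also have "\<dots> \<le> (\<integral>\<^sup>+t. ennreal (\<delta> / C) + indicator {\<rho>..<1} t * k t \<partial>\<mu>)"
    proof (rule nn_integral_mono)
      fix t assume "t \<in> space \<mu>"
      then have t: "t \<in> {0..<1}" by (simp add: space_mu)
      show "k t \<le> ennreal (\<delta> / C) + indicator {\<rho>..<1} t * k t"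
      proof (cases "\<rho> \<le> t")
        case True
        then show ?thesis using t by simp
      next
        case False
        have "1 - \<rho> \<le> norm (1 - of_real t * z)"
          using norm_one_minus_ge(1)[OF z t] False by simp
        then have "(1 - \<rho>)\<^sup>2 \<le> (norm (1 - of_real t * z))\<^sup>2"
          using \<rho> by (intro power_mono) auto
        then have "inverse ((norm (1 - of_real t * z))\<^sup>2) \<le> inverse ((1 - \<rho>)\<^sup>2)"
          using \<rho> by (intro le_imp_inverse_le) auto
        then have "norm (h (of_real t)) * inverse ((norm (1 - of_real t * z))\<^sup>2) \<le> \<delta> * (1 - \<rho>)\<^sup>2 / C * inverse ((1 - \<rho>)\<^sup>2)"
          using small[of t] t False \<delta> C by (intro mult_mono) auto
        also have "\<dots> = \<delta> / C" using \<rho> by simp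
        finally show ?thesis using False by (simp add: k_def ennreal_leI)
      qed
    qed
    also have "\<dots> = (\<integral>\<^sup>+t. ennreal (\<delta> / C) \<partial>\<mu>) + (\<integral>\<^sup>+t. indicator {\<rho>..<1} t * k t \<partial>\<mu>)"
      by (rule nn_integral_add) measurable
    also have "(\<integral>\<^sup>+t. ennreal (\<delta> / C) \<partial>\<mu>) \<le> ennreal \<delta>"
    proof -
      have "(\<integral>\<^sup>+t. ennreal (\<delta> / C) \<partial>\<mu>) = ennreal (\<delta> / C) * emeasure \<mu> {0..<1}"
        by (simp add: space_mu)
      also have "\<dots> \<le> ennreal (\<delta> / C) * ennreal (C * (1 - 0)\<^sup>2)"
        by (intro mult_left_mono tail) auto
      also have "\<dots> = ennreal (\<delta> / C * (C * (1 - 0)\<^sup>2))"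
        using \<delta> C by (intro ennreal_mult'[symmetric]) auto
      also have "\<delta> / C * (C * (1 - 0)\<^sup>2) = \<delta>" using C by simp
      finally show ?thesis .
    qed
    also have "(\<integral>\<^sup>+t. indicator {\<rho>..<1} t * k t \<partial>\<mu>) = (\<integral>\<^sup>+t. k t \<partial>density \<mu> (indicator {\<rho>..<1}))"
      by (rule nn_integral_density[symmetric]) measurable
    finally have le: "ennreal (D \<theta>) \<le> ennreal \<delta> + (\<integral>\<^sup>+t. k t \<partial>density \<mu> (indicator {\<rho>..<1}))"
      by (simp add: add_right_mono)
    then have "ennreal (D \<theta>) - ennreal \<delta> \<le> (\<integral>\<^sup>+t. k t \<partial>density \<mu> (indicator {\<rho>..<1}))"
      by (subst ennreal_minus_le_iff) auto
    moreover have "ennreal (X \<theta>) = ennreal (D \<theta>) - ennreal \<delta>"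
      using \<delta> by (auto simp: X_def max_def ennreal_minus ennreal_neg)
    ultimately have "ennreal (X \<theta>) \<le> (\<integral>\<^sup>+t. k t \<partial>density \<mu> (indicator {\<rho>..<1}))"
      by (simp only:)
    then show ?thesis unfolding k_def z_def .
  qed
  have cD: "continuous_on UNIV D"
    unfolding D_def
    by (rule continuous_on_norm,
        rule continuous_on_compose2[OF holomorphic_on_imp_continuous_on[OF DH_representation(2)[OF h p(1)]]])
       (use r in \<open>auto intro!: continuous_intros simp: norm_mult\<close>)
  then have "D \<in> borel_measurable borel" by (rule borel_measurable_continuous_onI)
  then have "D \<in> borel_measurable circ" using measurable_cong_sets[OF sets_circ refl] by blast
  then have Xm: "(\<lambda>\<theta>. ennreal (X \<theta> powr p)) \<in> borel_measurable circ" unfolding X_def by measurable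
  have "(\<integral>\<^sup>+\<theta>. ennreal (D \<theta> powr p) \<partial>circ) \<le> (\<integral>\<^sup>+\<theta>. ennreal (2 powr p) * (ennreal (X \<theta> powr p) + ennreal (\<delta> powr p)) \<partial>circ)"
  proof (rule nn_integral_mono)
    fix \<theta>
    have "D \<theta> powr p \<le> (X \<theta> + \<delta>) powr p"
      using p by (intro powr_mono2) (auto simp: X_def D_def)
    also have "\<dots> \<le> 2 powr p * (X \<theta> powr p + \<delta> powr p)"
      using p \<delta> by (intro powr_add_le) (auto simp: X_def)
    finally have "ennreal (D \<theta> powr p) \<le> ennreal (2 powr p * (X \<theta> powr p + \<delta> powr p))" by (rule ennreal_leI)
    then show "ennreal (D \<theta> powr p) \<le> ennreal (2 powr p) * (ennreal (X \<theta> powr p) + ennreal (\<delta> powr p))"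
      by (simp add: ennreal_mult' ennreal_plus)
  qed
  also have "\<dots> = ennreal (2 powr p) * ((\<integral>\<^sup>+\<theta>. ennreal (X \<theta> powr p) \<partial>circ) + (\<integral>\<^sup>+\<theta>. ennreal (\<delta> powr p) \<partial>circ))"
    using Xm by (subst nn_integral_cmult, measurable, subst nn_integral_add, measurable)
  also have "\<dots> \<le> ennreal (2 powr p) * (ennreal (24300 * \<epsilon> powr p * M) + ennreal (\<delta> powr p))"
    using T'.operator_bound[OF hol p r M0 M, of X] Xle
    by (intro mult_left_mono add_mono) (auto simp: X_def emeasure_circ_UNIV)
  also have "\<dots> = ennreal (2 powr p * (24300 * \<epsilon> powr p * M + \<delta> powr p))"
    using M0 by (simp add: ennreal_mult' ennreal_plus)
  finally show ?thesis by (simp add: D_def)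
qed

text \<open>The common coefficient bound makes the family locally bounded. Fatou's lemma on each
  circle keeps the limit within the norm bound B.\<close>

lemma hardy_montel:
  assumes F: "\<And>j. F j \<in> hardy p" and p: "1 \<le> p" and B: "\<And>j. hardy_norm p (F j) \<le> B"
  obtains g \<sigma> where "g \<in> hardy p" "strict_mono (\<sigma> :: nat \<Rightarrow> nat)" "hardy_norm p g \<le> B"
    "\<And>K. compact K \<Longrightarrow> K \<subseteq> ball 0 1 \<Longrightarrow> uniform_limit K (\<lambda>j. F (\<sigma> j)) g sequentially"
proof -
  have B0: "0 \<le> B" using hardy_norm_nonneg[OF F] B order_trans by blast
  have hol: "F j holomorphic_on ball 0 1" for j using F by (simp add: hardy_def)
  have co: "norm (fps_nth (fps_expansion (F j) 0) k) \<le> 1 + B powr p" for j k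
    using p B hardy_mean_le_norm[OF F] hardy_mean_nonneg order_trans
    by (intro hardy_coeff_bound[OF hol p]) (auto intro!: powr_mono2 intro: order_trans)
  obtain g \<sigma> where g: "g holomorphic_on ball 0 1" "strict_mono (\<sigma> :: nat \<Rightarrow> nat)"
    "\<And>x. x \<in> ball 0 1 \<Longrightarrow> (\<lambda>n. F (\<sigma> n) x) \<longlonglongrightarrow> g x"
    "\<And>K. compact K \<Longrightarrow> K \<subseteq> ball 0 1 \<Longrightarrow> uniform_limit K (F \<circ> \<sigma>) g sequentially"
  proof (rule Montel[of "ball 0 1" "range F" F])
    fix K :: "complex set" assume K: "compact K" "K \<subseteq> ball 0 1"
    have "continuous_on K (\<lambda>z. (1 + B powr p) / (1 - norm z))"
      using K(2) by (intro continuous_intros) auto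
    then have "bounded ((\<lambda>z. (1 + B powr p) / (1 - norm z)) ` K)"
      using K(1) by (intro compact_imp_bounded compact_continuous_image)
    then obtain b where b: "\<And>z. z \<in> K \<Longrightarrow> norm ((1 + B powr p) / (1 - norm z)) \<le> b"
      unfolding bounded_iff by auto
    have "norm (F j z) \<le> b" if "z \<in> K" for j z
    proof -
      have "norm z < 1" using that K by auto
      from bounded_coeff_growth[OF hol co this, of j] have "norm (F j z) \<le> (1 + B powr p) / (1 - norm z)" .
      also have "\<dots> \<le> norm ((1 + B powr p) / (1 - norm z))" by (simp only: real_norm_def abs_ge_self)
      finally show ?thesis using b[OF that] by simp
    qed
    then show "\<exists>b. \<forall>h\<in>range F. \<forall>z\<in>K. norm (h z) \<le> b" by blast
  qed (use hol in auto)
  have gB: "(\<integral>\<^sup>+\<theta>. ennreal (norm (g (of_real r * cis \<theta>)) powr p) \<partial>circ) \<le> ennreal (B powr p)" if r: "0 < r" "r < 1" for r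
  proof (rule nn_integral_limit_le)
    show "(\<lambda>\<theta>. ennreal (norm (F (\<sigma> n) (of_real r * cis \<theta>)) powr p)) \<in> borel_measurable circ" for n
      using borel_measurable_continuous_onI[OF continuous_on_circle_powr[OF hol, of r p "\<sigma> n"]] r p
        measurable_cong_sets[OF sets_circ refl] by auto
    show "(\<lambda>n. ennreal (norm (F (\<sigma> n) (of_real r * cis \<theta>)) powr p)) \<longlonglongrightarrow> ennreal (norm (g (of_real r * cis \<theta>)) powr p)" for \<theta>
      using r p by (intro tendsto_ennrealI tendsto_powr2 tendsto_norm tendsto_const g(3)) (auto simp: norm_mult)
    show "(\<integral>\<^sup>+\<theta>. ennreal (norm (F (\<sigma> n) (of_real r * cis \<theta>)) powr p) \<partial>circ) \<le> ennreal (B powr p)" for n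
      using p r hardy_norm_nonneg[OF F] B
      by (intro order_trans[OF hardy_circle_le[OF F]] ennreal_leI powr_mono2) auto
  qed
  have "g \<in> hardy p" "hardy_norm p g \<le> (B powr p) powr (1 / p)"
    using hardyI[OF g(1) _ _ gB] p by auto
  moreover have "(B powr p) powr (1 / p) = B" using B0 p by (simp add: powr_powr)
  ultimately show ?thesis using that[of g \<sigma>] g by (simp add: o_def)
qed

lemma (in tail_measure) DH_diff:
  assumes f: "f \<in> hardy p" and g: "g \<in> hardy p" and p: "1 \<le> p" and z: "norm z < 1"
  shows "DH \<mu> (\<lambda>w. f w - g w) z = DH \<mu> f z - DH \<mu> g z"
proof -
  have h: "(\<lambda>w. f w - g w) \<in> hardy p" using hardy_diff[OF f g] p by simp
  have "DH \<mu> (\<lambda>w. f w - g w) z = (LINT t|\<mu>. f (of_real t) / (1 - of_real t * z)\<^sup>2 - g (of_real t) / (1 - of_real t * z)\<^sup>2)"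
    unfolding DH_representation(4)[OF h p z] by (simp add: diff_divide_distrib)
  also have "\<dots> = DH \<mu> f z - DH \<mu> g z"
    unfolding DH_representation(4)[OF f p z] DH_representation(4)[OF g p z]
    by (intro Bochner_Integration.integral_diff DH_representation(3)[OF _ p z] f g)
  finally show ?thesis .
qed

lemma compact_if_vanishing:
  assumes p: "1 \<le> p" "p \<le> 2" and \<mu>: "borel_measure_on_unit \<mu>" and van: "vanishing_carleson 2 \<mu>"
  shows "hardy_compact_operator p (DH \<mu>)"
proof -
  obtain C where C: "0 < C" "\<And>t. t \<in> {0..<1} \<Longrightarrow> emeasure \<mu> {t..<1} \<le> ennreal (C * (1 - t) powr 2)"
    using van by (auto simp: vanishing_carleson_def carleson_def)
  have T: "tail_measure \<mu> C" by (rule tail_measureI[OF \<mu> C])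
  interpret tail_measure \<mu> C by (rule T)
  show ?thesis
    unfolding hardy_compact_operator_def
  proof (intro conjI ballI allI impI)
    show "DH \<mu> f \<in> hardy p" if "f \<in> hardy p" for f by (rule DH_in_hardy[OF that p])
    show "hardy_linear p (DH \<mu>)" by (rule DH_linear[OF p])
    fix F :: "nat \<Rightarrow> complex \<Rightarrow> complex"
    assume "(\<forall>j. F j \<in> hardy p) \<and> bdd_above (range (\<lambda>j. hardy_norm p (F j)))"
    then obtain B where F: "\<And>j. F j \<in> hardy p" and B: "\<And>j. hardy_norm p (F j) \<le> B"
      by (auto simp: bdd_above_def)
    obtain g \<sigma> where g: "g \<in> hardy p" "strict_mono (\<sigma> :: nat \<Rightarrow> nat)" "hardy_norm p g \<le> B"
      "\<And>K. compact K \<Longrightarrow> K \<subseteq> ball 0 1 \<Longrightarrow> uniform_limit K (\<lambda>j. F (\<sigma> j)) g sequentially"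
      by (rule hardy_montel[OF F p(1) B]) (rule that)
    define h where "h j = (\<lambda>z. F (\<sigma> j) z - g z)" for j
    have h: "h j \<in> hardy p" for j
      unfolding h_def using hardy_diff[OF F g(1)] p by simp
    define M where "M = 2 powr p * (B powr p + B powr p)"
    have M0: "0 \<le> M" by (simp add: M_def)
    have le_B: "(\<integral>\<^sup>+\<theta>. ennreal (norm (f (of_real r * cis \<theta>)) powr p) \<partial>circ) \<le> ennreal (B powr p)"
      if "f \<in> hardy p" "hardy_norm p f \<le> B" "0 < r" "r < 1" for f r
      using that p hardy_norm_nonneg[OF that(1)]
      by (intro order_trans[OF hardy_circle_le[OF that(1)]] ennreal_leI powr_mono2) auto
    have hM: "(\<integral>\<^sup>+\<theta>. ennreal (norm (h j (of_real r * cis \<theta>)) powr p) \<partial>circ) \<le> ennreal M" if r: "0 < r" "r < 1" for j r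
      unfolding h_def M_def using F g p r B
      by (intro circle_diff_le le_B) (auto simp: hardy_def)
    define D where "D j = (\<lambda>z. DH \<mu> (F (\<sigma> j)) z - DH \<mu> g z)" for j
    have D: "D j \<in> hardy p" for j
      unfolding D_def using p by (intro hardy_diff DH_in_hardy F g(1)) auto
    have Dh: "D j z = DH \<mu> (h j) z" if "norm z < 1" for j z
      unfolding D_def h_def using DH_diff[OF F g(1) p(1) that] by simp
    have ev: "eventually (\<lambda>j. hardy_norm p (D j) \<le> \<eta>) sequentially" if \<eta>: "0 < \<eta>" for \<eta>
    proof -
      \<comment> \<open>\<delta> and \<epsilon> are solved from the requirement that each of the two
        terms of the split bound be at most half of \<eta>^p; M + 1 keeps the division legitimate
        when M = 0.\<close>
      define \<delta> where "\<delta> = (\<eta> powr p / (2 * 2 powr p)) powr (1 / p)"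
      define \<epsilon> where "\<epsilon> = (\<eta> powr p / (2 * 2 powr p * 24300 * (M + 1))) powr (1 / p)"
      have \<delta>: "0 < \<delta>" "\<delta> powr p = \<eta> powr p / (2 * 2 powr p)"
        using \<eta> p by (auto simp: \<delta>_def powr_powr)
      have \<epsilon>: "0 < \<epsilon>" "\<epsilon> powr p = \<eta> powr p / (2 * 2 powr p * 24300 * (M + 1))"
        using \<eta> p M0 by (auto simp: \<epsilon>_def powr_powr)
      have total: "2 powr p * (24300 * \<epsilon> powr p * M + \<delta> powr p) \<le> \<eta> powr p"
      proof -
        have gen: "x * (24300 * (e / (2 * x * 24300 * y)) * M) = e / 2 * (M / y)" if "x \<noteq> 0" "y \<noteq> 0" for x y e :: real
          using that by (simp add: field_simps)
        have "2 powr p * (24300 * \<epsilon> powr p * M) = \<eta> powr p / 2 * (M / (M + 1))"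
          unfolding \<epsilon> by (rule gen) (use M0 in auto)
        also have "\<dots> \<le> \<eta> powr p / 2 * 1"
          using M0 by (intro mult_left_mono) auto
        finally have "2 powr p * (24300 * \<epsilon> powr p * M) \<le> \<eta> powr p / 2" by (simp only: mult_1_right)
        moreover have "2 powr p * \<delta> powr p = \<eta> powr p / 2" unfolding \<delta> by simp
        ultimately show ?thesis unfolding distrib_left by linarith
      qed
      obtain \<rho> where \<rho>: "0 \<le> \<rho>" "\<rho> < 1" and T': "tail_measure (density \<mu> (indicator {\<rho>..<1})) \<epsilon>"
        using vanishing_tail[OF T van \<epsilon>(1)] by blast
      have K: "compact (of_real ` {0..\<rho>} :: complex set)" "of_real ` {0..\<rho>} \<subseteq> ball (0::complex) 1"
        using \<rho> by (auto intro!: compact_continuous_image continuous_intros)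
      have "0 < \<delta> * (1 - \<rho>)\<^sup>2 / C" using \<delta> \<rho> C by simp
      from uniform_limitD[OF g(4)[OF K] this]
      have "eventually (\<lambda>j. \<forall>z\<in>of_real ` {0..\<rho>}. dist (F (\<sigma> j) z) (g z) < \<delta> * (1 - \<rho>)\<^sup>2 / C) sequentially" .
      then show ?thesis
      proof eventually_elim
        case (elim j)
        have small: "norm (h j (of_real t)) \<le> \<delta> * (1 - \<rho>)\<^sup>2 / C" if "0 \<le> t" "t \<le> \<rho>" for t
          using elim that by (force simp: h_def dist_norm)
        have "hardy_norm p (D j) \<le> (\<eta> powr p) powr (1 / p)"
        proof (rule hardyI(2))
          show "D j holomorphic_on ball 0 1" using D[of j] by (simp add: hardy_def)
          fix r :: real assume r: "0 < r" "r < 1"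
          have "(\<integral>\<^sup>+\<theta>. ennreal (norm (D j (of_real r * cis \<theta>)) powr p) \<partial>circ)
              = (\<integral>\<^sup>+\<theta>. ennreal (norm (DH \<mu> (h j) (of_real r * cis \<theta>)) powr p) \<partial>circ)"
            using r by (intro nn_integral_cong) (simp add: Dh norm_mult)
          also have "\<dots> \<le> ennreal (2 powr p * (24300 * \<epsilon> powr p * M + \<delta> powr p))"
            by (rule DH_circle_bound_split[OF T T' \<rho> p h M0 hM \<delta>(1) small r])
          also have "\<dots> \<le> ennreal (\<eta> powr p)" by (rule ennreal_leI[OF total])
          finally show "(\<integral>\<^sup>+\<theta>. ennreal (norm (D j (of_real r * cis \<theta>)) powr p) \<partial>circ) \<le> ennreal (\<eta> powr p)" .
        qed (use p in auto)
        then show ?case using \<eta> p by (simp add: powr_powr)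
      qed
    qed
    have "(\<lambda>j. hardy_norm p (D j)) \<longlonglongrightarrow> 0"
    proof (rule order_tendstoI)
      show "eventually (\<lambda>j. a < hardy_norm p (D j)) sequentially" if "a < 0" for a
        using hardy_norm_nonneg[OF D] that by (intro always_eventually allI) (rule order_less_le_trans)
      show "eventually (\<lambda>j. hardy_norm p (D j) < a) sequentially" if "0 < a" for a
        using ev[of "a / 2"] that by (auto elim: eventually_mono)
    qed
    then show "\<exists>g\<in>hardy p. \<exists>\<sigma>::nat \<Rightarrow> nat. strict_mono \<sigma> \<and> (\<lambda>j. hardy_norm p (\<lambda>z. DH \<mu> (F (\<sigma> j)) z - g z)) \<longlonglongrightarrow> 0"
      using g(2) DH_in_hardy[OF g(1) p] unfolding D_def by blast
  qed
qed

section \<open>Necessity\<close>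

text \<open>Normalised so that the \<open>p\<close>-th power of the modulus is dominated by the Poisson kernel.\<close>

definition test_fun :: "real \<Rightarrow> real \<Rightarrow> complex \<Rightarrow> complex" where
  "test_fun p a z = of_real ((1 - a) powr (2 - 1 / p)) / (1 - of_real a * z)\<^sup>2"

lemma test_fun_nz:
  assumes "0 \<le> a" "a < 1" "norm z \<le> 1"
  shows "1 - of_real a * z \<noteq> (0::complex)" "1 - a \<le> norm (1 - of_real a * z)"
proof -
  have "norm (of_real a * z) \<le> a"
    using assms by (simp add: norm_mult mult_left_le)
  then show "1 - a \<le> norm (1 - of_real a * z)"
    using norm_triangle_ineq2[of 1 "of_real a * z"] by simp
  then show "1 - of_real a * z \<noteq> 0" using assms by auto
qed

lemma test_fun_holomorphic: "0 \<le> a \<Longrightarrow> a < 1 \<Longrightarrow> test_fun p a holomorphic_on ball 0 1"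
  unfolding test_fun_def using test_fun_nz(1) by (intro holomorphic_intros) auto

text \<open>With n = |1 - a z| \<ge> 1 - a, the p-th power (1 - a)^(2p-1) n^(-2p) is at most (1 - a)
  n^(-2), since 2p - 2 \<ge> 0. This lies below the Poisson kernel at a r, whose mean is 1.\<close>

lemma test_fun_hardy:
  assumes p: "1 \<le> p" and a: "0 \<le> a" "a < 1"
  shows "test_fun p a \<in> hardy p" "hardy_norm p (test_fun p a) \<le> 1"
proof -
  have le: "(\<integral>\<^sup>+\<theta>. ennreal (norm (test_fun p a (of_real r * cis \<theta>)) powr p) \<partial>circ) \<le> ennreal 1" if r: "0 < r" "r < 1" for r
  proof -
    have ar: "0 \<le> a * r" "a * r < 1"
      using r a mult_strict_mono'[of a 1 r 1] by auto
    have "(\<integral>\<^sup>+\<theta>. ennreal (norm (test_fun p a (of_real r * cis \<theta>)) powr p) \<partial>circ) \<le> (\<integral>\<^sup>+\<theta>. ennreal (pois (a * r) \<theta>) \<partial>circ)"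
    proof (intro nn_integral_mono ennreal_leI)
      fix \<theta>
      define n where "n = norm (1 - of_real (a * r) * cis \<theta>)"
      have n: "1 - a \<le> n"
        using test_fun_nz(2)[OF a, of "of_real r * cis \<theta>"] r by (simp add: n_def norm_mult mult.assoc)
      then have n0: "0 < n" using a by simp
      have "norm (test_fun p a (of_real r * cis \<theta>)) = (1 - a) powr (2 - 1 / p) / n\<^sup>2"
        by (simp add: test_fun_def n_def norm_divide norm_power mult.assoc)
      also have "\<dots> = (1 - a) powr (2 - 1 / p) * n powr (-2)"
        using n0 by (simp add: powr_minus divide_inverse)
      finally have "norm (test_fun p a (of_real r * cis \<theta>)) powr p = ((1 - a) powr (2 - 1 / p) * n powr (-2)) powr p"
        by simp
      also have "\<dots> = (1 - a) powr ((2 - 1 / p) * p) * n powr (-2 * p)"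
        by (simp add: powr_mult powr_powr)
      also have "(2 - 1 / p) * p = 2 * p - 1" using p by (simp add: field_simps)
      also have "n powr (-2 * p) = n powr (- (2 * p - 2)) * n powr (-2)"
        by (subst powr_add[symmetric]) simp
      also have "(1 - a) powr (2 * p - 1) * (n powr (- (2 * p - 2)) * n powr (-2))
          \<le> (1 - a) powr (2 * p - 1) * ((1 - a) powr (- (2 * p - 2)) * n powr (-2))"
        using p a n by (intro mult_left_mono mult_right_mono powr_mono2') auto
      also have "\<dots> = ((1 - a) powr (2 * p - 1) * (1 - a) powr (- (2 * p - 2))) * n powr (-2)"
        by (rule mult.assoc[symmetric])
      also have "(1 - a) powr (2 * p - 1) * (1 - a) powr (- (2 * p - 2)) = 1 - a"
        using a by (subst powr_add[symmetric]) simp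
      also have "(1 - a) * n powr (-2) \<le> (1 - (a * r)\<^sup>2) * n powr (-2)"
      proof (rule mult_right_mono)
        have "(a * r) * (a * r) \<le> a * 1"
          using ar r a by (intro mult_mono) (auto simp: mult_left_le)
        then show "1 - a \<le> 1 - (a * r)\<^sup>2" by (simp add: power2_eq_square)
      qed simp
      also have "\<dots> = pois (a * r) \<theta>"
        using n0 by (simp add: pois_def n_def powr_minus divide_inverse)
      finally show "norm (test_fun p a (of_real r * cis \<theta>)) powr p \<le> pois (a * r) \<theta>" .
    qed
    then show ?thesis using nn_integral_pois[OF ar] by simp
  qed
  show "test_fun p a \<in> hardy p"
    using hardyI(1)[OF test_fun_holomorphic[OF a] _ _ le] p by simp
  show "hardy_norm p (test_fun p a) \<le> 1"
    using hardyI(2)[OF test_fun_holomorphic[OF a] _ _ le] p by simp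
qed

lemma test_fun_coeff:
  assumes a: "0 \<le> a" "a < 1"
  shows "norm (fps_nth (fps_expansion (test_fun p a) 0) k) = (1 - a) powr (2 - 1 / p) * (real (Suc k) * a ^ k)"
proof -
  define c where "c = (1 - a) powr (2 - 1 / p)"
  define F where "F = Abs_fps (\<lambda>k. of_real c * (of_nat (Suc k) * of_real a ^ k) :: complex)"
  have "test_fun p a has_fps_expansion F"
  proof (rule has_fps_expansionI)
    have "eventually (\<lambda>u::complex. u \<in> ball 0 1) (nhds 0)"
      by (rule eventually_nhds_in_open) auto
    then show "eventually (\<lambda>u. (\<lambda>n. fps_nth F n * u ^ n) sums test_fun p a u) (nhds 0)"
    proof eventually_elim
      case (elim u)
      then have "norm (of_real a * u) \<le> 1 * norm u"
        using a unfolding norm_mult by (intro mult_right_mono) auto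
      then have "norm (of_real a * u) < 1" using elim by simp
      from sums_mult[OF geometric_deriv_sums[OF this], of "of_real c"]
      show ?case by (simp add: F_def test_fun_def c_def power_mult_distrib mult_ac)
    qed
  qed
  then have "fps_nth (fps_expansion (test_fun p a) 0) k = fps_nth F k"
    by (simp add: fps_nth_fps_expansion fps_expansion_def)
  then show ?thesis
    using a by (simp add: F_def c_def norm_mult norm_power del: of_nat_Suc)
qed

lemma test_fun_of_real:
  "test_fun p a (of_real t) = of_real ((1 - a) powr (2 - 1 / p) / (1 - a * t)\<^sup>2)"
  by (simp add: test_fun_def)

text \<open>A majorant independent of a, for dominated convergence as a tends to 1; it rests on 2 -
  1/p \<ge> 1.\<close>

lemma test_fun_le:
  assumes p: "1 \<le> p" and a: "0 \<le> a" "a < 1" and t: "0 \<le> t" "t < 1"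
  shows "norm (test_fun p a (of_real t)) \<le> inverse (1 - t)"
proof -
  have 1: "1 - a \<le> 1 - a * t" using a t by (simp add: mult_left_le)
  have 2: "1 - t \<le> 1 - a * t" using a t by (simp add: mult_left_le_one_le)
  have pos: "0 < 1 - a * t" using 1 a by simp
  have "(1 - a) powr (2 - 1 / p) \<le> (1 - a) powr 1"
    using a p by (intro powr_mono') auto
  then have "(1 - a) powr (2 - 1 / p) \<le> 1 - a * t" using 1 a by simp
  then have "(1 - a) powr (2 - 1 / p) / (1 - a * t)\<^sup>2 \<le> (1 - a * t) / (1 - a * t)\<^sup>2"
    by (intro divide_right_mono) auto
  also have "\<dots> = inverse (1 - a * t)" using pos by (simp add: power2_eq_square divide_inverse)
  also have "\<dots> \<le> inverse (1 - t)" using 2 t by (intro le_imp_inverse_le) auto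
  finally show ?thesis unfolding test_fun_of_real norm_of_real by simp
qed

section \<open>Test functions against compactness, for a finite measure\<close>

context
  fixes \<mu> :: "real measure" and p :: real
  assumes sets: "sets \<mu> = sets (restrict_space borel {0..<1})" and fin: "finite_measure \<mu>" and p: "1 \<le> p"
begin

text \<open>The moments are bounded by the total mass, and the coefficients decay
  geometrically.\<close>

lemma test_fun_summable:
  assumes a: "0 \<le> a" "a < 1"
  shows "summable (\<lambda>k. moment \<mu> k * norm (fps_nth (fps_expansion (test_fun p a) 0) k))"
proof -
  interpret finite_measure \<mu> by (rule fin)
  have sp: "space \<mu> = {0..<1}" by (rule space_restrict_unit[OF sets])
  have [measurable]: "(\<lambda>t. t) \<in> borel_measurable \<mu>"
    by (rule measurable_restrict_unit[OF sets]) (intro continuous_intros)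
  have int_pow: "integrable \<mu> (\<lambda>t. t ^ n)" for n
    by (intro integrable_const_bound[where B = 1] AE_I2) (auto simp: sp power_le_one)
  have m: "0 \<le> moment \<mu> k" "moment \<mu> k \<le> moment \<mu> 0" for k
    unfolding moment_def using int_pow
    by (auto intro!: integral_nonneg_AE AE_I2 integral_mono simp: sp power_le_one simp del: power_0 lebesgue_integral_const)
       (auto intro!: integral_mono simp: sp power_le_one)
  have "summable (\<lambda>k. real (Suc k) * a ^ k)"
    using geometric_deriv_sums[of a] a by (intro sums_summable) auto
  then have s: "summable (\<lambda>k. moment \<mu> 0 * ((1 - a) powr (2 - 1 / p) * (real (Suc k) * a ^ k)))"
    by (intro summable_mult)
  show ?thesis
    unfolding test_fun_coeff[OF a]
    by (rule summable_comparison_test[OF _ s])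
       (use m a in \<open>auto intro!: exI[of _ 0] mult_right_mono simp: abs_mult simp del: of_nat_Suc\<close>)
qed

text \<open>At z = a the integrand is the positive function c / (1 - a t)^4. On [a,1) one has 1 - a
  t \<le> 1 - a^2 \<le> 2 (1 - a), whence 16 = 2^4; and (1 - a)^(1/p) c = (1 - a)^2 leaves the
  exponent 2.\<close>

lemma DH_test_fun_lower:
  assumes a: "0 \<le> a" "a < 1"
  shows "measure \<mu> {a..<1} / (1 - a) powr 2 \<le> 16 * (1 - a) powr (1 / p) * norm (DH \<mu> (test_fun p a) (of_real a))"
proof -
  interpret finite_measure \<mu> by (rule fin)
  have sp: "space \<mu> = {0..<1}" by (rule space_restrict_unit[OF sets])
  have [measurable]: "{a..<1} \<in> sets \<mu>" by (rule sets_Ico[OF sets a(1)])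
  have z: "norm (of_real a :: complex) < 1" using a by simp
  note rep = DH_integral_representation[OF sets fin test_fun_holomorphic[OF a] test_fun_summable[OF a]]
  define c where "c = (1 - a) powr (2 - 1 / p)"
  have c: "0 < c" using a by (simp add: c_def)
  have eq: "test_fun p a (of_real t) / (1 - of_real t * of_real a)\<^sup>2 = of_real (c / (1 - a * t) ^ 4)" for t
    by (simp add: test_fun_def c_def mult.commute power_add[symmetric] flip: of_real_mult)
  have int: "integrable \<mu> (\<lambda>t. c / (1 - a * t) ^ 4)"
    using rep(3)[OF z] unfolding eq complex_of_real_integrable_eq .
  have "DH \<mu> (test_fun p a) (of_real a) = of_real (LINT t|\<mu>. c / (1 - a * t) ^ 4)"
    unfolding rep(4)[OF z] eq by (rule integral_complex_of_real)
  then have "norm (DH \<mu> (test_fun p a) (of_real a)) \<ge> (LINT t|\<mu>. c / (1 - a * t) ^ 4)"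
    by simp
  moreover have "(LINT t|\<mu>. c / (16 * (1 - a) ^ 4) * indicator {a..<1} t) \<le> (LINT t|\<mu>. c / (1 - a * t) ^ 4)"
  proof (rule integral_mono[OF _ int])
    show "integrable \<mu> (\<lambda>t. c / (16 * (1 - a) ^ 4) * indicator {a..<1} t)"
      by (intro integrable_mult_right integrable_real_indicator) (auto simp: emeasure_eq_measure)
    fix t assume "t \<in> space \<mu>"
    then have t: "0 \<le> t" "t < 1" by (auto simp: sp)
    have pos: "0 < 1 - a * t" using mult_left_le[of t a] a t by simp
    show "c / (16 * (1 - a) ^ 4) * indicator {a..<1} t \<le> c / (1 - a * t) ^ 4"
    proof (cases "a \<le> t")
      case True
      have "a * a \<le> a * t" using True a by (intro mult_left_mono) auto
      moreover have "1 - a * a = (1 + a) * (1 - a)" by (simp add: algebra_simps)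
      moreover have "(1 + a) * (1 - a) \<le> 2 * (1 - a)" using a by (intro mult_right_mono) auto
      ultimately have "1 - a * t \<le> 2 * (1 - a)" by linarith
      then have "(1 - a * t) ^ 4 \<le> (2 * (1 - a)) ^ 4" using pos by (intro power_mono) auto
      also have "\<dots> = 16 * (1 - a) ^ 4" unfolding power_mult_distrib by simp
      finally show ?thesis using c pos t True by (auto intro!: divide_left_mono mult_pos_pos)
    next
      case False
      then show ?thesis using c pos by simp
    qed
  qed
  moreover have "(LINT t|\<mu>. c / (16 * (1 - a) ^ 4) * indicator {a..<1} t) = c / (16 * (1 - a) ^ 4) * measure \<mu> {a..<1}"
  proof -
    have "{a..<1} \<inter> space \<mu> = {a..<1}" using a by (auto simp: sp)
    then show ?thesis by simp
  qed
  ultimately have le: "c / (16 * (1 - a) ^ 4) * measure \<mu> {a..<1} \<le> norm (DH \<mu> (test_fun p a) (of_real a))" by linarith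
  have "(1 - a) powr (1 / p) * c = (1 - a)\<^sup>2"
    unfolding c_def using a by (subst powr_add[symmetric]) simp
  then have "16 * (1 - a) powr (1 / p) * (c / (16 * (1 - a) ^ 4) * measure \<mu> {a..<1}) = (1 - a)\<^sup>2 / (1 - a) ^ 4 * measure \<mu> {a..<1}"
    by (simp add: field_simps)
  also have "\<dots> = measure \<mu> {a..<1} / (1 - a) powr 2"
    using a by (simp add: power2_eq_square power4_eq_xxxx)
  finally show ?thesis
    using mult_left_mono[OF le, of "16 * (1 - a) powr (1 / p)"] by simp
qed

text \<open>The factor (1 - a)^(1/p) of the lower bound exactly balances the growth of point
  evaluation at a, so norm distance to G controls the Carleson ratio up to the value of G. Here 32 =
  16 * 2 with 2 \<ge> 2^(1/p).\<close>

lemma ratio_le: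
  assumes G: "G \<in> hardy p" and D: "(\<lambda>z. DH \<mu> (test_fun p a) z - G z) \<in> hardy p" and a: "0 \<le> a" "a < 1"
  shows "measure \<mu> {a..<1} / (1 - a) powr 2
    \<le> 32 * hardy_norm p (\<lambda>z. DH \<mu> (test_fun p a) z - G z) + 16 * (1 - a) powr (1 / p) * norm (G (of_real a))"
    and "(1 - a) powr (1 / p) * norm (G (of_real a)) \<le> 2 * hardy_norm p G"
proof -
  have grow: "(1 - a) powr (1 / p) * norm (f (of_real a)) \<le> 2 * hardy_norm p f" if f: "f \<in> hardy p" for f
  proof -
    have "(1 - a) powr (1 / p) * norm (f (of_real a)) \<le> (1 - a) powr (1 / p) * ((2 / (1 - a)) powr (1 / p) * hardy_norm p f)"
      using p a by (intro mult_left_mono hardy_growth f) auto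
    also have "\<dots> = 2 powr (1 / p) * hardy_norm p f"
      using a by (simp add: powr_divide)
    also have "\<dots> \<le> 2 powr 1 * hardy_norm p f"
      using p hardy_norm_nonneg[OF f] by (intro mult_right_mono powr_mono) auto
    finally show ?thesis by simp
  qed
  show "(1 - a) powr (1 / p) * norm (G (of_real a)) \<le> 2 * hardy_norm p G" by (rule grow[OF G])
  let ?w = "(1 - a) powr (1 / p)" and ?d = "DH \<mu> (test_fun p a) (of_real a)"
  have "norm ?d \<le> norm (?d - G (of_real a)) + norm (G (of_real a))"
    by (metis norm_triangle_sub add.commute)
  then have "16 * ?w * norm ?d \<le> 16 * ?w * (norm (?d - G (of_real a)) + norm (G (of_real a)))"
    by (intro mult_left_mono) auto
  also have "\<dots> = 16 * (?w * norm (?d - G (of_real a))) + 16 * ?w * norm (G (of_real a))"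
    by (simp add: algebra_simps)
  finally show "measure \<mu> {a..<1} / (1 - a) powr 2
    \<le> 32 * hardy_norm p (\<lambda>z. DH \<mu> (test_fun p a) z - G z) + 16 * (1 - a) powr (1 / p) * norm (G (of_real a))"
    using DH_test_fun_lower[OF a] grow[OF D] by linarith
qed

lemma compact_test_sequence:
  assumes K: "hardy_compact_operator p (DH \<mu>)" and a: "\<And>n. 0 \<le> a n" "\<And>n. a n < 1"
  obtains G \<sigma> where "G \<in> hardy p" "strict_mono (\<sigma> :: nat \<Rightarrow> nat)"
    "\<And>n. (\<lambda>z. DH \<mu> (test_fun p (a n)) z - G z) \<in> hardy p"
    "(\<lambda>n. hardy_norm p (\<lambda>z. DH \<mu> (test_fun p (a (\<sigma> n))) z - G z)) \<longlonglongrightarrow> 0"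
proof -
  have th: "test_fun p (a n) \<in> hardy p" "hardy_norm p (test_fun p (a n)) \<le> 1" for n
    using test_fun_hardy[OF p a(1)[of n] a(2)[of n]] by auto
  then have bdd: "bdd_above (range (\<lambda>n. hardy_norm p (test_fun p (a n))))"
    by (auto intro!: bdd_aboveI2[where M = 1])
  note K' = K[unfolded hardy_compact_operator_def]
  have DH: "DH \<mu> f \<in> hardy p" if "f \<in> hardy p" for f
    using K'[THEN conjunct1] that by (rule bspec)
  note K'[THEN conjunct2, THEN conjunct2, THEN spec[where x = "\<lambda>n. test_fun p (a n)"], THEN mp]
  from this[OF conjI, OF allI bdd, OF th(1)]
  obtain G \<sigma> where G: "G \<in> hardy p" "strict_mono (\<sigma> :: nat \<Rightarrow> nat)"
    "(\<lambda>n. hardy_norm p (\<lambda>z. DH \<mu> (test_fun p (a (\<sigma> n))) z - G z)) \<longlonglongrightarrow> 0"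
    by (elim bexE exE conjE) (rule that)
  have "(\<lambda>z. DH \<mu> (test_fun p (a n)) z - G z) \<in> hardy p" for n
    using p by (intro hardy_diff DH th(1) G(1)) auto
  then show ?thesis by (rule that[OF G(1,2) _ G(3)])
qed

text \<open>\<open>hardy_compact_operator\<close> provides convergent subsequences but no explicit
  operator norm, so an unbounded ratio is refuted along a subsequence of images converging to some
  G: there the ratio stays below 32 + 32 times the norm of G.\<close>

lemma carleson2_if_compact:
  assumes K: "hardy_compact_operator p (DH \<mu>)"
  shows "\<exists>C>0. \<forall>a\<in>{0..<1}. measure \<mu> {a..<1} / (1 - a) powr 2 \<le> C"
proof (rule ccontr)
  assume neg: "\<not> ?thesis"
  have "\<exists>a\<in>{0..<1}. real (Suc n) < measure \<mu> {a..<1} / (1 - a) powr 2" for n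
  proof (rule ccontr)
    assume "\<not> ?thesis"
    then have "0 < real (Suc n) \<and> (\<forall>a\<in>{0..<1}. measure \<mu> {a..<1} / (1 - a) powr 2 \<le> real (Suc n))"
      by (auto simp: not_less)
    then show False using neg by blast
  qed
  then obtain a where a: "\<And>n. a n \<in> {0..<1}" "\<And>n. real (Suc n) < measure \<mu> {a n..<1} / (1 - a n) powr 2"
    by metis
  then have a01: "0 \<le> a n" "a n < 1" for n using a(1)[of n] by auto
  obtain G \<sigma> where G: "G \<in> hardy p" "strict_mono (\<sigma> :: nat \<Rightarrow> nat)"
    "\<And>n. (\<lambda>z. DH \<mu> (test_fun p (a n)) z - G z) \<in> hardy p"
    "(\<lambda>n. hardy_norm p (\<lambda>z. DH \<mu> (test_fun p (a (\<sigma> n))) z - G z)) \<longlonglongrightarrow> 0"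
    by (rule compact_test_sequence[OF K a01]) (rule that)
  have "eventually (\<lambda>n. hardy_norm p (\<lambda>z. DH \<mu> (test_fun p (a (\<sigma> n))) z - G z) < 1) sequentially"
    using order_tendstoD(2)[OF G(4), of 1] by simp
  moreover have "eventually (\<lambda>n. 32 + 32 * hardy_norm p G < real n) sequentially"
    using eventually_gt_at_top filterlim_real_sequentially unfolding filterlim_at_top_dense by blast
  ultimately have "eventually (\<lambda>n. False) sequentially"
  proof eventually_elim
    case (elim n)
    have "real n \<le> real (Suc (\<sigma> n))" using seq_suble[OF G(2), of n] by simp
    also have "\<dots> < measure \<mu> {a (\<sigma> n)..<1} / (1 - a (\<sigma> n)) powr 2" by (rule a(2))
    also have "\<dots> \<le> 32 * hardy_norm p (\<lambda>z. DH \<mu> (test_fun p (a (\<sigma> n))) z - G z)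
        + 16 * (1 - a (\<sigma> n)) powr (1 / p) * norm (G (of_real (a (\<sigma> n))))"
      by (rule ratio_le(1)[OF G(1) G(3) a01])
    finally show ?case
      using ratio_le(2)[OF G(1) G(3) a01, of "\<sigma> n"] elim by linarith
  qed
  then show False by simp
qed

text \<open>The 2-Carleson bound has to be secured first: it makes 1 / (1 - t) integrable, the
  majorant in the limit below, and puts the test functions within reach of
  \<open>tail_measure\<close>.\<close>

lemma vanishing_if_compact:
  assumes K: "hardy_compact_operator p (DH \<mu>)"
  shows "vanishing_carleson 2 \<mu>"
proof -
  interpret finite_measure \<mu> by (rule fin)
  obtain C where C: "0 < C" "\<And>a. a \<in> {0..<1} \<Longrightarrow> measure \<mu> {a..<1} / (1 - a) powr 2 \<le> C"
    using carleson2_if_compact[OF K] by blast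
  have C2: "emeasure \<mu> {t..<1} \<le> ennreal (C * (1 - t) powr 2)" if t: "t \<in> {0..<1}" for t
    using C(2)[OF t] t unfolding emeasure_eq_measure
    by (intro ennreal_leI) (simp add: divide_le_eq)
  have T: "tail_measure \<mu> C"
    by (rule tail_measureI) (use C C2 sets in \<open>auto simp: borel_measure_on_unit_def\<close>)
  interpret tail_measure \<mu> C by (rule T)
  have "((\<lambda>t. measure \<mu> {t..<1} / (1 - t) powr 2) \<longlongrightarrow> 0) (at_left 1)"
  proof (rule ccontr)
    assume "\<not> ?thesis"
    then obtain \<epsilon> where \<epsilon>: "0 < \<epsilon>" and
      ne: "\<not> eventually (\<lambda>t. dist (measure \<mu> {t..<1} / (1 - t) powr 2) 0 < \<epsilon>) (at_left 1)"
      unfolding tendsto_iff by auto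
    have "\<exists>t. 1 - 1 / real (Suc n) < t \<and> t < 1 \<and> \<epsilon> \<le> measure \<mu> {t..<1} / (1 - t) powr 2" for n
    proof (rule ccontr)
      assume *: "\<not> ?thesis"
      have "eventually (\<lambda>t. dist (measure \<mu> {t..<1} / (1 - t) powr 2) 0 < \<epsilon>) (at_left 1)"
        unfolding eventually_at_left_field
        by (rule exI[of _ "1 - 1 / real (Suc n)"]) (use * in \<open>auto simp: not_le\<close>)
      then show False using ne by blast
    qed
    then obtain a where a: "\<And>n. 1 - 1 / real (Suc n) < a n" "\<And>n. a n < 1"
      "\<And>n. \<epsilon> \<le> measure \<mu> {a n..<1} / (1 - a n) powr 2" by metis
    have a0: "0 \<le> a n" for n
    proof -
      have "0 \<le> 1 - 1 / real (Suc n)" by simp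
      then show ?thesis using a(1)[of n] by linarith
    qed
    have a_lim: "a \<longlonglongrightarrow> 1"
    proof (rule tendsto_sandwich)
      have "(\<lambda>n. 1 - 1 / real (Suc n)) \<longlonglongrightarrow> 1 - 0"
        by (intro tendsto_diff tendsto_const lim_1_over_n[THEN LIMSEQ_Suc])
      then show "(\<lambda>n. 1 - 1 / real (Suc n)) \<longlonglongrightarrow> 1" by simp
      show "eventually (\<lambda>n. 1 - 1 / real (Suc n) \<le> a n) sequentially"
        using a(1) by (intro always_eventually allI less_imp_le)
      show "eventually (\<lambda>n. a n \<le> 1) sequentially"
        using a(2) by (intro always_eventually allI less_imp_le)
    qed simp
    obtain G \<sigma> where G: "G \<in> hardy p" "strict_mono (\<sigma> :: nat \<Rightarrow> nat)"
      "\<And>n. (\<lambda>z. DH \<mu> (test_fun p (a n)) z - G z) \<in> hardy p"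
      "(\<lambda>n. hardy_norm p (\<lambda>z. DH \<mu> (test_fun p (a (\<sigma> n))) z - G z)) \<longlonglongrightarrow> 0"
      by (rule compact_test_sequence[OF K a0 a(2)]) (rule that)
    have \<sigma>_lim: "(\<lambda>n. a (\<sigma> n)) \<longlonglongrightarrow> 1"
      using LIMSEQ_subseq_LIMSEQ[OF a_lim G(2)] by (simp add: o_def)
    \<comment> \<open>The images at b have two limits: G b, because norm convergence implies
      pointwise convergence, and 0, by dominated convergence. Real b suffice, since
      \<open>ratio_le\<close> evaluates G only at the points a.\<close>
    have G0: "G (of_real b) = 0" if b: "0 \<le> b" "b < 1" for b
    proof -
      have z: "norm (of_real b :: complex) < 1" using b by simp
      have "(\<lambda>n. DH \<mu> (test_fun p (a (\<sigma> n))) (of_real b) - G (of_real b)) \<longlonglongrightarrow> 0"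
      proof (rule tendsto_norm_zero_cancel, rule tendsto_sandwich[OF _ _ tendsto_const])
        show "(\<lambda>n. (2 / (1 - b)) powr (1 / p) * hardy_norm p (\<lambda>z. DH \<mu> (test_fun p (a (\<sigma> n))) z - G z)) \<longlonglongrightarrow> 0"
          using tendsto_mult_right_zero[OF G(4)] .
        show "eventually (\<lambda>n. norm (DH \<mu> (test_fun p (a (\<sigma> n))) (of_real b) - G (of_real b))
            \<le> (2 / (1 - b)) powr (1 / p) * hardy_norm p (\<lambda>z. DH \<mu> (test_fun p (a (\<sigma> n))) z - G z)) sequentially"
          using hardy_growth[OF G(3) _ b] p by (intro always_eventually allI) auto
      qed auto
      then have 1: "(\<lambda>n. DH \<mu> (test_fun p (a (\<sigma> n))) (of_real b)) \<longlonglongrightarrow> G (of_real b)"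
        by (rule LIM_zero_cancel)
      have "(\<lambda>n. LINT t|\<mu>. test_fun p (a (\<sigma> n)) (of_real t) / (1 - of_real t * of_real b)\<^sup>2) \<longlonglongrightarrow> (LINT t|\<mu>. 0)"
      \<comment> \<open>The first factor bounds the test functions by \<open>test_fun_le\<close>,
        the second bounds the kernel at the fixed point b.\<close>
      proof (rule integral_dominated_convergence[where w = "\<lambda>t. inverse (1 - t) * inverse ((1 - b)\<^sup>2)"])
        show "(\<lambda>t. test_fun p (a (\<sigma> n)) (of_real t) / (1 - of_real t * of_real b)\<^sup>2) \<in> borel_measurable \<mu>" for n
          using DH_representation(3)[OF test_fun_hardy(1)[OF p a0 a(2)] p z] by (rule borel_measurable_integrable)
        show "integrable \<mu> (\<lambda>t. inverse (1 - t) * inverse ((1 - b)\<^sup>2))"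
          by (intro integrable_mult_left integrable_inverse)
        show "AE t in \<mu>. (\<lambda>n. test_fun p (a (\<sigma> n)) (of_real t) / (1 - of_real t * of_real b)\<^sup>2) \<longlonglongrightarrow> 0"
        proof (rule AE_I2)
          fix t assume "t \<in> space \<mu>"
          then have t: "0 \<le> t" "t < 1" by (auto simp: space_mu)
          have e: "0 < 2 - 1 / p" using p by (simp add: field_simps)
          have "(\<lambda>n. (1 - a (\<sigma> n)) powr (2 - 1 / p) / (1 - a (\<sigma> n) * t)\<^sup>2) \<longlonglongrightarrow> (1 - 1) powr (2 - 1 / p) / (1 - 1 * t)\<^sup>2"
            using e t a(2) by (intro tendsto_intros \<sigma>_lim tendsto_powr2) (auto intro!: always_eventually less_imp_le)
          then have "(\<lambda>n. test_fun p (a (\<sigma> n)) (of_real t)) \<longlonglongrightarrow> of_real 0"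
            unfolding test_fun_of_real by (intro tendsto_of_real) simp
          moreover have "1 - t \<le> norm (1 - of_real t * of_real b :: complex)"
            using norm_one_minus_ge(1)[OF z, of t] t by simp
          then have "0 < norm (1 - of_real t * of_real b :: complex)"
            using t(2) by linarith
          then have "(1 - of_real t * of_real b :: complex)\<^sup>2 \<noteq> 0" by simp
          ultimately have "(\<lambda>n. test_fun p (a (\<sigma> n)) (of_real t) / (1 - of_real t * of_real b)\<^sup>2)
              \<longlonglongrightarrow> of_real 0 / (1 - of_real t * of_real b)\<^sup>2"
            by (intro tendsto_divide tendsto_const)
          then show "(\<lambda>n. test_fun p (a (\<sigma> n)) (of_real t) / (1 - of_real t * of_real b)\<^sup>2) \<longlonglongrightarrow> 0"
            by simp
        qed
        show "AE t in \<mu>. norm (test_fun p (a (\<sigma> n)) (of_real t) / (1 - of_real t * of_real b)\<^sup>2)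
            \<le> inverse (1 - t) * inverse ((1 - b)\<^sup>2)" for n
        proof (rule AE_I2)
          fix t assume "t \<in> space \<mu>"
          then have t: "0 \<le> t" "t < 1" by (auto simp: space_mu)
          have "1 - b \<le> norm (1 - of_real t * of_real b :: complex)"
          proof -
            have "t * b \<le> b" using t b by (simp add: mult_left_le_one_le)
            then have "1 - b \<le> \<bar>1 - t * b\<bar>" by linarith
            also have "\<dots> = norm (of_real (1 - t * b) :: complex)" by (rule norm_of_real[symmetric])
            finally show ?thesis unfolding of_real_diff of_real_mult of_real_1 .
          qed
          then have "(1 - b)\<^sup>2 \<le> (norm (1 - of_real t * of_real b :: complex))\<^sup>2"
            using b by (intro power_mono) auto
          then have "inverse ((norm (1 - of_real t * of_real b :: complex))\<^sup>2) \<le> inverse ((1 - b)\<^sup>2)"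
            using b by (intro le_imp_inverse_le) auto
          then show "norm (test_fun p (a (\<sigma> n)) (of_real t) / (1 - of_real t * of_real b)\<^sup>2)
            \<le> inverse (1 - t) * inverse ((1 - b)\<^sup>2)"
            unfolding norm_divide norm_power unfolding divide_inverse
            using test_fun_le[OF p a0 a(2) t] t by (intro mult_mono) auto
        qed
      qed simp
      then have 2: "(\<lambda>n. DH \<mu> (test_fun p (a (\<sigma> n))) (of_real b)) \<longlonglongrightarrow> 0"
        by (simp add: DH_representation(4)[OF test_fun_hardy(1)[OF p a0 a(2)] p z])
      show ?thesis by (rule LIMSEQ_unique[OF 1 2])
    qed
    have "eventually (\<lambda>n. hardy_norm p (\<lambda>z. DH \<mu> (test_fun p (a (\<sigma> n))) z - G z) < \<epsilon> / 32) sequentially"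
      using order_tendstoD(2)[OF G(4), of "\<epsilon> / 32"] \<epsilon> by simp
    then obtain n where n: "hardy_norm p (\<lambda>z. DH \<mu> (test_fun p (a (\<sigma> n))) z - G z) < \<epsilon> / 32"
      unfolding eventually_sequentially by auto
    have "\<epsilon> \<le> measure \<mu> {a (\<sigma> n)..<1} / (1 - a (\<sigma> n)) powr 2" by (rule a(3))
    also have "\<dots> \<le> 32 * hardy_norm p (\<lambda>z. DH \<mu> (test_fun p (a (\<sigma> n))) z - G z)"
      using ratio_le(1)[OF G(1) G(3) a0 a(2), of "\<sigma> n"] G0[OF a0 a(2)] by simp
    finally show False using n by simp
  qed
  then show ?thesis
    using C(1) C2 by (auto simp: vanishing_carleson_def carleson_def)
qed

end

lemma finite_measure_if_carleson:
  assumes "borel_measure_on_unit \<mu>" "carleson s \<mu>"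
  shows "finite_measure \<mu>"
proof
  have sp: "space \<mu> = {0..<1}"
    using space_restrict_unit assms(1) by (simp add: borel_measure_on_unit_def)
  obtain C where C: "\<And>t. t \<in> {0..<1} \<Longrightarrow> emeasure \<mu> {t..<1} \<le> ennreal (C * (1 - t) powr s)"
    using assms(2) unfolding carleson_def by blast
  show "emeasure \<mu> (space \<mu>) \<noteq> \<infinity>"
    unfolding sp using C[of 0] by (auto simp: top_unique)
qed

theorem theorem5p3:
  fixes p :: real and \<mu> :: "real measure"
  assumes "1 \<le> p" and "p \<le> 2"
    and "borel_measure_on_unit \<mu>"
    and "carleson 1 \<mu>"
  shows "hardy_compact_operator p (DH \<mu>) \<longleftrightarrow> vanishing_carleson 2 \<mu>"
  using vanishing_if_compact[OF _ finite_measure_if_carleson[OF assms(3,4)] assms(1)]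
    compact_if_vanishing[OF assms(1-3)] assms(3)
  by (auto simp: borel_measure_on_unit_def)

end
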